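(* Let $P\in L_2[0,1]$ be a self-similar function with self-similarity parameters $N$, $\{a_k\}_{k=1}^N$, $\{d_k\}_{k=1}^N$, $\{\beta_k\}_{k=1}^N$, which is arithmetically self-similar with step $\nu>0$ and has positive spectral order $D$. Suppose that: 1. the generalized derivative $\rho\in\mathring{W}_2^{-1}[0,1]$ of $P$ is nonzero; 2. for every index $k\in\{1,\dots,N\}$ with $d_k>0$ the integer $\dfrac{\ln(a_k|d_k|)}{\nu}$ is even; 3. for every index $k\in\{1,\dots,N\}$ with $d_k<0$ the integer $\dfrac{\ln(a_k|d_k|)}{\nu}$ is odd. Then there exists a continuous positive $2$-periodic function $s:\mathbb R\to\mathbb R$ such that, as $\lambda\to+\infty$, $$\operatorname{ind}T_\rho(\lambda)=\lambda^{D/2}\cdot\left(s\left(\frac{\ln\lambda}{\nu}\right)+o(1)\right),$$ and, as $\lambda\to-\infty$, $$\operatorname{ind}T_\rho(\lambda)=|\lambda|^{D/2}\cdot\left(s\left(\frac{\ln|\lambda|}{\nu}-1\right)+o(1)\right).$$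
   Context: Spaces: $\mathring{W}_2^1[0,1]$ is the Sobolev space of (complex-valued) functions $y\in W_2^1[0,1]$ with $y(0)=y(1)=0$, and $\mathring{W}_2^{-1}[0,1]$ is its dual. The generalized derivative $\rho\in\mathring{W}_2^{-1}[0,1]$ of $P\in L_2[0,1]$ is given by $\langle\rho,y\rangle=-\int_0^1P\,\overline{y'}\,dx$ for $y\in\mathring{W}_2^1[0,1]$. Self-similar functions: let $N>1$ be an integer, $a_k>0$ with $\sum_{k=1}^Na_k=1$, and $d_k,\beta_k\in\mathbb R$ ($k=1,\dots,N$) with $\sum_{k=1}^Na_kd_k^2<1$. Put $\alpha_1=0$ and $\alpha_{k+1}=\alpha_k+a_k$. A (real-valued) function $P\in L_2[0,1]$ is self-similar with these parameters if for every $k\in\{1,\dots,N\}$ and almost every $x\in(\alpha_k,\alpha_{k+1})$ $$P(x)=\beta_k+d_k\,P\left(\frac{x-\alpha_k}{a_k}\right)$$ (such $P$ exists and is unique for given parameters). The spectral order $D$ is the number determined by $\sum_{k:\,d_k\ne0}(a_k|d_k|)^{D/2}=1$; it is positive exactly when at least two of the $d_k$ are nonzero. $P$ is arithmetically self-similar with step $\nu>0$ if all numbers $\ln(a_k|d_k|)$ with $d_k\neq0$ are integer multiples of $\nu$, and $\nu$ is the largest positive number with this property. Operator pencil: for $\lambda\in\mathbb R$ the operator $T_\rho(\lambda):\mathring{W}_2^1[0,1]\to\mathring{W}_2^{-1}[0,1]$ is defined by $$\langle T_\rho(\lambda)y,z\rangle=\int_0^1\left\{y'\overline{z'}+\lambda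 P\cdot(y'\overline z+y\overline{z'})\right\}dx,\qquad y,z\in\mathring{W}_2^1[0,1],$$ and corresponds to the boundary value problem $-y''-\lambda\rho y=0$, $y(0)=y(1)=0$. The number $\operatorname{ind}T_\rho(\lambda)$ is the negative index of inertia: the maximal dimension of a linear subspace of $\mathring{W}_2^1[0,1]$ on which the quadratic form $\langle T_\rho(\lambda)y,y\rangle$ is negative definite. *)

theory Defs
  imports
    "HOL-Analysis.Analysis"
    "HOL-Library.Function_Algebras"
    "HOL-Library.Extended_Real"
begin

abbreviation unit_meas :: "real measure" where
  "unit_meas \<equiv> lebesgue_on {0..1}"

definition L2 :: "(real \<Rightarrow> 'a::real_normed_vector) set" where
  "L2 = {f. f \<in> borel_measurable unit_meas \<and> integrable unit_meas (\<lambda>x. (norm (f x))\<^sup>2)}"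

text \<open>Test functions: continuously differentiable, with compact support inside the open unit
  interval.  They determine the same weak derivatives as infinitely differentiable ones.\<close>

definition test_functions :: "(real \<Rightarrow> real) set" where
  "test_functions = {\<phi>. (\<forall>x. \<phi> differentiable (at x)) \<and> continuous_on UNIV (deriv \<phi>) \<and>
     (\<exists>u v. 0 < u \<and> v < 1 \<and> (\<forall>x. x \<notin> {u..v} \<longrightarrow> \<phi> x = 0))}"

definition has_weak_derivative :: "(real \<Rightarrow> complex) \<Rightarrow> (real \<Rightarrow> complex) \<Rightarrow> bool" where
  "has_weak_derivative y g \<longleftrightarrow> y \<in> L2 \<and> g \<in> L2 \<and>
     (\<forall>\<phi>\<in>test_functions.
        (\<integral>x. deriv \<phi> x *\<^sub>R y x \<partial>unit_meas) = - (\<integral>x. \<phi> x *\<^sub>R g x \<partial>unit_meas))"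

definition W21 :: "(real \<Rightarrow> complex) set" where
  "W21 = {y. \<exists>g. has_weak_derivative y g}"

text \<open>The weak derivative is unique up to null sets, and is only used under integrals.\<close>

definition weak_deriv :: "(real \<Rightarrow> complex) \<Rightarrow> real \<Rightarrow> complex" where
  "weak_deriv y = (SOME g. has_weak_derivative y g)"

text \<open>Each class in the Sobolev space vanishing at the end points is represented by its continuous
  member, extended by zero outside the unit interval; so distinct functions in this set are distinct
  elements of the Sobolev space, and the zero function is the only zero element.\<close>

definition W21_0 :: "(real \<Rightarrow> complex) set" where
  "W21_0 = {y \<in> W21. continuous_on {0..1} y \<and> y 0 = 0 \<and> y 1 = 0 \<and> (\<forall>x. x \<notin> {0..1} \<longrightarrow> y x = 0)}"

text \<open>Elements of the dual space are given by their pairing with the elements of \<open>W21_0\<close>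
  (antilinear in the argument); values outside \<open>W21_0\<close> carry no meaning.\<close>

definition generalized_derivative :: "(real \<Rightarrow> real) \<Rightarrow> (real \<Rightarrow> complex) \<Rightarrow> complex" where
  "generalized_derivative P y = - (\<integral>x. of_real (P x) * cnj (weak_deriv y x) \<partial>unit_meas)"

definition T_pencil ::
    "(real \<Rightarrow> real) \<Rightarrow> real \<Rightarrow> (real \<Rightarrow> complex) \<Rightarrow> (real \<Rightarrow> complex) \<Rightarrow> complex" where
  "T_pencil P l y z = (\<integral>x. (weak_deriv y x * cnj (weak_deriv z x)
      + of_real l * of_real (P x) * (weak_deriv y x * cnj (z x) + y x * cnj (weak_deriv z x)))
      \<partial>unit_meas)"

definition cscale :: "complex \<Rightarrow> (real \<Rightarrow> complex) \<Rightarrow> real \<Rightarrow> complex" where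
  "cscale c f = (\<lambda>x. c * f x)"

global_interpretation cfun: vector_space cscale
  by unfold_locales (auto simp: cscale_def algebra_simps fun_eq_iff)

text \<open>For real \<open>P\<close> the form is Hermitian, so its diagonal values are real.\<close>

definition negative_definite_on ::
    "(real \<Rightarrow> complex) set \<Rightarrow> ((real \<Rightarrow> complex) \<Rightarrow> (real \<Rightarrow> complex) \<Rightarrow> complex) \<Rightarrow> bool" where
  "negative_definite_on V T \<longleftrightarrow> (\<forall>y\<in>V. y \<noteq> 0 \<longrightarrow> Re (T y y) < 0)"

text \<open>The value is infinite if negative definite subspaces of arbitrarily large dimension exist.\<close>

definition ind :: "((real \<Rightarrow> complex) \<Rightarrow> (real \<Rightarrow> complex) \<Rightarrow> complex) \<Rightarrow> enat" where
  "ind T = Sup {enat (cfun.dim V) | V. cfun.subspace V \<and> V \<subseteq> W21_0 \<and>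
     (\<exists>B. finite B \<and> V \<subseteq> cfun.span B) \<and> negative_definite_on V T}"

definition self_similarity_parameters ::
    "nat \<Rightarrow> (nat \<Rightarrow> real) \<Rightarrow> (nat \<Rightarrow> real) \<Rightarrow> bool" where
  "self_similarity_parameters N a d \<longleftrightarrow>
     N > 1 \<and> (\<forall>k\<in>{1..N}. a k > 0) \<and> (\<Sum>k=1..N. a k) = 1 \<and> (\<Sum>k=1..N. a k * (d k)\<^sup>2) < 1"

definition \<alpha> :: "(nat \<Rightarrow> real) \<Rightarrow> nat \<Rightarrow> real" where
  "\<alpha> a k = (\<Sum>j=1..<k. a j)"

definition self_similar ::
    "nat \<Rightarrow> (nat \<Rightarrow> real) \<Rightarrow> (nat \<Rightarrow> real) \<Rightarrow> (nat \<Rightarrow> real) \<Rightarrow> (real \<Rightarrow> real) \<Rightarrow> bool" where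
  "self_similar N a d \<beta> P \<longleftrightarrow> P \<in> L2 \<and>
     (\<forall>k\<in>{1..N}. AE x in lebesgue. x \<in> {\<alpha> a k <..< \<alpha> a (k + 1)} \<longrightarrow>
        P x = \<beta> k + d k * P ((x - \<alpha> a k) / a k))"

definition is_spectral_order :: "nat \<Rightarrow> (nat \<Rightarrow> real) \<Rightarrow> (nat \<Rightarrow> real) \<Rightarrow> real \<Rightarrow> bool" where
  "is_spectral_order N a d D \<longleftrightarrow>
     (\<Sum>k\<in>{k\<in>{1..N}. d k \<noteq> 0}. (a k * \<bar>d k\<bar>) powr (D / 2)) = 1"

definition logs_multiples_of :: "nat \<Rightarrow> (nat \<Rightarrow> real) \<Rightarrow> (nat \<Rightarrow> real) \<Rightarrow> real \<Rightarrow> bool" where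
  "logs_multiples_of N a d \<mu> \<longleftrightarrow>
     (\<forall>k\<in>{1..N}. d k \<noteq> 0 \<longrightarrow> (\<exists>m::int. ln (a k * \<bar>d k\<bar>) = of_int m * \<mu>))"

definition arithmetic_step :: "nat \<Rightarrow> (nat \<Rightarrow> real) \<Rightarrow> (nat \<Rightarrow> real) \<Rightarrow> real \<Rightarrow> bool" where
  "arithmetic_step N a d \<nu> \<longleftrightarrow> \<nu> > 0 \<and> logs_multiples_of N a d \<nu> \<and>
     (\<forall>\<mu>>0. logs_multiples_of N a d \<mu> \<longrightarrow> \<mu> \<le> \<nu>)"

end

theory Submission
  imports Defs
begin

text \<open>Write \<open>n(\<lambda>)\<close> for the negative index.  Functions vanishing at the division points \<open>\<alpha>\<^sub>k\<close> form a subspace of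
  codimension \<open>N - 1\<close> on which the form splits into rescaled copies of itself, because a constant added to \<open>P\<close>
  does not contribute on functions with zero boundary values; hence
  \<open>\<Sum>\<^sub>k n(\<lambda> a\<^sub>k d\<^sub>k) \<le> n(\<lambda>) \<le> \<Sum>\<^sub>k n(\<lambda> a\<^sub>k d\<^sub>k) + N - 1\<close>.  The parity conditions make
  \<open>j \<mapsto> n((-1)\<^sup>j exp(\<nu> (t + j)))\<close> satisfy a scalar arithmetic renewal equation with bounded error, and the
  discrete renewal theorem gives a limit \<open>s(t)\<close>, uniformly in \<open>t\<close>.  Continuity of \<open>s\<close> needs in addition that
  the jumps of \<open>n\<close> are bounded: this follows from comparing \<open>n(\<lambda>)\<close> with the number of zeros of the solution of
  the initial value problem \<open>- y'' - \<lambda> \<rho> y = 0\<close>, \<open>y(0) = 0\<close>, since these zeros are simple and depend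
  continuously on \<open>\<lambda>\<close>.\<close>

section \<open>Absolutely continuous functions on an interval\<close>

text \<open>The datum \<rho> is only the distributional derivative of an L2 function, so classical
  Sturm oscillation theory does not apply as it stands: the equation becomes a first order system in
  which P enters undifferentiated, and after removal of an exponential factor the zeros are those of
  a C1 function. Two inequalities tie the index to zeros: a Picone identity bounds it by the number
  of zeros in (0,1), and solutions for a smaller parameter, cut off at their zeros, bound it from
  below. Near a given \<lambda> the two counts can differ only through a zero at the end point 1, so
  the local oscillation is at most 1. That is enough for continuity, because the weight
  \<open>exp (- \<kappa> x)\<close> makes bounded jumps vanish in the limit, and it is needed only
  for positive \<lambda>: both signs share one function s, a change of sign costing one step of the
  alternating sequence, whence period 2 and shift 1. Positivity of s is where \<rho> \<noteq> 0
  enters. There the obstacle is that \<rho> pairs with single functions while the form sees only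
  products of two, so products must first be shown to suffice.\<close>

lemma absolutely_integrable_continuous_mult:
  fixes f g :: "real \<Rightarrow> real"
  assumes "continuous_on {a..b} f" "g absolutely_integrable_on {a..b}"
  shows "(\<lambda>x. f x * g x) absolutely_integrable_on {a..b}"
  using assms
  by (intro absolutely_integrable_bounded_measurable_product_real)
     (auto intro!: continuous_imp_measurable_on_sets_lebesgue compact_imp_bounded
        compact_continuous_image)

lemma absolutely_integrable_Icc_subset:
  fixes f :: "real \<Rightarrow> 'a::euclidean_space"
  assumes "f absolutely_integrable_on {a..b}" "a \<le> s" "t \<le> b"
  shows "f absolutely_integrable_on {s..t}" "f integrable_on {s..t}"
proof -
  show "f absolutely_integrable_on {s..t}"
    by (rule set_integrable_subset[OF assms(1)]) (use assms in auto)
  then show "f integrable_on {s..t}"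
    by (rule set_lebesgue_integral_eq_integral(1))
qed

text \<open>\<open>F\<close> is absolutely continuous on \<open>[a,b]\<close> with almost everywhere derivative \<open>f\<close>.\<close>

definition ac :: "real \<Rightarrow> real \<Rightarrow> (real \<Rightarrow> real) \<Rightarrow> (real \<Rightarrow> real) \<Rightarrow> bool" where
  "ac a b F f \<longleftrightarrow> f absolutely_integrable_on {a..b} \<and>
     (\<forall>s t. a \<le> s \<longrightarrow> s \<le> t \<longrightarrow> t \<le> b \<longrightarrow> F t - F s = integral {s..t} f)"

lemma acD:
  assumes "ac a b F f"
  shows "f absolutely_integrable_on {a..b}"
    and "a \<le> s \<Longrightarrow> s \<le> t \<Longrightarrow> t \<le> b \<Longrightarrow> F t - F s = integral {s..t} f"
    and "a \<le> s \<Longrightarrow> s \<le> t \<Longrightarrow> t \<le> b \<Longrightarrow> f integrable_on {s..t}"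
    and "a \<le> s \<Longrightarrow> s \<le> t \<Longrightarrow> t \<le> b \<Longrightarrow> f absolutely_integrable_on {s..t}"
proof -
  show f: "f absolutely_integrable_on {a..b}" using assms unfolding ac_def by blast
  show "a \<le> s \<Longrightarrow> s \<le> t \<Longrightarrow> t \<le> b \<Longrightarrow> F t - F s = integral {s..t} f"
    using assms unfolding ac_def by blast
  show *: "a \<le> s \<Longrightarrow> s \<le> t \<Longrightarrow> t \<le> b \<Longrightarrow> f absolutely_integrable_on {s..t}"
    by (rule set_integrable_subset[OF f]) auto
  show "a \<le> s \<Longrightarrow> s \<le> t \<Longrightarrow> t \<le> b \<Longrightarrow> f integrable_on {s..t}"
    using * set_lebesgue_integral_eq_integral(1) by blast
qed

lemma ac_subinterval:
  assumes "ac a b F f" "a \<le> a'" "b' \<le> b"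
  shows "ac a' b' F f"
proof -
  have "f absolutely_integrable_on {a'..b'}"
    by (rule set_integrable_subset[OF acD(1)[OF assms(1)]]) (use assms in auto)
  then show ?thesis using assms unfolding ac_def by auto
qed

lemma acI:
  assumes "f absolutely_integrable_on {a..b}"
    and "\<And>x. a \<le> x \<Longrightarrow> x \<le> b \<Longrightarrow> F x = c + integral {a..x} f"
  shows "ac a b F f"
  unfolding ac_def
proof (intro conjI allI impI assms(1))
  fix s t :: real assume st: "a \<le> s" "s \<le> t" "t \<le> b"
  have "f integrable_on {a..t}"
    using set_lebesgue_integral_eq_integral(1)[OF set_integrable_subset[OF assms(1), of "{a..t}"]] st
    by auto
  from Henstock_Kurzweil_Integration.integral_combine[OF st(1,2) this]
  show "F t - F s = integral {s..t} f"
    using assms(2)[of s] assms(2)[of t] st by auto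
qed

lemma ac_continuous_on:
  assumes "ac a b F f" shows "continuous_on {a..b} F"
proof (cases "a \<le> b")
  case True
  have "continuous_on {a..b} (\<lambda>x. F a + integral {a..x} f)"
    using acD(3)[OF assms, of a b] True
    by (intro continuous_intros indefinite_integral_continuous_1) auto
  moreover have "F a + integral {a..x} f = F x" if "x \<in> {a..b}" for x
    using acD(2)[OF assms, of a x] that by auto
  ultimately show ?thesis by (rule continuous_on_eq)
qed auto

lemma ac_const: "ac a b (\<lambda>x. c) (\<lambda>x. 0)"
  by (auto simp: ac_def)

lemma ac_add:
  assumes "ac a b F f" "ac a b G g"
  shows "ac a b (\<lambda>x. F x + G x) (\<lambda>x. f x + g x)"
  unfolding ac_def
proof (intro conjI allI impI)
  show "(\<lambda>x. f x + g x) absolutely_integrable_on {a..b}"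
    using assms by (auto simp: ac_def)
  fix s t assume st: "a \<le> s" "s \<le> t" "t \<le> b"
  show "F t + G t - (F s + G s) = integral {s..t} (\<lambda>x. f x + g x)"
    using acD(2)[OF assms(1) st] acD(2)[OF assms(2) st] acD(3)[OF assms(1) st] acD(3)[OF assms(2) st]
    by (simp add: Henstock_Kurzweil_Integration.integral_add)
qed

lemma ac_cmult:
  assumes "ac a b F f" shows "ac a b (\<lambda>x. c * F x) (\<lambda>x. c * f x)"
  unfolding ac_def
proof (intro conjI allI impI)
  show "(\<lambda>x. c * f x) absolutely_integrable_on {a..b}"
    using assms by (auto simp: ac_def)
  fix s t assume st: "a \<le> s" "s \<le> t" "t \<le> b"
  show "c * F t - c * F s = integral {s..t} (\<lambda>x. c * f x)"
    using acD(2)[OF assms(1) st]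
    by (simp flip: right_diff_distrib)
qed

lemma ac_cong_AE:
  assumes "ac a b F f" "AE x in lebesgue. x \<in> {a..b} \<longrightarrow> f x = g x"
    and "\<And>x. a \<le> x \<Longrightarrow> x \<le> b \<Longrightarrow> G x = F x"
  shows "ac a b G g"
proof -
  obtain N where N': "\<And>x. x \<in> space lebesgue - N \<Longrightarrow> x \<in> {a..b} \<longrightarrow> f x = g x" "N \<in> null_sets lebesgue"
    by (rule AE_E3[OF assms(2)]) (rule that)
  have N: "negligible N" "\<And>x. x \<notin> N \<Longrightarrow> x \<in> {a..b} \<Longrightarrow> f x = g x"
    using N' by (simp_all add: negligible_iff_null_sets)
  have g: "g absolutely_integrable_on {a..b}"
    using acD(1)[OF assms(1)] by (rule absolutely_integrable_spike[OF _ N(1)]) (use N in auto)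
  have eq: "integral {s..t} f = integral {s..t} g" if "a \<le> s" "t \<le> b" for s t
    by (rule integral_spike[OF N(1)]) (use N that in auto)
  show ?thesis unfolding ac_def
  proof (intro conjI allI impI g)
    fix s t assume st: "a \<le> s" "s \<le> t" "t \<le> b"
    show "G t - G s = integral {s..t} g"
      using acD(2)[OF assms(1) st] eq[OF st(1,3)] assms(3)[of s] assms(3)[of t] st by simp
  qed
qed

lemma ac_cong:
  assumes "ac a b F f" "\<And>x. a \<le> x \<Longrightarrow> x \<le> b \<Longrightarrow> f x = g x"
    and "\<And>x. a \<le> x \<Longrightarrow> x \<le> b \<Longrightarrow> G x = F x"
  shows "ac a b G g"
  by (rule ac_cong_AE[OF assms(1)]) (use assms in auto)

text \<open>The error \<open>F t - F s - integral {s..t} h\<close> and the bound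
  \<open>e * integral {s..t} m\<close> are both additive over adjacent intervals, so an estimate
  near each point extends to all subintervals by bisection; then e tends to 0. Differentiation
  almost everywhere is avoided in this way.\<close>

lemma ac_BolzanoI:
  assumes h: "h absolutely_integrable_on {a..b}" and m: "m absolutely_integrable_on {a..b}"
    and loc: "\<And>e x. 0 < e \<Longrightarrow> a \<le> x \<Longrightarrow> x \<le> b \<Longrightarrow>
      \<exists>d>0. \<forall>s t. a \<le> s \<and> s \<le> x \<and> x \<le> t \<and> t \<le> b \<and> t - s < d \<longrightarrow>
        \<bar>F t - F s - integral {s..t} h\<bar> \<le> e * integral {s..t} m"
  shows "ac a b F h"
  unfolding ac_def
proof (intro conjI allI impI h)
  fix s t assume st: "a \<le> s" "s \<le> t" "t \<le> b"
  have int: "h integrable_on {u..v}" "m integrable_on {u..v}" if "a \<le> u" "v \<le> b" for u v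
    using absolutely_integrable_Icc_subset(2)[OF h] absolutely_integrable_Icc_subset(2)[OF m] that
    by blast+
  have "\<bar>F t - F s - integral {s..t} h\<bar> \<le> e * integral {s..t} m" if e: "0 < e" for e
  proof -
    \<comment> \<open>The two guards confine the bisection to subintervals of [s,t].\<close>
    define Q where "Q u v \<longleftrightarrow> (s \<le> u \<longrightarrow> v \<le> t \<longrightarrow>
      \<bar>F v - F u - integral {u..v} h\<bar> \<le> e * integral {u..v} m)" for u v
    have "Q s t"
    proof (induction rule: Bolzano[OF st(2)])
      case (1 u v w)
      have "integral {u..v} h + integral {v..w} h = integral {u..w} h"
           "integral {u..v} m + integral {v..w} m = integral {u..w} m" if "s \<le> u" "w \<le> t"
        using 1 that st int by (auto intro!: Henstock_Kurzweil_Integration.integral_combine)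
      note comb = this
      show ?case unfolding Q_def
      proof (intro impI)
        assume g: "s \<le> u" "w \<le> t"
        have "\<bar>F v - F u - integral {u..v} h\<bar> \<le> e * integral {u..v} m"
          "\<bar>F w - F v - integral {v..w} h\<bar> \<le> e * integral {v..w} m"
          using 1 g by (auto simp: Q_def)
        moreover have "e * integral {u..w} m = e * integral {u..v} m + e * integral {v..w} m"
          using comb(2)[OF g] by (simp flip: distrib_left)
        ultimately show "\<bar>F w - F u - integral {u..w} h\<bar> \<le> e * integral {u..w} m"
          using comb(1)[OF g] by linarith
      qed
    next
      case (2 x)
      then obtain d where "d > 0" and d: "\<And>u v. a \<le> u \<and> u \<le> x \<and> x \<le> v \<and> v \<le> b \<and> v - u < d \<Longrightarrow>
        \<bar>F v - F u - integral {u..v} h\<bar> \<le> e * integral {u..v} m"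
        using loc[OF e, of x] st by auto
      show ?case unfolding Q_def
        by (intro exI[of _ d] conjI allI impI d \<open>d > 0\<close>) (use st in auto)
    qed
    then show ?thesis using st by (auto simp: Q_def)
  qed
  then have "((\<lambda>e. \<bar>F t - F s - integral {s..t} h\<bar>) \<longlongrightarrow> \<bar>F t - F s - integral {s..t} h\<bar>) (at_right 0)"
    "\<forall>\<^sub>F e in at_right 0. \<bar>F t - F s - integral {s..t} h\<bar> \<le> e * integral {s..t} m"
    by (auto simp: eventually_at_right_field intro!: exI[of _ 1])
  moreover have "((\<lambda>e. e * integral {s..t} m) \<longlongrightarrow> 0 * integral {s..t} m) (at_right 0)"
    by (intro tendsto_intros)
  ultimately have "\<bar>F t - F s - integral {s..t} h\<bar> \<le> 0 * integral {s..t} m"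
    by (intro tendsto_le[of "at_right (0::real)"]) (auto simp: trivial_limit_at_right_real)
  then show "F t - F s = integral {s..t} h" by auto
qed

lemma MVT_segment:
  fixes \<phi> \<phi>' :: "real \<Rightarrow> real"
  assumes "\<And>x. x \<in> closed_segment u v \<Longrightarrow> (\<phi> has_real_derivative \<phi>' x) (at x)"
  shows "\<exists>z\<in>closed_segment u v. \<phi> v - \<phi> u = (v - u) * \<phi>' z"
proof (cases u v rule: linorder_cases)
  case less
  then obtain z where "u < z" "z < v" "\<phi> v - \<phi> u = (v - u) * \<phi>' z"
    using MVT2[of u v \<phi> \<phi>'] assms by (auto simp: closed_segment_eq_real_ivl)
  then show ?thesis by (intro bexI[of _ z]) (auto simp: closed_segment_eq_real_ivl)
next
  case greater
  then obtain z where "v < z" "z < u" "\<phi> u - \<phi> v = (u - v) * \<phi>' z"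
    using MVT2[of v u \<phi> \<phi>'] assms by (auto simp: closed_segment_eq_real_ivl)
  then show ?thesis by (intro bexI[of _ z]) (auto simp: closed_segment_eq_real_ivl algebra_simps)
qed auto

text \<open>The mean value theorem writes the increment of \<open>\<phi> (F x)\<close> over a short
  interval as \<open>\<phi>' (F r)\<close> times the increment of F; continuity replaces the fixed r
  by the running point at the cost of e times the integral of
  \<open>\<bar>f x\<bar>\<close>.\<close>

lemma ac_chain:
  assumes F: "ac a b F f"
    and der: "\<And>x. a \<le> x \<Longrightarrow> x \<le> b \<Longrightarrow> (\<phi> has_real_derivative \<phi>' (F x)) (at (F x))"
    and cont: "continuous_on (F ` {a..b}) \<phi>'"
  shows "ac a b (\<lambda>x. \<phi> (F x)) (\<lambda>x. \<phi>' (F x) * f x)"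
proof -
  note Fc = ac_continuous_on[OF F]
  have c: "continuous_on {a..b} (\<lambda>x. \<phi>' (F x))"
    by (rule continuous_on_compose2[OF cont Fc]) auto
  have ai: "(\<lambda>x. \<phi>' (F x) * f x) absolutely_integrable_on {a..b}"
    by (rule absolutely_integrable_continuous_mult[OF c acD(1)[OF F]])
  have ab: "(\<lambda>x. \<bar>f x\<bar>) absolutely_integrable_on {a..b}"
    by (rule set_integrable_abs[OF acD(1)[OF F]])
  have loc: "\<exists>d>0. \<forall>s t. a \<le> s \<and> s \<le> x \<and> x \<le> t \<and> t \<le> b \<and> t - s < d \<longrightarrow>
     \<bar>\<phi> (F t) - \<phi> (F s) - integral {s..t} (\<lambda>x. \<phi>' (F x) * f x)\<bar> \<le> e * integral {s..t} (\<lambda>x. \<bar>f x\<bar>)"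
    if e: "0 < e" and x: "a \<le> x" "x \<le> b" for e x
  proof -
  obtain d where d: "d > 0" "\<And>y. y \<in> {a..b} \<Longrightarrow> dist y x < d \<Longrightarrow> dist (\<phi>' (F y)) (\<phi>' (F x)) < e / 2"
    using c[unfolded continuous_on_iff, rule_format, of x "e/2"] e x by auto
  show ?thesis
  proof (intro exI[of _ d] conjI allI impI \<open>d > 0\<close>)
    fix s t assume *: "a \<le> s \<and> s \<le> x \<and> x \<le> t \<and> t \<le> b \<and> t - s < d"
    \<comment> \<open>The intermediate point lies between \<open>F s\<close> and \<open>F t\<close>,
      hence is itself a value \<open>F r\<close> with r in [s,t], although F need not be
      monotone.\<close>
    have "continuous_on {s..t} F" by (rule continuous_on_subset[OF Fc]) (use * in auto)
    then have "connected (F ` {s..t})" by (intro connected_continuous_image) auto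
    then have sub: "closed_segment (F s) (F t) \<subseteq> F ` {s..t}"
      using * by (intro closed_segment_subset imageI) (auto simp flip: connected_convex_1)
    have "\<exists>z\<in>closed_segment (F s) (F t). \<phi> (F t) - \<phi> (F s) = (F t - F s) * \<phi>' z"
    proof (rule MVT_segment)
      fix w assume "w \<in> closed_segment (F s) (F t)"
      then obtain r where "r \<in> {s..t}" "w = F r" using sub by blast
      moreover from this have "a \<le> r" "r \<le> b" using * by auto
      ultimately show "(\<phi> has_real_derivative \<phi>' w) (at w)"
        using der[of r] by blast
    qed
    then obtain z where z: "z \<in> closed_segment (F s) (F t)" "\<phi> (F t) - \<phi> (F s) = (F t - F s) * \<phi>' z"
      by blast
    then obtain r where "r \<in> {s..t}" "z = F r" using sub by blast
    with z have r: "r \<in> {s..t}" "\<phi> (F t) - \<phi> (F s) = (F t - F s) * \<phi>' (F r)"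
      by blast+
    have near: "\<bar>\<phi>' (F r) - \<phi>' (F y)\<bar> \<le> e" if "y \<in> {s..t}" for y
    proof -
      have "r \<in> {a..b}" "dist r x < d" "y \<in> {a..b}" "dist y x < d"
        using r(1) that * unfolding dist_real_def by auto
      then have "dist (\<phi>' (F r)) (\<phi>' (F x)) < e / 2" "dist (\<phi>' (F y)) (\<phi>' (F x)) < e / 2"
        using d(2) by blast+
      then show ?thesis unfolding dist_real_def by linarith
    qed
    have int: "f integrable_on {s..t}" using acD(3)[OF F] * by auto
    have aist: "(\<lambda>x. \<phi>' (F x) * f x) integrable_on {s..t}" "(\<lambda>x. \<bar>f x\<bar>) integrable_on {s..t}"
      using absolutely_integrable_Icc_subset(2)[OF ai] absolutely_integrable_Icc_subset(2)[OF ab] *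
      by blast+
    have "\<phi> (F t) - \<phi> (F s) - integral {s..t} (\<lambda>x. \<phi>' (F x) * f x)
        = integral {s..t} (\<lambda>x. \<phi>' (F r) * f x) - integral {s..t} (\<lambda>x. \<phi>' (F x) * f x)"
      using r(2) acD(2)[OF F, of s t] * by simp
    also have "\<dots> = integral {s..t} (\<lambda>x. \<phi>' (F r) * f x - \<phi>' (F x) * f x)"
      by (rule Henstock_Kurzweil_Integration.integral_diff[symmetric])
        (use aist(1) integrable_on_mult_right[OF int] in blast)+
    finally have eq: "\<phi> (F t) - \<phi> (F s) - integral {s..t} (\<lambda>x. \<phi>' (F x) * f x)
      = integral {s..t} (\<lambda>x. \<phi>' (F r) * f x - \<phi>' (F x) * f x)" .
    have "norm (integral {s..t} (\<lambda>x. \<phi>' (F r) * f x - \<phi>' (F x) * f x)) \<le> integral {s..t} (\<lambda>x. e * \<bar>f x\<bar>)"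
    proof (rule integral_norm_bound_integral)
      show "(\<lambda>x. \<phi>' (F r) * f x - \<phi>' (F x) * f x) integrable_on {s..t}"
        by (rule integrable_diff) (use aist(1) integrable_on_mult_right[OF int] in blast)+
      show "(\<lambda>x. e * \<bar>f x\<bar>) integrable_on {s..t}"
        using aist(2) by (rule integrable_on_mult_right)
      fix y assume "y \<in> {s..t}"
      from near[OF this] show "norm (\<phi>' (F r) * f y - \<phi>' (F y) * f y) \<le> e * \<bar>f y\<bar>"
        by (simp add: abs_mult mult_right_mono flip: left_diff_distrib)
    qed
    then show "\<bar>\<phi> (F t) - \<phi> (F s) - integral {s..t} (\<lambda>x. \<phi>' (F x) * f x)\<bar> \<le> e * integral {s..t} (\<lambda>x. \<bar>f x\<bar>)"
      unfolding eq by simp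
  qed
  qed
  show ?thesis
    by (rule ac_BolzanoI[OF ai ab]) (rule loc)
qed

text \<open>Polarisation: the product is half of \<open>(F + G)^2 - F^2 - G^2\<close>, so the chain
  rule for squares is enough.\<close>

lemma ac_mult:
  assumes F: "ac a b F f" and G: "ac a b G g"
  shows "ac a b (\<lambda>x. F x * G x) (\<lambda>x. f x * G x + F x * g x)"
proof -
  have sq: "ac a b (\<lambda>x. (H x)\<^sup>2) (\<lambda>x. 2 * H x * h x)" if "ac a b H h" for H h
    by (rule ac_chain[OF that, of "\<lambda>x. x\<^sup>2" "\<lambda>x. 2 * x"])
      (auto intro!: derivative_eq_intros continuous_intros)
  have "ac a b (\<lambda>x. (1/2) * ((F x + G x)\<^sup>2 + ((-1) * (F x)\<^sup>2 + (-1) * (G x)\<^sup>2)))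
        (\<lambda>x. (1/2) * (2 * (F x + G x) * (f x + g x) + ((-1) * (2 * F x * f x) + (-1) * (2 * G x * g x))))"
    by (intro ac_cmult ac_add sq F G)
  then show ?thesis
    by (rule ac_cong) (auto simp: power2_eq_square algebra_simps)
qed

lemma ac_C1:
  assumes "\<And>x. a \<le> x \<Longrightarrow> x \<le> b \<Longrightarrow> (F has_real_derivative f x) (at x within {a..b})"
    and "continuous_on {a..b} f"
  shows "ac a b F f"
  unfolding ac_def
proof (intro conjI allI impI)
  show "f absolutely_integrable_on {a..b}" by (rule absolutely_integrable_continuous_real[OF assms(2)])
  fix s t assume st: "a \<le> s" "s \<le> t" "t \<le> b"
  have "(F has_vector_derivative f x) (at x within {s..t})" if "x \<in> {s..t}" for x
    using assms(1)[of x] that st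
    by (auto intro: has_vector_derivative_within_subset
        simp: has_real_derivative_iff_has_vector_derivative)
  with st have "(f has_integral F t - F s) {s..t}"
    by (intro fundamental_theorem_of_calculus) auto
  then show "F t - F s = integral {s..t} f" by (simp add: integral_unique)
qed

section \<open>Square integrable functions on the unit interval\<close>

text \<open>Vanishing on intervals passes to integrals against continuous functions, and these
  approximate sgn f almost everywhere; so the integral of \<open>\<bar>f x\<bar>\<close> is
  zero.\<close>

lemma AE_zero_of_interval_integrals_zero:
  fixes f :: "real \<Rightarrow> real"
  assumes f: "f absolutely_integrable_on {a..b}"
    and zero: "\<And>s t. a \<le> s \<Longrightarrow> s \<le> t \<Longrightarrow> t \<le> b \<Longrightarrow> integral {s..t} f = 0"
  shows "AE x in lebesgue. x \<in> {a..b} \<longrightarrow> f x = 0"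
proof (cases "a \<le> b")
  case False then show ?thesis by simp
next
  case ab: True
  have cont0: "integral {a..b} (\<lambda>x. g x * f x) = 0" if g: "continuous_on UNIV g" for g :: "real \<Rightarrow> real"
  proof -
    have gab: "continuous_on {a..b} g" by (rule continuous_on_subset[OF g]) auto
    have ai: "(\<lambda>x. g x * f x) absolutely_integrable_on {a..b}"
      by (rule absolutely_integrable_continuous_mult[OF gab f])
    \<comment> \<open>On a short interval g is close to a constant, whose contribution is zero;
      hence the zero function is a primitive of \<open>g x * f x\<close>.\<close>
    have "ac a b (\<lambda>x. 0) (\<lambda>x. g x * f x)"
    proof (rule ac_BolzanoI[OF ai set_integrable_abs[OF f]])
      fix e x :: real assume e: "0 < e" and x: "a \<le> x" "x \<le> b"
      obtain d where d: "d > 0" "\<And>y. dist y x < d \<Longrightarrow> dist (g y) (g x) < e"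
        using g[unfolded continuous_on_iff, rule_format, of x e] e by auto
      have "\<bar>0 - 0 - integral {s..t} (\<lambda>x. g x * f x)\<bar> \<le> e * integral {s..t} (\<lambda>x. \<bar>f x\<bar>)"
        if st: "a \<le> s" "s \<le> x" "x \<le> t" "t \<le> b" "t - s < d" for s t
      proof -
        have i: "f integrable_on {s..t}" "(\<lambda>x. g x * f x) integrable_on {s..t}"
          "(\<lambda>x. \<bar>f x\<bar>) integrable_on {s..t}"
          using absolutely_integrable_Icc_subset(2)[OF f st(1,4)]
            absolutely_integrable_Icc_subset(2)[OF ai st(1,4)]
            absolutely_integrable_Icc_subset(2)[OF set_integrable_abs[OF f] st(1,4)] by auto
        have "integral {s..t} (\<lambda>x. g x * f x) = integral {s..t} (\<lambda>y. g y * f y - g x * f y)"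
          using zero[of s t] st i
          by (subst Henstock_Kurzweil_Integration.integral_diff) (auto intro: integrable_on_mult_right)
        moreover have "norm (integral {s..t} (\<lambda>y. g y * f y - g x * f y)) \<le> integral {s..t} (\<lambda>y. e * \<bar>f y\<bar>)"
        proof (rule integral_norm_bound_integral)
          show "(\<lambda>y. g y * f y - g x * f y) integrable_on {s..t}"
            by (rule integrable_diff[OF i(2) integrable_on_mult_right[OF i(1)]])
          show "(\<lambda>y. e * \<bar>f y\<bar>) integrable_on {s..t}" by (rule integrable_on_mult_right[OF i(3)])
          fix y assume y: "y \<in> {s..t}"
          have "dist y x < d" using y st unfolding dist_real_def by auto
          then have "\<bar>g y - g x\<bar> \<le> e" using d(2) by (auto simp: dist_real_def intro: less_imp_le)
          then show "norm (g y * f y - g x * f y) \<le> e * \<bar>f y\<bar>"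
            by (simp add: abs_mult mult_right_mono flip: left_diff_distrib)
        qed
        ultimately show ?thesis by simp
      qed
      then show "\<exists>d>0. \<forall>s t. a \<le> s \<and> s \<le> x \<and> x \<le> t \<and> t \<le> b \<and> t - s < d \<longrightarrow>
        \<bar>0 - 0 - integral {s..t} (\<lambda>x. g x * f x)\<bar> \<le> e * integral {s..t} (\<lambda>x. \<bar>f x\<bar>)"
        using d(1) by blast
    qed
    from acD(2)[OF this _ ab] show ?thesis by simp
  qed
  have fm: "f measurable_on {a..b}"
    using absolutely_integrable_measurable[of "{a..b}" f] f
    by (simp add: measurable_on_iff_borel_measurable)
  have "(\<lambda>x. sgn (f x)) \<in> borel_measurable (lebesgue_on {a..b})"
    using fm by (auto simp: measurable_on_iff_borel_measurable)
  then have "(\<lambda>x. sgn (f x)) measurable_on {a..b}"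
    by (simp add: measurable_on_iff_borel_measurable)
  then obtain N g where N: "negligible N" and gc: "\<And>n. continuous_on UNIV (g n)"
    and gl: "\<And>x. x \<notin> N \<Longrightarrow> (\<lambda>n::nat. g n x) \<longlonglongrightarrow> (if x \<in> {a..b} then sgn (f x) else 0)"
    unfolding measurable_on_def by blast
  \<comment> \<open>Truncation to [-1,1] keeps the limit sgn f and makes
    \<open>\<bar>f x\<bar>\<close> a majorant for dominated convergence.\<close>
  define G where "G n x = max (-1) (min 1 (g n x))" for n x
  have Gc: "continuous_on UNIV (G n)" for n unfolding G_def by (intro continuous_intros gc)
  have Gl: "(\<lambda>n. G n x * f x) \<longlonglongrightarrow> \<bar>f x\<bar>" if "x \<in> {a..b} - N" for x
  proof -
    have "(\<lambda>n. G n x) \<longlonglongrightarrow> max (-1) (min 1 (sgn (f x)))"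
      unfolding G_def using gl[of x] that by (intro tendsto_intros) auto
    then have "(\<lambda>n. G n x * f x) \<longlonglongrightarrow> max (-1) (min 1 (sgn (f x))) * f x" by (intro tendsto_intros)
    moreover have "max (-1) (min 1 (sgn (f x))) * f x = \<bar>f x\<bar>" by (auto simp: sgn_if)
    ultimately show ?thesis by simp
  qed
  have "(\<lambda>n. integral ({a..b} - N) (\<lambda>x. G n x * f x)) \<longlonglongrightarrow> integral ({a..b} - N) (\<lambda>x. \<bar>f x\<bar>)"
  proof (rule dominated_convergence(2)[where h="\<lambda>x. \<bar>f x\<bar>"])
    have sp: "u integrable_on ({a..b} - N)" if "u integrable_on {a..b}" for u :: "real \<Rightarrow> real"
      using that by (rule integrable_spike_set) (auto intro: negligible_subset[OF N])
    show "(\<lambda>x. G k x * f x) integrable_on ({a..b} - N)" for k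
    proof (rule sp)
      have "continuous_on {a..b} (G k)" by (rule continuous_on_subset[OF Gc]) auto
      from absolutely_integrable_continuous_mult[OF this f]
      show "(\<lambda>x. G k x * f x) integrable_on {a..b}" by (rule set_lebesgue_integral_eq_integral(1))
    qed
    show "(\<lambda>x. \<bar>f x\<bar>) integrable_on ({a..b} - N)"
      by (rule sp[OF set_lebesgue_integral_eq_integral(1)[OF set_integrable_abs[OF f]]])
    have "\<bar>G k x\<bar> \<le> 1" for k x unfolding G_def by auto
    then show "norm (G k x * f x) \<le> \<bar>f x\<bar>" for k x
      using mult_right_mono[of "\<bar>G k x\<bar>" 1 "\<bar>f x\<bar>"] by (simp add: abs_mult)
  qed (use Gl in blast)
  moreover have ssp: "integral ({a..b} - N) u = integral {a..b} u" for u :: "real \<Rightarrow> real"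
    by (rule integral_spike_set) (auto intro: negligible_subset[OF N])
  ultimately have lim: "(\<lambda>n. 0) \<longlonglongrightarrow> integral {a..b} (\<lambda>x. \<bar>f x\<bar>)"
    unfolding ssp using cont0[OF Gc] by simp
  have "integral {a..b} (\<lambda>x. \<bar>f x\<bar>) = 0"
    using LIMSEQ_unique[OF lim tendsto_const] by simp
  moreover note fa = set_integrable_abs[OF f]
  ultimately have "(LINT x:{a..b}|lebesgue. \<bar>f x\<bar>) = 0"
    using set_lebesgue_integral_eq_integral(2)[OF fa] by simp
  then have "AE x in lebesgue. indicator {a..b} x *\<^sub>R \<bar>f x\<bar> = 0"
    using fa unfolding set_lebesgue_integral_def set_integrable_def
    by (subst (asm) integral_nonneg_eq_0_iff_AE) auto
  then show ?thesis by (rule AE_mp) (auto intro!: AE_I2)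
qed

section \<open>Translation between the measure on [0,1] and gauge integrals\<close>

lemma unit_meas_iff: "integrable unit_meas f \<longleftrightarrow> f absolutely_integrable_on {0..1}"
  for f :: "real \<Rightarrow> 'a::euclidean_space"
  by (simp add: integrable_restrict_space set_integrable_def)

lemma unit_meas_integral:
  fixes f :: "real \<Rightarrow> 'a::euclidean_space"
  assumes "f absolutely_integrable_on {0..1}"
  shows "(\<integral>x. f x \<partial>unit_meas) = integral {0..1} f"
  using assms by (intro lebesgue_integral_eq_integral) (auto simp: unit_meas_iff)

lemma L2_square: "f \<in> L2 \<Longrightarrow> (\<lambda>x. (norm (f x))\<^sup>2) absolutely_integrable_on {0..1}"
  by (auto simp: L2_def unit_meas_iff)

lemma L2_measurable: "f \<in> L2 \<Longrightarrow> f \<in> borel_measurable unit_meas"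
  by (simp add: L2_def)

text \<open>A general bilinear map covers real, complex and scalar products at once; the sum of the
  squared norms is the integrable majorant.\<close>

lemma L2_mult_absolutely_integrable:
  fixes f :: "real \<Rightarrow> 'a::euclidean_space" and g :: "real \<Rightarrow> 'b::euclidean_space" and h :: "'a \<Rightarrow> 'b \<Rightarrow> 'c::euclidean_space"
  assumes "f \<in> L2" "g \<in> L2" "bilinear h" and le: "\<And>x y. norm (h x y) \<le> norm x * norm y"
  shows "(\<lambda>x. h (f x) (g x)) absolutely_integrable_on {0..1}"
proof (rule measurable_bounded_by_integrable_imp_absolutely_integrable)
  show "(\<lambda>x. h (f x) (g x)) \<in> borel_measurable unit_meas"
    by (rule borel_measurable_bilinear[OF assms(3) L2_measurable[OF assms(1)] L2_measurable[OF assms(2)]]) auto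
  have "(\<lambda>x. (norm (f x))\<^sup>2 + (norm (g x))\<^sup>2) absolutely_integrable_on {0..1}"
    by (intro set_integral_add L2_square assms)
  then show "(\<lambda>x. (norm (f x))\<^sup>2 + (norm (g x))\<^sup>2) integrable_on {0..1}"
    by (rule set_lebesgue_integral_eq_integral(1))
  fix x
  have "norm (h (f x) (g x)) \<le> norm (f x) * norm (g x)" by (rule le)
  also have "\<dots> \<le> (norm (f x))\<^sup>2 + (norm (g x))\<^sup>2"
    using sum_squares_bound[of "norm (f x)" "norm (g x)"] mult_nonneg_nonneg[OF norm_ge_zero[of "f x"] norm_ge_zero[of "g x"]]
    by linarith
  finally show "norm (h (f x) (g x)) \<le> (norm (f x))\<^sup>2 + (norm (g x))\<^sup>2" .
qed auto

lemma L2_real_mult: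
  fixes f g :: "real \<Rightarrow> real"
  assumes "f \<in> L2" "g \<in> L2" shows "(\<lambda>x. f x * g x) absolutely_integrable_on {0..1}"
  by (rule L2_mult_absolutely_integrable[OF assms bilinear_times]) (simp add: abs_mult)

lemma const_L2: "(\<lambda>x. c) \<in> L2"
  by (auto simp: L2_def)

lemma L2_absolutely_integrable:
  fixes f :: "real \<Rightarrow> 'a::euclidean_space"
  assumes "f \<in> L2" shows "f absolutely_integrable_on {0..1}"
  using L2_mult_absolutely_integrable[OF const_L2[of "1::real"] assms, of "\<lambda>c x. c *\<^sub>R x"]
  by (auto simp: bilinear_conv_bounded_bilinear bounded_bilinear_scaleR)

lemma L2I:
  fixes f :: "real \<Rightarrow> 'a::euclidean_space"
  assumes "f \<in> borel_measurable unit_meas" "g absolutely_integrable_on {0..1}"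
    and "\<And>x. x \<in> {0..1} \<Longrightarrow> (norm (f x))\<^sup>2 \<le> g x"
  shows "f \<in> L2"
proof -
  have "(\<lambda>x. (norm (f x))\<^sup>2) absolutely_integrable_on {0..1}"
    by (rule measurable_bounded_by_integrable_imp_absolutely_integrable[where g=g])
      (use assms set_lebesgue_integral_eq_integral(1)[OF assms(2)] in auto)
  then show ?thesis using assms(1) by (simp add: L2_def unit_meas_iff)
qed

lemma continuous_on_L2:
  fixes f :: "real \<Rightarrow> 'a::euclidean_space"
  assumes "continuous_on {0..1} f" shows "f \<in> L2"
proof (rule L2I)
  show "f \<in> borel_measurable unit_meas"
    by (rule continuous_imp_measurable_on_sets_lebesgue[OF assms]) auto
  show "(\<lambda>x. (norm (f x))\<^sup>2) absolutely_integrable_on {0..1}"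
    by (intro absolutely_integrable_continuous_real continuous_intros assms)
qed auto

lemma L2_add:
  fixes f g :: "real \<Rightarrow> 'a::euclidean_space"
  assumes "f \<in> L2" "g \<in> L2" shows "(\<lambda>x. f x + g x) \<in> L2"
proof (rule L2I)
  show "(\<lambda>x. f x + g x) \<in> borel_measurable unit_meas" using assms by (auto simp: L2_def)
  show "(\<lambda>x. 2 * (norm (f x))\<^sup>2 + 2 * (norm (g x))\<^sup>2) absolutely_integrable_on {0..1}"
    by (intro set_integral_add set_integrable_mult_right impI L2_square assms)
  fix x
  have "(norm (f x + g x))\<^sup>2 \<le> (norm (f x) + norm (g x))\<^sup>2"
    by (intro power_mono norm_triangle_ineq) auto
  also have "\<dots> \<le> 2 * (norm (f x))\<^sup>2 + 2 * (norm (g x))\<^sup>2"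
    using sum_squares_bound[of "norm (f x)" "norm (g x)"] by (simp add: power2_sum)
  finally show "(norm (f x + g x))\<^sup>2 \<le> 2 * (norm (f x))\<^sup>2 + 2 * (norm (g x))\<^sup>2" .
qed

lemma L2_bounded_bilinear_continuous:
  fixes f :: "real \<Rightarrow> 'a::euclidean_space" and g :: "real \<Rightarrow> 'b::euclidean_space" and h :: "'a \<Rightarrow> 'b \<Rightarrow> 'c::euclidean_space"
  assumes c: "continuous_on {0..1} f" and g: "g \<in> L2" "bilinear h" and le: "\<And>x y. norm (h x y) \<le> norm x * norm y"
  shows "(\<lambda>x. h (f x) (g x)) \<in> L2"
proof -
  have "bounded (f ` {0..1})" by (intro compact_imp_bounded compact_continuous_image c) auto
  then obtain C where C: "\<And>x. x \<in> {0..1} \<Longrightarrow> norm (f x) \<le> C" unfolding bounded_iff by blast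
  show ?thesis
  proof (rule L2I)
    show "(\<lambda>x. h (f x) (g x)) \<in> borel_measurable unit_meas"
      by (rule borel_measurable_bilinear[OF g(2) L2_measurable[OF continuous_on_L2[OF c]] L2_measurable[OF g(1)]]) auto
    show "(\<lambda>x. C\<^sup>2 * (norm (g x))\<^sup>2) absolutely_integrable_on {0..1}"
      by (intro set_integrable_mult_right impI L2_square g)
    fix x assume "x \<in> {0..1::real}"
    then have "norm (h (f x) (g x)) \<le> C * norm (g x)"
      using le[of "f x" "g x"] C[of x] by (meson mult_right_mono norm_ge_zero order_trans)
    then show "(norm (h (f x) (g x)))\<^sup>2 \<le> C\<^sup>2 * (norm (g x))\<^sup>2"
      using power_mono[of "norm (h (f x) (g x))" "C * norm (g x)" 2] by (simp add: power_mult_distrib)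
  qed
qed

lemma L2_complex_mult_cont: "continuous_on {0..1} f \<Longrightarrow> g \<in> L2 \<Longrightarrow> (\<lambda>x. f x * g x) \<in> L2"
  for f g :: "real \<Rightarrow> complex"
  by (rule L2_bounded_bilinear_continuous[OF _ _ bilinear_times]) (auto simp: norm_mult)

lemma L2_real_mult_cont: "continuous_on {0..1} f \<Longrightarrow> g \<in> L2 \<Longrightarrow> (\<lambda>x. f x * g x) \<in> L2"
  for f g :: "real \<Rightarrow> real"
  by (rule L2_bounded_bilinear_continuous[OF _ _ bilinear_times]) (auto simp: abs_mult)

section \<open>The Sobolev space and weak derivatives\<close>

lemma antiderivative_UNIV:
  fixes k :: "real \<Rightarrow> real"
  assumes "continuous_on UNIV k"
  shows "\<exists>F. \<forall>x. (F has_real_derivative k x) (at x)"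
proof -
  have "\<exists>F. \<forall>x::real. -\<infinity> < ereal x \<longrightarrow> ereal x < \<infinity> \<longrightarrow> (F has_vector_derivative k x) (at x)"
    by (rule einterval_antiderivative) (use assms in \<open>auto simp: continuous_on_eq_continuous_at\<close>)
  then show ?thesis by (auto simp: has_real_derivative_iff_has_vector_derivative)
qed

text \<open>The primitive vanishes left of u by normalisation, and right of v because k has mean
  zero.\<close>

lemma test_function_of_derivative:
  fixes k :: "real \<Rightarrow> real"
  assumes k: "continuous_on UNIV k" and uv: "0 < u" "u \<le> v" "v < 1"
    and out: "\<And>x. x \<notin> {u..v} \<Longrightarrow> k x = 0" and int: "integral {u..v} k = 0"
  shows "\<exists>\<phi>\<in>test_functions. deriv \<phi> = k"
proof -
  obtain F where F: "\<And>x. (F has_real_derivative k x) (at x)"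
    using antiderivative_UNIV[OF k] by blast
  define \<phi> where "\<phi> x = F x - F u" for x
  have d: "(\<phi> has_real_derivative k x) (at x)" for x
    unfolding \<phi>_def by (auto intro!: derivative_eq_intros F)
  have ftc: "(k has_integral F t - F s) {s..t}" if "s \<le> t" for s t
    by (rule fundamental_theorem_of_calculus[OF that])
      (use F in \<open>auto intro: has_vector_derivative_at_within simp: has_real_derivative_iff_has_vector_derivative\<close>)
  \<comment> \<open>The hypothesis covers only points outside [u,v]; continuity from outside gives
    the value 0 at both ends.\<close>
  have ku: "k u = 0" "k v = 0"
  proof -
    have z: "k x = 0" if "x \<in> closure {x. x < u}" for x
      by (rule continuous_constant_on_closure[OF continuous_on_subset[OF k] _ that]) (use out in auto)
    show "k u = 0" by (rule z) (simp add: closure_lessThan[unfolded lessThan_def])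
    have z: "k x = 0" if "x \<in> closure {x. v < x}" for x
      by (rule continuous_constant_on_closure[OF continuous_on_subset[OF k] _ that]) (use out in auto)
    show "k v = 0" by (rule z) (simp add: closure_greaterThan[unfolded greaterThan_def])
  qed
  have k0: "k x = 0" if "x \<le> u \<or> v \<le> x" for x
    using that out[of x] ku by (cases "x = u \<or> x = v") auto
  have "\<phi> x = 0" if "x \<notin> {u..v}" for x
  proof (cases "x < u")
    case True
    have "(k has_integral 0) {x..u}"
      by (rule has_integral_is_0) (use k0 in auto)
    from has_integral_unique[OF ftc this] True show ?thesis unfolding \<phi>_def by simp
  next
    case False
    then have "v < x" using that uv by auto
    have "(k has_integral 0) {v..x}"
      by (rule has_integral_is_0) (use k0 in auto)
    from has_integral_unique[OF ftc this] \<open>v < x\<close> have "F x - F v = 0" by simp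
    moreover have "F v - F u = 0" using integral_unique[OF ftc[OF uv(2)]] int by simp
    ultimately show ?thesis unfolding \<phi>_def by simp
  qed
  moreover have "deriv \<phi> = k" using d by (intro ext) (rule DERIV_imp_deriv)
  moreover have "\<forall>x. \<phi> differentiable (at x)" using d real_differentiable_def by blast
  ultimately have "\<phi> \<in> test_functions"
    unfolding test_functions_def using k uv by blast
  with \<open>deriv \<phi> = k\<close> show ?thesis by blast
qed

text \<open>On [u,v] let c be the mean of h weighted by a bump \<tau>. Then
  \<open>(h x - c) * \<tau> x\<close> has mean zero and is the derivative of a test function;
  testing h against it leaves the integral of \<open>(h x - c)^2 * \<tau> x\<close>, which must
  vanish.\<close>

lemma du_Bois_Reymond:
  fixes h :: "real \<Rightarrow> real"
  assumes h: "continuous_on {0..1} h"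
    and orth: "\<And>\<phi>. \<phi> \<in> test_functions \<Longrightarrow> integral {0..1} (\<lambda>x. deriv \<phi> x * h x) = 0"
    and x: "x \<in> {0..1}"
  shows "h x = h 0"
proof -
  have loc: "\<exists>c. \<forall>x\<in>{u<..<v}. h x = c" if uv: "0 < u" "u < v" "v < 1" for u v
  proof -
    define \<tau> where "\<tau> x = max 0 ((x - u) * (v - x))" for x
    have \<tau>c: "continuous_on S \<tau>" for S unfolding \<tau>_def by (intro continuous_intros)
    have \<tau>0: "\<tau> x = 0" if "x \<notin> {u..v}" for x
    proof -
      have "(x - u) * (v - x) \<le> 0" using that uv by (auto simp: mult_le_0_iff)
      then show ?thesis unfolding \<tau>_def by simp
    qed
    have \<tau>pos: "\<tau> x > 0" if "x \<in> {u<..<v}" for x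
      using that unfolding \<tau>_def by auto
    \<comment> \<open>Clamping the argument extends h continuously to the whole line, where
      derivatives of test functions have to be continuous.\<close>
    define H where "H x = h (max 0 (min 1 x))" for x
    have Hc: "continuous_on S H" for S unfolding H_def
      by (rule continuous_on_compose2[OF h]) (auto intro!: continuous_intros)
    have Hh: "H x = h x" if "x \<in> {0..1}" for x using that by (auto simp: H_def)
    have i\<tau>: "\<tau> integrable_on {u..v}" "(\<lambda>x. H x * \<tau> x) integrable_on {u..v}"
      by (auto intro!: integrable_continuous_real continuous_intros \<tau>c Hc)
    have "integral {u..v} \<tau> \<noteq> 0"
    proof
      assume "integral {u..v} \<tau> = 0"
      moreover have "\<tau> x \<ge> 0" for x by (simp add: \<tau>_def)
      ultimately have "\<forall>x\<in>{u..v}. \<tau> x = 0"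
        using integral_eq_0_iff[of u v \<tau>] \<tau>c uv by blast
      then show False using \<tau>pos[of "(u+v)/2"] uv by auto
    qed
    define c where "c = integral {u..v} (\<lambda>x. H x * \<tau> x) / integral {u..v} \<tau>"
    define k where "k x = (H x - c) * \<tau> x" for x
    have kc: "continuous_on S k" for S unfolding k_def by (intro continuous_intros Hc \<tau>c)
    have k0: "k x = 0" if "x \<notin> {u..v}" for x using \<tau>0[OF that] by (simp add: k_def)
    have ki: "integral {u..v} k = 0"
    proof -
      have "integral {u..v} k = integral {u..v} (\<lambda>x. H x * \<tau> x - c * \<tau> x)"
        by (simp add: k_def[abs_def] left_diff_distrib)
      also have "\<dots> = integral {u..v} (\<lambda>x. H x * \<tau> x) - integral {u..v} (\<lambda>x. c * \<tau> x)"
        by (rule Henstock_Kurzweil_Integration.integral_diff[OF i\<tau>(2) integrable_on_mult_right[OF i\<tau>(1)]])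
      also have "\<dots> = 0" using \<open>integral {u..v} \<tau> \<noteq> 0\<close> by (simp add: c_def)
      finally show ?thesis .
    qed
    obtain \<phi> where \<phi>: "\<phi> \<in> test_functions" "deriv \<phi> = k"
      using test_function_of_derivative[OF kc uv(1) less_imp_le[OF uv(2)] uv(3) k0 ki] by blast
    have restrict: "integral {u..v} g = integral {0..1} g" if "\<And>x. x \<notin> {u..v} \<Longrightarrow> g x = 0" for g :: "real \<Rightarrow> real"
    proof -
      have eq: "(\<lambda>x. if x \<in> {u..v} then g x else 0) = g" using that by auto
      have sub: "{u..v} \<inter> {0..1} = {u..v}" using uv by auto
      have "integral {0..1} (\<lambda>x. if x \<in> {u..v} then g x else 0) = integral ({u..v} \<inter> {0..1}) g"
        by (rule Henstock_Kurzweil_Integration.integral_restrict_Int)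
      then show ?thesis unfolding eq sub by (rule sym)
    qed
    have "integral {u..v} (\<lambda>x. k x * H x) = integral {0..1} (\<lambda>x. k x * H x)"
      by (rule restrict) (simp add: k0)
    also have "\<dots> = integral {0..1} (\<lambda>x. deriv \<phi> x * h x)"
      by (rule Henstock_Kurzweil_Integration.integral_cong) (simp add: \<phi> Hh)
    also have "\<dots> = 0" by (rule orth[OF \<phi>(1)])
    finally have z: "integral {u..v} (\<lambda>x. k x * H x) = 0" .
    have "integral {u..v} (\<lambda>x. (H x - c)\<^sup>2 * \<tau> x) = integral {u..v} (\<lambda>x. k x * H x - c * k x)"
      by (simp add: k_def power2_eq_square algebra_simps)
    also have "\<dots> = integral {u..v} (\<lambda>x. k x * H x) - integral {u..v} (\<lambda>x. c * k x)"
      by (rule Henstock_Kurzweil_Integration.integral_diff)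
        (auto intro!: integrable_continuous_real continuous_intros kc Hc)
    also have "\<dots> = 0" using z ki by simp
    finally have "integral {u..v} (\<lambda>x. (H x - c)\<^sup>2 * \<tau> x) = 0" .
    moreover have "continuous_on {u..v} (\<lambda>x. (H x - c)\<^sup>2 * \<tau> x)"
      by (intro continuous_intros Hc \<tau>c)
    moreover have "(H x - c)\<^sup>2 * \<tau> x \<ge> 0" for x by (simp add: \<tau>_def)
    ultimately have z0: "\<forall>x\<in>{u..v}. (H x - c)\<^sup>2 * \<tau> x = 0"
      using integral_eq_0_iff[of u v "\<lambda>x. (H x - c)\<^sup>2 * \<tau> x"] uv by blast
    have "h x = c" if x: "x \<in> {u<..<v}" for x
    proof -
      have "(H x - c)\<^sup>2 * \<tau> x = 0" using z0 x by simp
      then have "H x = c" using \<tau>pos[OF x] by simp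
      then show ?thesis using Hh[of x] x uv by simp
    qed
    then show ?thesis by blast
  qed
  have "h y = h (1/2)" if y: "y \<in> {0<..<1}" for y
  proof -
    \<comment> \<open>Each y is compared with 1/2 inside one interval that contains both and stays
      away from 0 and 1.\<close>
    define u where "u = min y (1/2) / 2"
    define v where "v = (max y (1/2) + 1) / 2"
    have uv: "0 < u" "u < v" "v < 1" "y \<in> {u<..<v}" "1/2 \<in> {u<..<v}"
      using y unfolding u_def v_def by auto
    from loc[OF uv(1-3)] uv(4,5) show ?thesis by metis
  qed
  then have *: "h y = h (1/2)" if "y \<in> {0<..<1}" for y using that by blast
  have cl: "closure {0<..<1::real} = {0..1}" by simp
  have "h y = h (1/2)" if y: "y \<in> {0..1}" for y
    by (rule continuous_constant_on_closure[of "{0<..<1}" h "h (1/2)" y, unfolded cl, OF h _ y]) (rule *)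
  from this[of x] this[of 0] x show ?thesis by simp
qed

text \<open>An element of the space together with one explicit derivative. Calculations carry their
  own g, so the arbitrary choice \<open>weak_deriv\<close> is met only through
  \<open>sob_weak_deriv\<close> and uniqueness almost everywhere.\<close>

definition sob :: "(real \<Rightarrow> complex) \<Rightarrow> (real \<Rightarrow> complex) \<Rightarrow> bool" where
  "sob y g \<longleftrightarrow> g \<in> L2 \<and> ac 0 1 (\<lambda>x. Re (y x)) (\<lambda>x. Re (g x)) \<and> ac 0 1 (\<lambda>x. Im (y x)) (\<lambda>x. Im (g x)) \<and>
     y 0 = 0 \<and> y 1 = 0 \<and> (\<forall>x. x \<notin> {0..1} \<longrightarrow> y x = 0)"

lemma sob_continuous_on: "sob y g \<Longrightarrow> continuous_on {0..1} y"
  unfolding sob_def using continuous_on_Complex[of "{0..1}" "\<lambda>x. Re (y x)" "\<lambda>x. Im (y x)"]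
  by (auto dest!: ac_continuous_on)

section \<open>Integration by parts against test functions\<close>

lemma test_function_ac:
  assumes "\<phi> \<in> test_functions"
  shows "ac 0 1 \<phi> (deriv \<phi>)" "continuous_on {0..1} \<phi>" "continuous_on {0..1} (deriv \<phi>)" "\<phi> 0 = 0" "\<phi> 1 = 0"
proof -
  have d: "(\<phi> has_real_derivative deriv \<phi> x) (at x)" for x
    using assms by (simp add: test_functions_def DERIV_deriv_iff_real_differentiable)
  show c: "continuous_on {0..1} (deriv \<phi>)"
    using assms by (auto simp: test_functions_def intro: continuous_on_subset)
  show "ac 0 1 \<phi> (deriv \<phi>)"
    by (rule ac_C1[OF _ c]) (rule has_field_derivative_at_within[OF d])
  then show "continuous_on {0..1} \<phi>" by (rule ac_continuous_on)
  show "\<phi> 0 = 0" "\<phi> 1 = 0" using assms by (force simp: test_functions_def)+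
qed

lemma test_function_by_parts:
  assumes "\<phi> \<in> test_functions" "ac 0 1 F f"
  shows "integral {0..1} (\<lambda>x. deriv \<phi> x * F x) = - integral {0..1} (\<lambda>x. \<phi> x * f x)"
proof -
  note t = test_function_ac[OF assms(1)]
  have "integral {0..1} (\<lambda>x. deriv \<phi> x * F x + \<phi> x * f x) = \<phi> 1 * F 1 - \<phi> 0 * F 0"
    using acD(2)[OF ac_mult[OF t(1) assms(2)], of 0 1] by simp
  also have "integral {0..1} (\<lambda>x. deriv \<phi> x * F x + \<phi> x * f x)
     = integral {0..1} (\<lambda>x. deriv \<phi> x * F x) + integral {0..1} (\<lambda>x. \<phi> x * f x)"
  proof (rule Henstock_Kurzweil_Integration.integral_add)
    show "(\<lambda>x. deriv \<phi> x * F x) integrable_on {0..1}"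
      by (intro integrable_continuous_real continuous_intros t ac_continuous_on[OF assms(2)])
    show "(\<lambda>x. \<phi> x * f x) integrable_on {0..1}"
      by (rule set_lebesgue_integral_eq_integral(1)[OF
          absolutely_integrable_continuous_mult[OF t(2) acD(1)[OF assms(2)]]])
  qed
  finally show ?thesis using t by simp
qed

lemma absolutely_integrable_ReIm:
  fixes f :: "real \<Rightarrow> complex"
  assumes "f absolutely_integrable_on S"
  shows "(\<lambda>x. Re (f x)) absolutely_integrable_on S" "(\<lambda>x. Im (f x)) absolutely_integrable_on S"
  using absolutely_integrable_linear[OF assms bounded_linear_Re]
    absolutely_integrable_linear[OF assms bounded_linear_Im] by (simp_all add: o_def)

lemma integral_ReIm:
  fixes f :: "real \<Rightarrow> complex"
  assumes "f integrable_on S"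
  shows "Re (integral S f) = integral S (\<lambda>x. Re (f x))" "Im (integral S f) = integral S (\<lambda>x. Im (f x))"
  using integral_linear[OF assms bounded_linear_Re] integral_linear[OF assms bounded_linear_Im]
  by (simp_all add: o_def)

lemma absolutely_integrable_scaleR_continuous:
  fixes g :: "real \<Rightarrow> complex"
  assumes "continuous_on {0..1} \<phi>" "g \<in> L2"
  shows "(\<lambda>x. \<phi> x *\<^sub>R g x) absolutely_integrable_on {0..1}"
  using L2_complex_mult_cont[of "\<lambda>x. of_real (\<phi> x)" g] assms
  by (auto intro!: L2_absolutely_integrable continuous_intros simp: scaleR_conv_of_real)

lemma sob_has_weak_derivative:
  assumes "sob y g" shows "has_weak_derivative y g"
  unfolding has_weak_derivative_def
proof (intro conjI ballI)
  note c = sob_continuous_on[OF assms]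
  show y: "y \<in> L2" by (rule continuous_on_L2[OF c])
  show g: "g \<in> L2" using assms by (simp add: sob_def)
  fix \<phi> assume \<phi>: "\<phi> \<in> test_functions"
  note t = test_function_ac[OF \<phi>]
  note ai = absolutely_integrable_scaleR_continuous[OF t(3) y] absolutely_integrable_scaleR_continuous[OF t(2) g]
  note i = ai[THEN set_lebesgue_integral_eq_integral(1)]
  have ac: "ac 0 1 (\<lambda>x. Re (y x)) (\<lambda>x. Re (g x))" "ac 0 1 (\<lambda>x. Im (y x)) (\<lambda>x. Im (g x))"
    using assms by (auto simp: sob_def)
  show "(\<integral>x. deriv \<phi> x *\<^sub>R y x \<partial>unit_meas) = - (\<integral>x. \<phi> x *\<^sub>R g x \<partial>unit_meas)"
    unfolding unit_meas_integral[OF ai(1)] unit_meas_integral[OF ai(2)]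
    using test_function_by_parts[OF \<phi> ac(1)] test_function_by_parts[OF \<phi> ac(2)]
    by (intro complex_eqI) (simp_all add: integral_ReIm[OF i(1)] integral_ReIm[OF i(2)])
qed

text \<open>The difference of y and the primitive of g is orthogonal to all derivatives of test
  functions, hence constant. With \<pi> standing for Re or Im one proof serves both parts.\<close>

lemma has_weak_derivative_ac:
  fixes \<pi> :: "complex \<Rightarrow> real"
  assumes w: "has_weak_derivative y g" and c: "continuous_on {0..1} y" and y0: "y 0 = 0"
    and \<pi>: "\<pi> = Re \<or> \<pi> = Im"
  shows "ac 0 1 (\<lambda>x. \<pi> (y x)) (\<lambda>x. \<pi> (g x))"
proof -
  have y: "y \<in> L2" and g: "g \<in> L2" using w by (auto simp: has_weak_derivative_def)
  have gi: "(\<lambda>x. \<pi> (g x)) absolutely_integrable_on {0..1}"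
    using absolutely_integrable_ReIm[OF L2_absolutely_integrable[OF g]] \<pi> by auto
  define Y where "Y x = integral {0..x} (\<lambda>x. \<pi> (g x))" for x
  have Y: "ac 0 1 Y (\<lambda>x. \<pi> (g x))"
    by (rule acI[OF gi, where c=0]) (simp add: Y_def)
  have \<pi>c: "continuous_on {0..1} (\<lambda>x. \<pi> (y x))"
    using \<pi> c by (auto intro!: continuous_intros)
  have "\<pi> (y x) - Y x = \<pi> (y 0) - Y 0" if "x \<in> {0..1}" for x
  proof (rule du_Bois_Reymond[OF _ _ that])
    show "continuous_on {0..1} (\<lambda>x. \<pi> (y x) - Y x)"
      by (intro continuous_intros \<pi>c ac_continuous_on[OF Y])
    fix \<phi> assume \<phi>: "\<phi> \<in> test_functions"
    note t = test_function_ac[OF \<phi>]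
    note ai = absolutely_integrable_scaleR_continuous[OF t(3) y] absolutely_integrable_scaleR_continuous[OF t(2) g]
    note i = ai[THEN set_lebesgue_integral_eq_integral(1)]
    have "(\<integral>x. deriv \<phi> x *\<^sub>R y x \<partial>unit_meas) = - (\<integral>x. \<phi> x *\<^sub>R g x \<partial>unit_meas)"
      using w \<phi> by (auto simp: has_weak_derivative_def)
    then have eq: "integral {0..1} (\<lambda>x. deriv \<phi> x *\<^sub>R y x) = - integral {0..1} (\<lambda>x. \<phi> x *\<^sub>R g x)"
      unfolding unit_meas_integral[OF ai(1)] unit_meas_integral[OF ai(2)] .
    have "integral {0..1} (\<lambda>x. deriv \<phi> x * \<pi> (y x)) = - integral {0..1} (\<lambda>x. \<phi> x * \<pi> (g x))"
      using arg_cong[OF eq, of \<pi>] \<pi>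
      by (auto simp: integral_ReIm[OF i(1)] integral_ReIm[OF i(2)])
    moreover have "integral {0..1} (\<lambda>x. deriv \<phi> x * Y x) = - integral {0..1} (\<lambda>x. \<phi> x * \<pi> (g x))"
      by (rule test_function_by_parts[OF \<phi> Y])
    moreover have "integral {0..1} (\<lambda>x. deriv \<phi> x * \<pi> (y x) - deriv \<phi> x * Y x)
      = integral {0..1} (\<lambda>x. deriv \<phi> x * \<pi> (y x)) - integral {0..1} (\<lambda>x. deriv \<phi> x * Y x)"
      by (rule Henstock_Kurzweil_Integration.integral_diff)
        (auto intro!: integrable_continuous_real continuous_intros t \<pi>c ac_continuous_on[OF Y])
    ultimately show "integral {0..1} (\<lambda>x. deriv \<phi> x * (\<pi> (y x) - Y x)) = 0"
      by (simp add: right_diff_distrib)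
  qed
  moreover have "\<pi> (y 0) = 0" "Y 0 = 0" using y0 \<pi> by (auto simp: Y_def)
  ultimately show ?thesis
    by (intro ac_cong[OF Y]) auto
qed

lemma sob_weak_deriv:
  assumes "y \<in> W21_0" shows "sob y (weak_deriv y)"
proof -
  have "\<exists>g. has_weak_derivative y g" using assms by (auto simp: W21_0_def W21_def)
  then have w: "has_weak_derivative y (weak_deriv y)" unfolding weak_deriv_def by (rule someI_ex)
  have c: "continuous_on {0..1} y" "y 0 = 0" using assms by (auto simp: W21_0_def)
  show ?thesis
    using has_weak_derivative_ac[OF w c, of Re] has_weak_derivative_ac[OF w c, of Im] w assms
    by (auto simp: sob_def W21_0_def has_weak_derivative_def)
qed

lemma sob_W21_0: "sob y g \<Longrightarrow> y \<in> W21_0"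
  using sob_continuous_on[of y g] sob_has_weak_derivative[of y g]
  by (auto simp: W21_0_def W21_def sob_def)

lemma W21_0_iff: "y \<in> W21_0 \<longleftrightarrow> (\<exists>g. sob y g)"
  using sob_W21_0 sob_weak_deriv by blast

lemma ac_unique:
  assumes "ac a b F f" "ac a b F g"
  shows "AE x in lebesgue. x \<in> {a..b} \<longrightarrow> f x = g x"
proof -
  have "ac a b (\<lambda>x. F x + (-1) * F x) (\<lambda>x. f x + (-1) * g x)"
    by (intro ac_add ac_cmult assms)
  from AE_zero_of_interval_integrals_zero[OF acD(1)[OF this]] acD(2)[OF this]
  have "AE x in lebesgue. x \<in> {a..b} \<longrightarrow> f x + (-1) * g x = 0" by simp
  then show ?thesis by (rule AE_mp) (auto intro!: AE_I2)
qed

lemma sob_unique: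
  assumes "sob y g" "sob y h"
  shows "AE x in lebesgue. x \<in> {0..1} \<longrightarrow> g x = h x"
proof -
  have "AE x in lebesgue. x \<in> {0..1} \<longrightarrow> Re (g x) = Re (h x)"
    "AE x in lebesgue. x \<in> {0..1} \<longrightarrow> Im (g x) = Im (h x)"
    using ac_unique[of 0 1 "\<lambda>x. Re (y x)"] ac_unique[of 0 1 "\<lambda>x. Im (y x)"] assms
    by (auto simp: sob_def)
  then show ?thesis by eventually_elim (auto simp: complex_eq_iff)
qed

section \<open>Negative index and linear functionals\<close>

lemma sob_add:
  assumes "sob y g" "sob z h" shows "sob (y + z) (\<lambda>x. g x + h x)"
  using assms L2_add[of g h] ac_add[of 0 1 "\<lambda>x. Re (y x)" "\<lambda>x. Re (g x)"]
    ac_add[of 0 1 "\<lambda>x. Im (y x)" "\<lambda>x. Im (g x)"]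
  by (simp add: sob_def)

lemma sob_cscale:
  assumes "sob y g" shows "sob (cscale c y) (\<lambda>x. c * g x)"
proof -
  have g: "g \<in> L2" and re: "ac 0 1 (\<lambda>x. Re (y x)) (\<lambda>x. Re (g x))" and im: "ac 0 1 (\<lambda>x. Im (y x)) (\<lambda>x. Im (g x))"
    using assms by (auto simp: sob_def)
  have "(\<lambda>x. c * g x) \<in> L2" by (rule L2_complex_mult_cont[OF continuous_on_const g])
  moreover have "ac 0 1 (\<lambda>x. Re c * Re (y x) + (- Im c) * Im (y x)) (\<lambda>x. Re c * Re (g x) + (- Im c) * Im (g x))"
    "ac 0 1 (\<lambda>x. Re c * Im (y x) + Im c * Re (y x)) (\<lambda>x. Re c * Im (g x) + Im c * Re (g x))"
    by (intro ac_add ac_cmult re im)+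
  ultimately show ?thesis using assms by (simp add: sob_def cscale_def)
qed

lemma sob_zero: "sob 0 (\<lambda>x. 0)"
  using const_L2[of 0] ac_const[of 0 1 0] by (simp add: sob_def)

lemma W21_0_subspace: "cfun.subspace W21_0"
proof (rule cfun.subspaceI)
  show "0 \<in> W21_0" by (rule sob_W21_0[OF sob_zero])
  show "x + y \<in> W21_0" if "x \<in> W21_0" "y \<in> W21_0" for x y
    by (rule sob_W21_0[OF sob_add[OF sob_weak_deriv[OF that(1)] sob_weak_deriv[OF that(2)]]])
  show "cscale c x \<in> W21_0" if "x \<in> W21_0" for c x
    by (rule sob_W21_0[OF sob_cscale[OF sob_weak_deriv[OF that]]])
qed

lemma sob_L2: "sob y g \<Longrightarrow> g \<in> L2"
  by (simp add: sob_def)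

lemma cnj_L2: "f \<in> L2 \<Longrightarrow> (\<lambda>x. cnj (f x)) \<in> L2"
  unfolding L2_def by (auto intro: borel_measurable_continuous_on[OF continuous_on_cnj[OF continuous_on_id]])

lemma of_real_L2: "P \<in> L2 \<Longrightarrow> (\<lambda>x. complex_of_real (P x)) \<in> L2"
  unfolding L2_def by (auto intro: borel_measurable_continuous_on[OF continuous_on_of_real_id])

lemma L2_cmult: "(f :: real \<Rightarrow> complex) \<in> L2 \<Longrightarrow> g \<in> L2 \<Longrightarrow> (\<lambda>x. f x * g x) absolutely_integrable_on {0..1}"
  by (rule L2_mult_absolutely_integrable[OF _ _ bilinear_times]) (auto simp: norm_mult)

section \<open>The pencil as a Hermitian form\<close>

lemma pencil_integrable:
  assumes P: "P \<in> L2" and y: "sob y g" and z: "sob z h"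
  shows "(\<lambda>x. g x * cnj (h x)) absolutely_integrable_on {0..1}"
    and "(\<lambda>x. of_real (P x) * (g x * cnj (z x) + y x * cnj (h x))) absolutely_integrable_on {0..1}"
    and "(\<lambda>x. g x * cnj (h x) + of_real l * of_real (P x) * (g x * cnj (z x) + y x * cnj (h x)))
           absolutely_integrable_on {0..1}"
proof -
  note yc = sob_continuous_on[OF y] and zc = sob_continuous_on[OF z]
  show 1: "(\<lambda>x. g x * cnj (h x)) absolutely_integrable_on {0..1}"
    by (rule L2_cmult[OF sob_L2[OF y] cnj_L2[OF sob_L2[OF z]]])
  have "(\<lambda>x. cnj (z x) * g x + y x * cnj (h x)) \<in> L2"
    by (intro L2_add L2_complex_mult_cont continuous_intros yc zc sob_L2[OF y] cnj_L2 sob_L2[OF z])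
  from L2_cmult[OF of_real_L2[OF P] this]
  show 2: "(\<lambda>x. of_real (P x) * (g x * cnj (z x) + y x * cnj (h x))) absolutely_integrable_on {0..1}"
    by (simp add: mult.commute)
  have "(\<lambda>x. of_real l * (of_real (P x) * (g x * cnj (z x) + y x * cnj (h x)))) absolutely_integrable_on {0..1}"
    by (rule set_integrable_mult_right[OF 2])
  from set_integral_add(1)[OF 1 this]
  show "(\<lambda>x. g x * cnj (h x) + of_real l * of_real (P x) * (g x * cnj (z x) + y x * cnj (h x)))
           absolutely_integrable_on {0..1}" by (simp add: mult.assoc)
qed

lemma T_pencil_sob:
  assumes P: "P \<in> L2" and y: "sob y g" and z: "sob z h"
  shows "T_pencil P l y z = integral {0..1} (\<lambda>x. g x * cnj (h x)
    + of_real l * of_real (P x) * (g x * cnj (z x) + y x * cnj (h x)))"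
proof -
  have wy: "sob y (weak_deriv y)" by (rule sob_weak_deriv[OF sob_W21_0[OF y]])
  have wz: "sob z (weak_deriv z)" by (rule sob_weak_deriv[OF sob_W21_0[OF z]])
  have "T_pencil P l y z = integral {0..1} (\<lambda>x. weak_deriv y x * cnj (weak_deriv z x)
    + of_real l * of_real (P x) * (weak_deriv y x * cnj (z x) + y x * cnj (weak_deriv z x)))"
    unfolding T_pencil_def by (rule unit_meas_integral[OF pencil_integrable(3)[OF P wy wz]])
  also have "\<dots> = integral {0..1} (\<lambda>x. g x * cnj (h x)
    + of_real l * of_real (P x) * (g x * cnj (z x) + y x * cnj (h x)))"
  proof -
    have "AE x in lebesgue. x \<in> {0..1} \<longrightarrow> weak_deriv y x = g x \<and> weak_deriv z x = h x"
      using sob_unique[OF wy y] sob_unique[OF wz z] by eventually_elim auto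
    then obtain N where N: "\<And>x. x \<in> space lebesgue - N \<Longrightarrow>
        x \<in> {0..1} \<longrightarrow> weak_deriv y x = g x \<and> weak_deriv z x = h x" "N \<in> null_sets lebesgue"
      by (rule AE_E3) (rule that)
    show ?thesis
      by (rule integral_spike[of N]) (use N in \<open>simp_all add: negligible_iff_null_sets\<close>)
  qed
  finally show ?thesis .
qed

text \<open>Restricted to \<open>W21_0\<close>, since the pencil is sesquilinear only where weak
  derivatives exist.\<close>

definition hermitian :: "((real \<Rightarrow> complex) \<Rightarrow> (real \<Rightarrow> complex) \<Rightarrow> complex) \<Rightarrow> bool" where
  "hermitian T \<longleftrightarrow> (\<forall>x\<in>W21_0. \<forall>y\<in>W21_0. \<forall>z\<in>W21_0. T (x + y) z = T x z + T y z) \<and>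
     (\<forall>c. \<forall>x\<in>W21_0. \<forall>z\<in>W21_0. T (cscale c x) z = c * T x z) \<and>
     (\<forall>x\<in>W21_0. \<forall>z\<in>W21_0. T z x = cnj (T x z))"

lemma hermitian_T_pencil:
  assumes P: "P \<in> L2" shows "hermitian (T_pencil P l)"
  unfolding hermitian_def
proof (intro conjI ballI allI)
  fix x y z :: "real \<Rightarrow> complex" assume "x \<in> W21_0" "y \<in> W21_0" "z \<in> W21_0"
  then obtain f g h where s: "sob x f" "sob y g" "sob z h" unfolding W21_0_iff by blast
  note i = pencil_integrable(3)[OF P s(1,3), THEN set_lebesgue_integral_eq_integral(1)]
    pencil_integrable(3)[OF P s(2,3), THEN set_lebesgue_integral_eq_integral(1)]
  show "T_pencil P l (x + y) z = T_pencil P l x z + T_pencil P l y z"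
    unfolding T_pencil_sob[OF P sob_add[OF s(1,2)] s(3)] T_pencil_sob[OF P s(1,3)] T_pencil_sob[OF P s(2,3)]
      Henstock_Kurzweil_Integration.integral_add[OF i, symmetric]
    by (rule Henstock_Kurzweil_Integration.integral_cong) (simp add: algebra_simps)
next
  fix c and x z :: "real \<Rightarrow> complex" assume "x \<in> W21_0" "z \<in> W21_0"
  then obtain f h where s: "sob x f" "sob z h" unfolding W21_0_iff by blast
  show "T_pencil P l (cscale c x) z = c * T_pencil P l x z"
    unfolding T_pencil_sob[OF P sob_cscale[OF s(1)] s(2)] T_pencil_sob[OF P s] Henstock_Kurzweil_Integration.integral_mult_right[symmetric]
    by (rule Henstock_Kurzweil_Integration.integral_cong) (simp add: algebra_simps cscale_def)
  show "T_pencil P l z x = cnj (T_pencil P l x z)"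
    unfolding T_pencil_sob[OF P s(2,1)] T_pencil_sob[OF P s] integral_cnj
    by (rule Henstock_Kurzweil_Integration.integral_cong) (simp add: algebra_simps)
qed

lemma hermitianD:
  assumes "hermitian T"
  shows "x \<in> W21_0 \<Longrightarrow> y \<in> W21_0 \<Longrightarrow> z \<in> W21_0 \<Longrightarrow> T (x + y) z = T x z + T y z"
    and "x \<in> W21_0 \<Longrightarrow> z \<in> W21_0 \<Longrightarrow> T (cscale c x) z = c * T x z"
    and "x \<in> W21_0 \<Longrightarrow> z \<in> W21_0 \<Longrightarrow> T z x = cnj (T x z)"
    and "z \<in> W21_0 \<Longrightarrow> T 0 z = 0"
proof -
  have h: "\<forall>x\<in>W21_0. \<forall>y\<in>W21_0. \<forall>z\<in>W21_0. T (x + y) z = T x z + T y z"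
    "\<forall>c. \<forall>x\<in>W21_0. \<forall>z\<in>W21_0. T (cscale c x) z = c * T x z"
    "\<forall>x\<in>W21_0. \<forall>z\<in>W21_0. T z x = cnj (T x z)"
    using assms unfolding hermitian_def by blast+
  show "x \<in> W21_0 \<Longrightarrow> y \<in> W21_0 \<Longrightarrow> z \<in> W21_0 \<Longrightarrow> T (x + y) z = T x z + T y z"
    "x \<in> W21_0 \<Longrightarrow> z \<in> W21_0 \<Longrightarrow> T (cscale c x) z = c * T x z"
    "x \<in> W21_0 \<Longrightarrow> z \<in> W21_0 \<Longrightarrow> T z x = cnj (T x z)"
    by (rule h[rule_format]; assumption)+
  show "z \<in> W21_0 \<Longrightarrow> T 0 z = 0"
    using h(2)[rule_format, OF cfun.subspace_0[OF W21_0_subspace], of z 0] by simp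
qed

lemma lincomb_W21_0: "(\<And>i. i \<in> I \<Longrightarrow> e i \<in> W21_0) \<Longrightarrow> (\<Sum>i\<in>I. cscale (c i) (e i)) \<in> W21_0"
  by (intro cfun.subspace_sum[OF W21_0_subspace] cfun.subspace_scale[OF W21_0_subspace])

lemma hermitian_sum_left:
  assumes T: "hermitian T" and e: "\<And>i. i \<in> I \<Longrightarrow> e i \<in> W21_0" and z: "z \<in> W21_0"
  shows "T (\<Sum>i\<in>I. cscale (c i) (e i)) z = (\<Sum>i\<in>I. c i * T (e i) z)"
proof (cases "finite I")
  case True
  then show ?thesis using e
  proof (induction I)
    case empty
    show ?case unfolding sum.empty by (rule hermitianD(4)[OF T z])
  next
    case (insert i I)
    have I: "(\<Sum>i\<in>I. cscale (c i) (e i)) \<in> W21_0" by (rule lincomb_W21_0) (use insert.prems in blast)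
    have ei: "e i \<in> W21_0" using insert.prems by blast
    have "T (\<Sum>i\<in>I. cscale (c i) (e i)) z = (\<Sum>i\<in>I. c i * T (e i) z)"
      by (rule insert.IH) (use insert.prems in blast)
    then show ?case
      unfolding sum.insert[OF insert.hyps]
        hermitianD(1)[OF T cfun.subspace_scale[OF W21_0_subspace ei] I z, of "c i"]
        hermitianD(2)[OF T ei z, of "c i"] by simp
  qed
next
  case False
  show ?thesis unfolding sum.infinite[OF False] by (rule hermitianD(4)[OF T z])
qed

lemma hermitian_sum_right:
  assumes T: "hermitian T" and e: "\<And>i. i \<in> I \<Longrightarrow> e i \<in> W21_0" and z: "z \<in> W21_0"
  shows "T z (\<Sum>i\<in>I. cscale (c i) (e i)) = (\<Sum>i\<in>I. cnj (c i) * T z (e i))"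
proof -
  have "T z (\<Sum>i\<in>I. cscale (c i) (e i)) = cnj (T (\<Sum>i\<in>I. cscale (c i) (e i)) z)"
    by (rule hermitianD(3)[OF T lincomb_W21_0[OF e] z])
  also have "\<dots> = (\<Sum>i\<in>I. cnj (c i) * cnj (T (e i) z))"
    by (simp add: hermitian_sum_left[OF T e z])
  also have "\<dots> = (\<Sum>i\<in>I. cnj (c i) * T z (e i))"
    by (intro sum.cong refl arg_cong2[where f="(*)"] hermitianD(3)[OF T e z, symmetric])
  finally show ?thesis .
qed

text \<open>Negative definiteness in coordinates. The index type is arbitrary because numbers, pairs
  and zeros of a solution all serve as indices later.\<close>

definition neg_family ::
    "((real \<Rightarrow> complex) \<Rightarrow> (real \<Rightarrow> complex) \<Rightarrow> complex) \<Rightarrow> 'i set \<Rightarrow> ('i \<Rightarrow> real \<Rightarrow> complex) \<Rightarrow> bool" where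
  "neg_family T I e \<longleftrightarrow> finite I \<and> (\<forall>i\<in>I. e i \<in> W21_0) \<and>
     (\<forall>c. (\<exists>i\<in>I. c i \<noteq> 0) \<longrightarrow>
       Re (T (\<Sum>i\<in>I. cscale (c i) (e i)) (\<Sum>i\<in>I. cscale (c i) (e i))) < 0)"

text \<open>A vanishing nontrivial combination would give the value 0 instead of a negative one; so
  e is injective on I and its image is linearly independent.\<close>

lemma neg_family_ind:
  assumes T: "hermitian T" and f: "neg_family T I e"
  shows "enat (card I) \<le> ind T"
proof -
  have fin: "finite I" and W: "\<And>i. i \<in> I \<Longrightarrow> e i \<in> W21_0"
    and neg: "\<And>c. \<exists>i\<in>I. c i \<noteq> 0 \<Longrightarrow> Re (T (\<Sum>i\<in>I. cscale (c i) (e i)) (\<Sum>i\<in>I. cscale (c i) (e i))) < 0"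
    using f by (auto simp: neg_family_def)
  have T0: "T 0 0 = 0"
    by (rule hermitianD(4)[OF T cfun.subspace_0[OF W21_0_subspace]])
  have nz: "(\<Sum>i\<in>I. cscale (c i) (e i)) \<noteq> 0" if "\<exists>i\<in>I. c i \<noteq> 0" for c
    using neg[OF that] T0 by auto
  have inj: "inj_on e I"
  proof (rule inj_onI, rule ccontr)
    fix i j assume ij: "i \<in> I" "j \<in> I" "e i = e j" "i \<noteq> j"
    define c where "c k = (if k = i then 1 else if k = j then -1 else 0 :: complex)" for k
    have "(\<Sum>k\<in>I. cscale (c k) (e k)) = (\<Sum>k\<in>{i,j}. cscale (c k) (e k))"
      by (rule sum.mono_neutral_right) (use fin ij in \<open>auto simp: c_def\<close>)
    also have "\<dots> = 0" using ij by (auto simp: c_def cscale_def fun_eq_iff)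
    finally have "(\<Sum>k\<in>I. cscale (c k) (e k)) = 0" .
    moreover have "\<exists>k\<in>I. c k \<noteq> 0" using ij by (intro bexI[of _ i]) (auto simp: c_def)
    ultimately show False using nz by blast
  qed
  have repr: "(\<Sum>v\<in>e ` I. cscale (u v) v) = (\<Sum>i\<in>I. cscale (u (e i)) (e i))" for u
    using inj by (simp add: sum.reindex)
  have indep: "\<not> cfun.dependent (e ` I)"
  proof
    assume "cfun.dependent (e ` I)"
    then obtain u where u: "\<exists>v\<in>e ` I. u v \<noteq> 0" "(\<Sum>v\<in>e ` I. cscale (u v) v) = 0"
      using cfun.dependent_finite[of "e ` I"] fin by auto
    then show False using nz[of "\<lambda>i. u (e i)"] unfolding repr by auto
  qed
  define V where "V = cfun.span (e ` I)"
  have dim: "cfun.dim V = card I"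
    unfolding V_def cfun.dim_span using cfun.dim_eq_card_independent[OF indep] card_image[OF inj] by simp
  have "negative_definite_on V T"
    unfolding negative_definite_on_def
  proof (intro ballI impI)
    fix y assume y: "y \<in> V" "y \<noteq> 0"
    then obtain u where u: "y = (\<Sum>v\<in>e ` I. cscale (u v) v)"
      using cfun.span_finite[of "e ` I"] fin unfolding V_def by auto
    have "\<exists>i\<in>I. u (e i) \<noteq> 0"
    proof (rule ccontr)
      assume "\<not> (\<exists>i\<in>I. u (e i) \<noteq> 0)"
      then have "y = 0" unfolding u repr by (intro sum.neutral) auto
      then show False using y by simp
    qed
    from neg[OF this] show "Re (T y y) < 0" unfolding u repr .
  qed
  moreover have "V \<subseteq> W21_0" unfolding V_def
    by (rule cfun.span_minimal[OF _ W21_0_subspace]) (use W in auto)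
  ultimately have "enat (cfun.dim V) \<in> {enat (cfun.dim V) | V. cfun.subspace V \<and> V \<subseteq> W21_0 \<and>
     (\<exists>B. finite B \<and> V \<subseteq> cfun.span B) \<and> negative_definite_on V T}"
    using fin unfolding V_def by (intro CollectI exI[of _ "cfun.span (e ` I)"]) auto
  then show ?thesis unfolding ind_def dim[symmetric] by (rule Sup_upper)
qed

text \<open>Gaussian elimination, one equation per induction step: a pivot b0 with
  \<open>A j b0 \<noteq> 0\<close> is eliminated from the other equations, and its coefficient is
  recovered from equation j at the end.\<close>

lemma underdetermined_system:
  fixes A :: "'j \<Rightarrow> 'b \<Rightarrow> complex"
  assumes "finite J" "finite B" "card J < card B"
  shows "\<exists>c. (\<exists>b\<in>B. c b \<noteq> 0) \<and> (\<forall>j\<in>J. (\<Sum>b\<in>B. c b * A j b) = 0)"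
  using assms
proof (induction J arbitrary: B A)
  case empty
  then obtain b where "b \<in> B" by fastforce
  then show ?case by (intro exI[of _ "\<lambda>_. 1"]) auto
next
  case (insert j J)
  show ?case
  proof (cases "\<forall>b\<in>B. A j b = 0")
    case True
    have "card J < card B" using insert by simp
    from insert.IH[OF insert.prems(1) this, of A] True show ?thesis by auto
  next
    case False
    then obtain b0 where b0: "b0 \<in> B" "A j b0 \<noteq> 0" by blast
    define B' where "B' = B - {b0}"
    have B': "finite B'" "card J < card B'" "B = insert b0 B'" "b0 \<notin> B'"
      using insert b0 by (auto simp: B'_def)
    obtain c where c: "\<exists>b\<in>B'. c b \<noteq> 0"
      "\<And>i. i \<in> J \<Longrightarrow> (\<Sum>b\<in>B'. c b * (A i b - A j b / A j b0 * A i b0)) = 0"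
      using insert.IH[OF B'(1,2), of "\<lambda>i b. A i b - A j b / A j b0 * A i b0"] by blast
    define s where "s = (\<Sum>b\<in>B'. c b * A j b) / A j b0"
    define c' where "c' b = (if b = b0 then - s else c b)" for b
    have sum: "(\<Sum>b\<in>B. c' b * A i b) = (\<Sum>b\<in>B'. c b * A i b) - s * A i b0" for i
    proof -
      have "(\<Sum>b\<in>B'. c' b * A i b) = (\<Sum>b\<in>B'. c b * A i b)"
        by (rule sum.cong) (use B'(4) in \<open>auto simp: c'_def\<close>)
      then show ?thesis using B' by (simp add: c'_def)
    qed
    have "(\<Sum>b\<in>B. c' b * A i b) = 0" if "i \<in> insert j J" for i
    proof (cases "i = j")
      case True then show ?thesis using b0 unfolding sum s_def by simp
    next
      case False
      have "s * A i b0 = (\<Sum>b\<in>B'. c b * (A j b / A j b0 * A i b0))"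
        unfolding s_def sum_divide_distrib sum_distrib_right by (intro sum.cong) auto
      then show ?thesis using c(2)[of i] False that unfolding sum
        by (simp add: right_diff_distrib sum_subtractf)
    qed
    moreover have "\<exists>b\<in>B. c' b \<noteq> 0"
      using c(1) B' unfolding c'_def by auto
    ultimately show ?thesis by blast
  qed
qed

section \<open>Bounding the index by linear conditions\<close>

definition functional :: "((real \<Rightarrow> complex) \<Rightarrow> complex) \<Rightarrow> bool" where
  "functional \<xi> \<longleftrightarrow> (\<forall>x\<in>W21_0. \<forall>y\<in>W21_0. \<xi> (x + y) = \<xi> x + \<xi> y) \<and>
     (\<forall>c. \<forall>x\<in>W21_0. \<xi> (cscale c x) = c * \<xi> x)"

lemma functionalD:
  assumes "functional \<xi>"
  shows "x \<in> W21_0 \<Longrightarrow> y \<in> W21_0 \<Longrightarrow> \<xi> (x + y) = \<xi> x + \<xi> y"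
    and "x \<in> W21_0 \<Longrightarrow> \<xi> (cscale c x) = c * \<xi> x"
  using assms by (simp_all add: functional_def)

lemma functional_sum:
  assumes l: "functional \<xi>" and e: "\<And>i. i \<in> I \<Longrightarrow> e i \<in> W21_0"
  shows "\<xi> (\<Sum>i\<in>I. cscale (c i) (e i)) = (\<Sum>i\<in>I. c i * \<xi> (e i))"
proof -
  have l0: "\<xi> 0 = 0"
    using functionalD(2)[OF l cfun.subspace_0[OF W21_0_subspace], of 0] by simp
  show ?thesis
  proof (cases "finite I")
    case True
    then show ?thesis using e
    proof (induction I)
      case empty then show ?case unfolding sum.empty by (intro l0)
    next
      case (insert i I)
      have I: "(\<Sum>i\<in>I. cscale (c i) (e i)) \<in> W21_0" by (rule lincomb_W21_0) (use insert.prems in blast)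
      have ei: "e i \<in> W21_0" using insert.prems by blast
      have "\<xi> (\<Sum>i\<in>I. cscale (c i) (e i)) = (\<Sum>i\<in>I. c i * \<xi> (e i))"
        by (rule insert.IH) (use insert.prems in blast)
      then show ?case
        unfolding sum.insert[OF insert.hyps] functionalD(1)[OF l cfun.subspace_scale[OF W21_0_subspace ei] I, of "c i"]
          functionalD(2)[OF l ei, of "c i"] by simp
    qed
  next
    case False
    show ?thesis unfolding sum.infinite[OF False] by (rule l0)
  qed
qed

text \<open>A negative definite subspace of larger dimension would contain a nonzero vector on which
  all the functionals vanish.\<close>

lemma ind_le_card_functionals:
  assumes fin: "finite J" and l: "\<And>j. j \<in> J \<Longrightarrow> functional (\<xi> j)"
    and nonneg: "\<And>y. y \<in> W21_0 \<Longrightarrow> (\<And>j. j \<in> J \<Longrightarrow> \<xi> j y = 0) \<Longrightarrow> Re (T y y) \<ge> 0"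
  shows "ind T \<le> enat (card J)"
  unfolding ind_def
proof (rule Sup_least, safe)
  fix V B0 assume V: "cfun.subspace V" "V \<subseteq> W21_0" "finite B0" "V \<subseteq> cfun.span B0" "negative_definite_on V T"
  obtain B where B: "B \<subseteq> V" "\<not> cfun.dependent B" "V \<subseteq> cfun.span B" "card B = cfun.dim V"
    using cfun.basis_exists[of V] by blast
  have Bf: "finite B" using cfun.independent_span_bound[OF V(3) B(2)] B(1) V(4) by auto
  have "card B \<le> card J"
  proof (rule ccontr)
    assume "\<not> card B \<le> card J"
    then obtain c where c: "\<exists>b\<in>B. c b \<noteq> 0" "\<And>j. j \<in> J \<Longrightarrow> (\<Sum>b\<in>B. c b * \<xi> j b) = 0"
      using underdetermined_system[OF fin Bf, of \<xi>] by (auto simp: not_le)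
    define y where "y = (\<Sum>b\<in>B. cscale (c b) b)"
    have yV: "y \<in> V" unfolding y_def
      by (intro cfun.subspace_sum[OF V(1)] cfun.subspace_scale[OF V(1)]) (use B in auto)
    have "y \<noteq> 0" using B(2) c(1) cfun.dependent_finite[OF Bf] unfolding y_def by auto
    then have "Re (T y y) < 0" using V(5) yV by (auto simp: negative_definite_on_def)
    moreover have "\<xi> j y = 0" if "j \<in> J" for j
      unfolding y_def using functional_sum[OF l[OF that], of B "\<lambda>b. b" c] c(2)[OF that] B(1) V(2) by auto
    ultimately show False using nonneg[of y] yV V(2) by force
  qed
  then show "enat (cfun.dim V) \<le> enat (card J)" using B(4) by simp
qed

text \<open>A finite supremum of a nonempty set of extended naturals is attained, so the index is
  realised by an actual family; the zero subspace keeps the set nonempty.\<close>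

lemma ind_neg_family:
  assumes "ind T = enat n"
  shows "\<exists>e. neg_family T {..<n} e"
proof -
  define S where "S = {enat (cfun.dim V) | V. cfun.subspace V \<and> V \<subseteq> W21_0 \<and>
     (\<exists>B. finite B \<and> V \<subseteq> cfun.span B) \<and> negative_definite_on V T}"
  have "enat (cfun.dim {0}) \<in> S" unfolding S_def
    using cfun.subspace_0[OF W21_0_subspace]
    by (intro CollectI exI[of _ "{0}"]) (auto simp: negative_definite_on_def cfun.subspace_def intro!: exI[of _ "{}"])
  then have ne: "S \<noteq> {}" by blast
  have SS: "Sup S = enat n" using assms unfolding ind_def S_def .
  then have fS: "finite S" using ne by (auto simp: Sup_enat_def split: if_splits)
  then have "enat n \<in> S" using SS ne Max_in[OF fS ne] by (auto simp: Sup_enat_def split: if_splits)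
  then obtain V B0 where V: "n = cfun.dim V" "cfun.subspace V" "V \<subseteq> W21_0" "finite B0"
    "V \<subseteq> cfun.span B0" "negative_definite_on V T"
    unfolding S_def by auto
  obtain B where B: "B \<subseteq> V" "\<not> cfun.dependent B" "V \<subseteq> cfun.span B" "card B = cfun.dim V"
    using cfun.basis_exists[of V] by blast
  have Bf: "finite B" using cfun.independent_span_bound[OF V(4) B(2)] B(1) V(5) by auto
  obtain e where e: "bij_betw e {..<n} B"
    using ex_bij_betw_nat_finite[OF Bf] B(4) V(1) by (auto simp: atLeast0LessThan)
  have "neg_family T {..<n} e" unfolding neg_family_def
  proof (intro conjI allI impI ballI)
    show "e i \<in> W21_0" if "i \<in> {..<n}" for i using e that B(1) V(3) by (auto dest: bij_betwE)
    fix c :: "nat \<Rightarrow> complex" assume c: "\<exists>i\<in>{..<n}. c i \<noteq> 0"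
    define y where "y = (\<Sum>i<n. cscale (c i) (e i))"
    define u where "u b = c (inv_into {..<n} e b)" for b
    have u: "u (e i) = c i" if "i < n" for i
      using e that by (simp add: u_def bij_betw_def inv_into_f_f)
    have y: "y = (\<Sum>b\<in>B. cscale (u b) b)"
      unfolding y_def using sum.reindex_bij_betw[OF e, of "\<lambda>b. cscale (u b) b"] u by simp
    have "\<exists>b\<in>B. u b \<noteq> 0" using c u e by (metis bij_betwE lessThan_iff)
    then have "y \<noteq> 0" using B(2) cfun.dependent_finite[OF Bf] unfolding y by auto
    moreover have "y \<in> V" unfolding y
      by (intro cfun.subspace_sum[OF V(2)] cfun.subspace_scale[OF V(2)]) (use B in auto)
    ultimately show "Re (T (\<Sum>i<n. cscale (c i) (e i)) (\<Sum>i<n. cscale (c i) (e i))) < 0"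
      using V(6) unfolding negative_definite_on_def y_def by blast
  qed auto
  then show ?thesis by blast
qed

text \<open>Converse of \<open>ind_le_card_functionals\<close>: for a maximal negative family e the
  functionals \<open>T y (e j)\<close> suffice, because a vector orthogonal to all of them with
  negative value would enlarge the family.\<close>

lemma ind_functionals:
  assumes T: "hermitian T" and n: "ind T = enat n"
  shows "\<exists>\<xi>. (\<forall>j<n. functional (\<xi> j)) \<and>
    (\<forall>y\<in>W21_0. (\<forall>j<n. \<xi> j y = 0) \<longrightarrow> Re (T y y) \<ge> 0)"
proof -
  obtain e where e: "neg_family T {..<n} e" using ind_neg_family[OF n] by blast
  then have W: "\<And>i. i < n \<Longrightarrow> e i \<in> W21_0" by (auto simp: neg_family_def)
  define \<xi> where "\<xi> j y = T y (e j)" for j y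
  have "functional (\<xi> j)" if "j < n" for j
    using hermitianD(1,2)[OF T] W[OF that] unfolding functional_def \<xi>_def by simp
  moreover have "Re (T y y) \<ge> 0" if y: "y \<in> W21_0" and z: "\<forall>j<n. \<xi> j y = 0" for y
  proof (rule ccontr)
    assume "\<not> Re (T y y) \<ge> 0"
    then have neg: "Re (T y y) < 0" by simp
    define e' where "e' i = (if i < n then e i else y)" for i
    have "neg_family T {..<Suc n} e'"
      unfolding neg_family_def
    proof (intro conjI allI impI ballI)
      show "e' i \<in> W21_0" for i using W y by (simp add: e'_def)
      fix c :: "nat \<Rightarrow> complex" assume c: "\<exists>i\<in>{..<Suc n}. c i \<noteq> 0"
      define v where "v = (\<Sum>i<n. cscale (c i) (e i))"
      have vW: "v \<in> W21_0" unfolding v_def by (rule lincomb_W21_0) (use W in auto)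
      have cy: "cscale (c n) y \<in> W21_0" by (rule cfun.subspace_scale[OF W21_0_subspace y])
      have sum: "(\<Sum>i<Suc n. cscale (c i) (e' i)) = v + cscale (c n) y"
        unfolding v_def by (simp add: e'_def)
      have yv: "T y v = 0"
        unfolding v_def using hermitian_sum_right[OF T _ y, of "{..<n}" e c] W z by (simp add: \<xi>_def)
      then have vy: "T v y = 0" using hermitianD(3)[OF T y vW] by simp
      note add = hermitianD(1)[OF T] and scl = hermitianD(2)[OF T] and sym = hermitianD(3)[OF T]
      have w: "v + cscale (c n) y \<in> W21_0" by (rule cfun.subspace_add[OF W21_0_subspace vW cy])
      have 1: "T (v + cscale (c n) y) v = T v v" using add[OF vW cy vW] scl[OF y vW] yv by simp
      have 2: "T (v + cscale (c n) y) y = c n * T y y" using add[OF vW cy y] scl[OF y y] vy by simp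
      have 3: "T v (v + cscale (c n) y) = T v v"
        using sym[OF w vW] sym[OF vW vW] 1 by simp
      have 4: "T y (v + cscale (c n) y) = cnj (c n) * T y y"
        using sym[OF w y] sym[OF y y] 2 by simp
      \<comment> \<open>v and y are T-orthogonal, so the mixed terms are gone and a sum of two
        nonpositive terms remains; the case distinction below makes one of them negative.\<close>
      have "T (v + cscale (c n) y) (v + cscale (c n) y) = T v v + (c n * cnj (c n)) * T y y"
        using add[OF vW cy w] scl[OF y w] 3 4 by simp
      then have eq: "Re (T (v + cscale (c n) y) (v + cscale (c n) y)) = Re (T v v) + (cmod (c n))\<^sup>2 * Re (T y y)"
        by (simp flip: complex_norm_square)
      have T0: "T 0 0 = 0"
        by (rule hermitianD(4)[OF T cfun.subspace_0[OF W21_0_subspace]])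
      have vneg: "Re (T v v) < 0" if "\<exists>i<n. c i \<noteq> 0"
        using e that unfolding neg_family_def v_def by auto
      have vz: "Re (T v v) = 0" if "\<not> (\<exists>i<n. c i \<noteq> 0)"
      proof -
        have "v = 0" unfolding v_def using that by (intro sum.neutral) auto
        then show ?thesis using T0 by simp
      qed
      have "Re (T v v) + (cmod (c n))\<^sup>2 * Re (T y y) < 0"
      proof (cases "c n = 0")
        case True
        then have "\<exists>i<n. c i \<noteq> 0" using c by (metis lessThan_iff less_Suc_eq)
        from vneg[OF this] True show ?thesis by simp
      next
        case False
        then have "(cmod (c n))\<^sup>2 * Re (T y y) < 0" using neg by (intro mult_pos_neg) auto
        then show ?thesis using vneg vz by fastforce
      qed
      then show "Re (T (\<Sum>i<Suc n. cscale (c i) (e' i)) (\<Sum>i<Suc n. cscale (c i) (e' i))) < 0"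
        unfolding sum eq .
    qed auto
    from neg_family_ind[OF T this] n show False by simp
  qed
  ultimately show ?thesis by blast
qed

section \<open>Finiteness of the index\<close>

text \<open>Nonnegativity of the variance: the integral of \<open>(f x - m)^2\<close> with m the
  mean of f.\<close>

lemma integral_Cauchy_Schwarz:
  fixes f :: "real \<Rightarrow> real"
  assumes "a \<le> b" "f integrable_on {a..b}" "(\<lambda>x. (f x)\<^sup>2) integrable_on {a..b}"
  shows "(integral {a..b} f)\<^sup>2 \<le> (b - a) * integral {a..b} (\<lambda>x. (f x)\<^sup>2)"
proof (cases "a = b")
  case False
  define m where "m = integral {a..b} f / (b - a)"
  have "0 \<le> integral {a..b} (\<lambda>x. (f x - m)\<^sup>2)"
  proof (rule Henstock_Kurzweil_Integration.integral_nonneg)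
    have "(\<lambda>x. ((f x)\<^sup>2 + m\<^sup>2) - (2 * m) * f x) integrable_on {a..b}"
      by (intro integrable_add integrable_diff integrable_on_mult_right assms) auto
    then show "(\<lambda>x. (f x - m)\<^sup>2) integrable_on {a..b}" by (simp add: power2_diff mult_ac)
  qed auto
  also have "integral {a..b} (\<lambda>x. (f x - m)\<^sup>2) = integral {a..b} (\<lambda>x. ((f x)\<^sup>2 + m\<^sup>2) - (2 * m) * f x)"
    by (simp add: power2_diff algebra_simps)
  also have "\<dots> = integral {a..b} (\<lambda>x. (f x)\<^sup>2 + m\<^sup>2) - integral {a..b} (\<lambda>x. (2 * m) * f x)"
    by (rule Henstock_Kurzweil_Integration.integral_diff)
      (auto intro!: integrable_add integrable_on_mult_right assms)
  also have "integral {a..b} (\<lambda>x. (f x)\<^sup>2 + m\<^sup>2) = integral {a..b} (\<lambda>x. (f x)\<^sup>2) + m\<^sup>2 * (b - a)"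
    using assms by (subst Henstock_Kurzweil_Integration.integral_add) auto
  also have "integral {a..b} (\<lambda>x. (2 * m) * f x) = 2 * m * integral {a..b} f" by simp
  finally have "0 \<le> integral {a..b} (\<lambda>x. (f x)\<^sup>2) + m\<^sup>2 * (b - a) - 2 * m * integral {a..b} f" .
  moreover have "integral {a..b} f = m * (b - a)" using False by (simp add: m_def)
  ultimately have "m\<^sup>2 * (b - a) \<le> integral {a..b} (\<lambda>x. (f x)\<^sup>2)"
    by (simp add: power2_eq_square)
  then have "(b - a) * (m\<^sup>2 * (b - a)) \<le> (b - a) * integral {a..b} (\<lambda>x. (f x)\<^sup>2)"
    using assms(1) by (intro mult_left_mono) auto
  moreover have "(integral {a..b} f)\<^sup>2 = (b - a) * (m\<^sup>2 * (b - a))"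
    unfolding \<open>integral {a..b} f = m * (b - a)\<close> by (simp add: power2_eq_square)
  ultimately show ?thesis by simp
qed simp

lemma L2_iff:
  fixes f :: "real \<Rightarrow> 'a::euclidean_space"
  shows "f \<in> L2 \<longleftrightarrow> f absolutely_integrable_on {0..1} \<and> (\<lambda>x. (norm (f x))\<^sup>2) absolutely_integrable_on {0..1}"
proof
  assume "f \<in> L2"
  then show "f absolutely_integrable_on {0..1} \<and> (\<lambda>x. (norm (f x))\<^sup>2) absolutely_integrable_on {0..1}"
    using L2_absolutely_integrable L2_square by blast
next
  assume *: "f absolutely_integrable_on {0..1} \<and> (\<lambda>x. (norm (f x))\<^sup>2) absolutely_integrable_on {0..1}"
  then have "f \<in> borel_measurable unit_meas"
    using absolutely_integrable_measurable[of "{0..1}" f] by simp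
  then show "f \<in> L2" using * by (simp add: L2_def unit_meas_iff)
qed

lemma ac_difference_square_le:
  assumes F: "ac a b F f" and f2: "(\<lambda>x. (f x)\<^sup>2) absolutely_integrable_on {a..b}"
    and st: "a \<le> s" "s \<le> t" "t \<le> b"
  shows "(F t - F s)\<^sup>2 \<le> (t - s) * integral {s..t} (\<lambda>x. (f x)\<^sup>2)"
  unfolding acD(2)[OF F st]
  by (rule integral_Cauchy_Schwarz[OF st(2) acD(3)[OF F st] absolutely_integrable_Icc_subset(2)[OF f2 st(1,3)]])

lemma L2_ReIm:
  assumes "g \<in> L2" shows "(\<lambda>x. Re (g x)) \<in> L2" "(\<lambda>x. Im (g x)) \<in> L2"
proof -
  have m: "g \<in> borel_measurable unit_meas" by (rule L2_measurable[OF assms])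
  show "(\<lambda>x. Re (g x)) \<in> L2"
    by (rule L2I[OF _ L2_square[OF assms]]) (use m in \<open>auto simp: cmod_power2\<close>)
  show "(\<lambda>x. Im (g x)) \<in> L2"
    by (rule L2I[OF _ L2_square[OF assms]]) (use m in \<open>auto simp: cmod_power2\<close>)
qed

lemma sobD:
  assumes "sob y g"
  shows "g \<in> L2" "ac 0 1 (\<lambda>x. Re (y x)) (\<lambda>x. Re (g x))" "ac 0 1 (\<lambda>x. Im (y x)) (\<lambda>x. Im (g x))"
    "y 0 = 0" "y 1 = 0" "x \<notin> {0..1} \<Longrightarrow> y x = 0"
  using assms unfolding sob_def by blast+

text \<open>Finite energy means Holder continuity of exponent 1/2; this makes y small close to its
  zeros when the energy is fixed.\<close>

lemma sob_difference_square_le: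
  assumes y: "sob y g" and st: "0 \<le> s" "s \<le> t" "t \<le> 1"
  shows "(cmod (y t - y s))\<^sup>2 \<le> (t - s) * integral {0..1} (\<lambda>x. (cmod (g x))\<^sup>2)"
proof -
  note g = sobD(1)[OF y]
  note r2 = L2_square[OF L2_ReIm(1)[OF g], simplified] and i2 = L2_square[OF L2_ReIm(2)[OF g], simplified]
  note r = absolutely_integrable_Icc_subset(2)[OF r2 st(1,3)] and i = absolutely_integrable_Icc_subset(2)[OF i2 st(1,3)]
  have "(cmod (y t - y s))\<^sup>2 = (Re (y t) - Re (y s))\<^sup>2 + (Im (y t) - Im (y s))\<^sup>2"
    by (simp add: cmod_power2)
  also have "\<dots> \<le> (t - s) * integral {s..t} (\<lambda>x. (Re (g x))\<^sup>2) + (t - s) * integral {s..t} (\<lambda>x. (Im (g x))\<^sup>2)"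
    by (rule add_mono[OF ac_difference_square_le[OF sobD(2)[OF y] r2 st] ac_difference_square_le[OF sobD(3)[OF y] i2 st]])
  also have "\<dots> = (t - s) * integral {s..t} (\<lambda>x. (cmod (g x))\<^sup>2)"
    using Henstock_Kurzweil_Integration.integral_add[OF r i] by (simp add: cmod_power2 flip: distrib_left)
  also have "\<dots> \<le> (t - s) * integral {0..1} (\<lambda>x. (cmod (g x))\<^sup>2)"
    using st absolutely_integrable_Icc_subset(2)[OF L2_square[OF g]]
    by (intro mult_left_mono integral_subset_le) auto
  finally show ?thesis .
qed

section \<open>Energy and cross term of the quadratic form\<close>

definition energy :: "(real \<Rightarrow> complex) \<Rightarrow> real" where
  "energy g = integral {0..1} (\<lambda>x. (cmod (g x))\<^sup>2)"

text \<open>The coefficient of \<lambda> in the quadratic form, which is therefore affine in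
  \<lambda>. The integrand is P times the derivative of \<open>\<bar>y\<bar>^2\<close>, so this is
  the pairing of -\<rho> with that square.\<close>

definition cross :: "(real \<Rightarrow> real) \<Rightarrow> (real \<Rightarrow> complex) \<Rightarrow> (real \<Rightarrow> complex) \<Rightarrow> real" where
  "cross P y g = integral {0..1} (\<lambda>x. 2 * P x * Re (g x * cnj (y x)))"

lemma cross_integrable:
  assumes P: "P \<in> L2" and y: "sob y g"
  shows "(\<lambda>x. 2 * P x * Re (g x * cnj (y x))) absolutely_integrable_on {0..1}"
proof -
  have "(\<lambda>x. Re (of_real (P x) * (g x * cnj (y x) + y x * cnj (g x)))) absolutely_integrable_on {0..1}"
    by (rule absolutely_integrable_ReIm(1)[OF pencil_integrable(2)[OF P y y]])
  moreover have "Re (of_real (P x) * (g x * cnj (y x) + y x * cnj (g x))) = 2 * P x * Re (g x * cnj (y x))" for x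
    by (simp add: algebra_simps)
  ultimately show ?thesis by (simp only:)
qed

lemma Re_T_pencil:
  assumes P: "P \<in> L2" and y: "sob y g"
  shows "Re (T_pencil P l y y) = energy g + l * cross P y g"
proof -
  note e = L2_square[OF sobD(1)[OF y], THEN set_lebesgue_integral_eq_integral(1)]
  note c = cross_integrable[OF P y, THEN set_lebesgue_integral_eq_integral(1)]
  have "Re (T_pencil P l y y) = integral {0..1} (\<lambda>x. Re (g x * cnj (g x)
    + of_real l * of_real (P x) * (g x * cnj (y x) + y x * cnj (g x))))"
    unfolding T_pencil_sob[OF P y y]
    by (rule integral_ReIm(1)[OF set_lebesgue_integral_eq_integral(1)[OF pencil_integrable(3)[OF P y y]]])
  also have "\<dots> = integral {0..1} (\<lambda>x. (cmod (g x))\<^sup>2 + l * (2 * P x * Re (g x * cnj (y x))))"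
    by (rule Henstock_Kurzweil_Integration.integral_cong) (simp only: cmod_power2, simp add: power2_eq_square algebra_simps)
  also have "\<dots> = energy g + l * cross P y g"
    unfolding energy_def cross_def
    using Henstock_Kurzweil_Integration.integral_add[OF e integrable_on_mult_right[OF c, of l]] by simp
  finally show ?thesis .
qed

lemma energy_nonneg: "sob y g \<Longrightarrow> energy g \<ge> 0"
  unfolding energy_def
  by (rule Henstock_Kurzweil_Integration.integral_nonneg)
    (auto intro: set_lebesgue_integral_eq_integral(1) L2_square dest: sobD(1))

lemma functional_eval: "functional (\<lambda>y. y x)"
  by (simp add: functional_def cscale_def)

text \<open>If y vanishes at the m - 1 inner points of a mesh of width 1/m, then
  \<open>(cmod (y x))^2 \<le> E / m\<close> with E its energy, and the cross term is at most
  \<open>E / 2\<close> plus \<open>2 * l^2 * (E / m)\<close> times the integral of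
  \<open>(P x)^2\<close>. The factor 4 in the hypothesis makes the second part at most
  \<open>E / 2\<close> as well.\<close>

lemma ind_le_of_mesh:
  assumes P: "P \<in> L2" and m: "m > 0" "4 * l\<^sup>2 * integral {0..1} (\<lambda>x. (P x)\<^sup>2) \<le> real m"
  shows "ind (T_pencil P l) \<le> enat (m - 1)"
proof -
  have "ind (T_pencil P l) \<le> enat (card {1..<m})"
  proof (rule ind_le_card_functionals[where \<xi> = "\<lambda>j y. y (real j / real m)"])
    fix y assume "y \<in> W21_0" and z: "\<And>j. j \<in> {1..<m} \<Longrightarrow> y (real j / real m) = 0"
    then obtain g where y: "sob y g" unfolding W21_0_iff by blast
    define E where "E = energy g"
    have E0: "E \<ge> 0" unfolding E_def by (rule energy_nonneg[OF y])
    have bound: "(cmod (y x))\<^sup>2 \<le> E / m" if x: "x \<in> {0..1}" for x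
    proof -
      \<comment> \<open>Index of the mesh point next to x on the left; for j = 0 and j = m the
        boundary conditions supply the zero.\<close>
      define j where "j = nat \<lfloor>x * m\<rfloor>"
      have j: "real j \<le> x * m" "x * m < real j + 1"
        using x unfolding j_def by (simp_all add: of_nat_nat)
      have xm: "x * m \<le> m" using x m by simp
      have s: "0 \<le> real j / m" "real j / m \<le> x" "x - real j / m \<le> 1 / m"
      proof -
        have m0: "real m > 0" using m by simp
        show "0 \<le> real j / m" by simp
        show "real j / m \<le> x" using j(1) m0 by (simp add: divide_le_eq)
        have "x \<le> (real j + 1) / m" using j(2) m0 by (simp add: le_divide_eq)
        then show "x - real j / m \<le> 1 / m" by (simp add: add_divide_distrib)
      qed
      have "y (real j / m) = 0"
      proof (cases "j = 0 \<or> j \<ge> m")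
        case True
        then have "j = 0 \<or> j = m" using j(1) xm by linarith
        then show ?thesis using sobD(4,5)[OF y] m by auto
      next
        case False then show ?thesis using z[of j] by simp
      qed
      then have "(cmod (y x))\<^sup>2 \<le> (x - real j / m) * E"
        using sob_difference_square_le[OF y s(1,2)] x by (simp add: E_def energy_def)
      also have "\<dots> \<le> 1 / m * E" by (rule mult_right_mono[OF s(3) E0])
      finally show ?thesis by simp
    qed
    note c = cross_integrable[OF P y, THEN set_lebesgue_integral_eq_integral(1)]
    note e = L2_square[OF sobD(1)[OF y], THEN set_lebesgue_integral_eq_integral(1)]
    note p = L2_square[OF P, THEN set_lebesgue_integral_eq_integral(1), simplified]
    have "norm (integral {0..1} (\<lambda>x. l * (2 * P x * Re (g x * cnj (y x)))))
       \<le> integral {0..1} (\<lambda>x. (1/2) * (cmod (g x))\<^sup>2 + (2 * l\<^sup>2 * (E / m)) * (P x)\<^sup>2)"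
    proof (rule integral_norm_bound_integral)
      show "(\<lambda>x. l * (2 * P x * Re (g x * cnj (y x)))) integrable_on {0..1}"
        by (rule integrable_on_mult_right[OF c])
      show "(\<lambda>x. (1/2) * (cmod (g x))\<^sup>2 + (2 * l\<^sup>2 * (E / m)) * (P x)\<^sup>2) integrable_on {0..1}"
        by (intro integrable_add integrable_on_mult_right e p)
      fix x :: real assume x: "x \<in> {0..1}"
      have "norm (l * (2 * P x * Re (g x * cnj (y x)))) = 2 * \<bar>l * P x\<bar> * \<bar>Re (g x * cnj (y x))\<bar>"
        by (simp add: abs_mult)
      also have "\<dots> \<le> 2 * \<bar>l * P x\<bar> * (cmod (g x) * cmod (y x))"
        using abs_Re_le_cmod[of "g x * cnj (y x)"] by (intro mult_left_mono) (auto simp: norm_mult)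
      also have "\<dots> = 2 * (cmod (g x)) * (\<bar>l * P x\<bar> * cmod (y x))" by simp
      \<comment> \<open>\<open>2 * p * q \<le> p^2 / 2 + 2 * q^2\<close>, weighted so as to spend
        only half of the energy.\<close>
      also have "\<dots> \<le> (1/2) * (cmod (g x))\<^sup>2 + 2 * (\<bar>l * P x\<bar> * cmod (y x))\<^sup>2"
        using sum_squares_bound[of "cmod (g x)" "2 * (\<bar>l * P x\<bar> * cmod (y x))"]
        by (simp add: power_mult_distrib)
      also have "(\<bar>l * P x\<bar> * cmod (y x))\<^sup>2 = l\<^sup>2 * (P x)\<^sup>2 * (cmod (y x))\<^sup>2"
        by (simp add: power_mult_distrib)
      also have "\<dots> \<le> l\<^sup>2 * (P x)\<^sup>2 * (E / m)" by (intro mult_left_mono bound x) auto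
      finally show "norm (l * (2 * P x * Re (g x * cnj (y x)))) \<le>
        (1/2) * (cmod (g x))\<^sup>2 + (2 * l\<^sup>2 * (E / m)) * (P x)\<^sup>2"
        by (simp add: algebra_simps)
    qed
    also have "\<dots> = (1/2) * E + (2 * l\<^sup>2 * (E / m)) * integral {0..1} (\<lambda>x. (P x)\<^sup>2)"
      using Henstock_Kurzweil_Integration.integral_add[OF integrable_on_mult_right[OF e, of "1/2"]
          integrable_on_mult_right[OF p, of "2 * l\<^sup>2 * (E / m)"]]
      by (simp add: E_def energy_def)
    also have "(2 * l\<^sup>2 * (E / m)) * integral {0..1} (\<lambda>x. (P x)\<^sup>2)
      = (E / (2 * m)) * (4 * l\<^sup>2 * integral {0..1} (\<lambda>x. (P x)\<^sup>2))" by simp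
    also have "\<dots> \<le> (E / (2 * m)) * m" by (rule mult_left_mono[OF m(2)]) (use E0 in auto)
    also have "\<dots> = E / 2" using m by simp
    finally have "\<bar>l * cross P y g\<bar> \<le> E" by (simp add: cross_def)
    then show "Re (T_pencil P l y y) \<ge> 0" unfolding Re_T_pencil[OF P y] E_def by linarith
  qed (auto intro: functional_eval)
  then show ?thesis by simp
qed

lemma ind_finite:
  assumes P: "P \<in> L2" shows "\<exists>n. ind (T_pencil P l) = enat n"
proof -
  obtain m :: nat where "max 1 (4 * l\<^sup>2 * integral {0..1} (\<lambda>x. (P x)\<^sup>2)) \<le> real m"
    using real_arch_simple by blast
  then have "ind (T_pencil P l) \<le> enat (m - 1)" by (intro ind_le_of_mesh[OF P]) auto
  then show ?thesis by (cases "ind (T_pencil P l)") auto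
qed

text \<open>Near \<lambda> = 0 one mesh cell is enough, which imposes no condition at all; the
  choice of r makes \<open>4 * r^2 * c = c / (1 + c)^2 \<le> 1\<close>.\<close>

lemma ind_small:
  assumes P: "P \<in> L2" shows "\<exists>r>0. \<forall>l. \<bar>l\<bar> \<le> r \<longrightarrow> ind (T_pencil P l) = 0"
proof -
  define c where "c = integral {0..1} (\<lambda>x. (P x)\<^sup>2)"
  have c: "c \<ge> 0" unfolding c_def
    using set_lebesgue_integral_eq_integral(1)[OF L2_square[OF P]]
    by (intro Henstock_Kurzweil_Integration.integral_nonneg) auto
  define r where "r = 1 / (2 * (1 + c))"
  have "ind (T_pencil P l) = 0" if l: "\<bar>l\<bar> \<le> r" for l
  proof -
    have "l\<^sup>2 \<le> r\<^sup>2" using l by (simp add: abs_le_square_iff[symmetric] r_def c)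
    then have "4 * l\<^sup>2 * c \<le> 4 * r\<^sup>2 * c" using c by (simp add: mult_right_mono)
    also have "\<dots> = c / (1 + c)\<^sup>2" unfolding r_def power_divide power_mult_distrib by simp
    also have "\<dots> \<le> 1"
    proof -
      have "c \<le> (1 + c)\<^sup>2" using c by (simp add: power2_sum)
      then show ?thesis using c by (simp add: divide_le_eq_1)
    qed
    finally have "ind (T_pencil P l) \<le> 0"
      using ind_le_of_mesh[OF P, of 1 l] by (simp add: c_def zero_enat_def)
    then show ?thesis by simp
  qed
  moreover have "r > 0" using c by (simp add: r_def)
  ultimately show ?thesis by blast
qed

section \<open>Rescaling to a subinterval\<close>

lemma has_integral_scale:
  fixes f :: "real \<Rightarrow> 'a::euclidean_space"
  assumes "(f has_integral I) {p + a * s..p + a * t}" "a > 0"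
  shows "((\<lambda>x. f (p + a * x)) has_integral I /\<^sub>R a) {s..t}"
proof -
  have "((p + a * s) - p) /\<^sub>R a = s" "((p + a * t) - p) /\<^sub>R a = t"
    and e: "inverse a * (a * s) = s" "inverse a * (a * t) = t"
    using assms(2) by simp_all
  then show ?thesis
    using has_integral_affinity'[of f I "p + a * s" "p + a * t" a p] assms by (simp add: add.commute e)
qed

lemma integral_scale:
  fixes f :: "real \<Rightarrow> 'a::euclidean_space"
  assumes "f integrable_on {p + a * s..p + a * t}" "a > 0"
  shows "(\<lambda>x. f (p + a * x)) integrable_on {s..t}"
    "integral {s..t} (\<lambda>x. f (p + a * x)) = integral {p + a * s..p + a * t} f /\<^sub>R a"
  using has_integral_scale[OF integrable_integral[OF assms(1)] assms(2)]
  by (auto simp: integrable_on_def integral_unique)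

lemma absolutely_integrable_scale:
  fixes f :: "real \<Rightarrow> 'a::euclidean_space"
  assumes "f absolutely_integrable_on {p + a * s..p + a * t}" "a > 0"
  shows "(\<lambda>x. f (p + a * x)) absolutely_integrable_on {s..t}"
  using assms integral_scale(1)[of f] integral_scale(1)[of "\<lambda>x. norm (f x)"]
  unfolding absolutely_integrable_on_def by blast

lemma ac_scale:
  assumes F: "ac (p + a * s) (p + a * t) F f" and a: "a > 0"
  shows "ac s t (\<lambda>x. F (p + a * x)) (\<lambda>x. a * f (p + a * x))"
  unfolding ac_def
proof (intro conjI allI impI)
  show "(\<lambda>x. a * f (p + a * x)) absolutely_integrable_on {s..t}"
    by (intro set_integrable_mult_right impI absolutely_integrable_scale[OF acD(1)[OF F] a])
  fix u v assume uv: "s \<le> u" "u \<le> v" "v \<le> t"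
  have "p + a * s \<le> p + a * u" "p + a * u \<le> p + a * v" "p + a * v \<le> p + a * t"
    using uv a by auto
  from acD(2)[OF F this] integral_scale(2)[OF acD(3)[OF F this] a]
  show "F (p + a * v) - F (p + a * u) = integral {u..v} (\<lambda>x. a * f (p + a * x))"
    using a by simp
qed

lemma L2_scale:
  fixes f :: "real \<Rightarrow> 'a::euclidean_space"
  assumes f: "f \<in> L2" and a: "a > 0" "0 \<le> p" "p + a \<le> 1"
  shows "(\<lambda>x. f (p + a * x)) \<in> L2"
proof -
  have sub: "g absolutely_integrable_on {p + a * 0..p + a * 1}" if "g absolutely_integrable_on {0..1}"
    for g :: "real \<Rightarrow> 'b::euclidean_space"
    by (rule absolutely_integrable_Icc_subset(1)[OF that]) (use a in auto)
  from f show ?thesis unfolding L2_iff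
    using absolutely_integrable_scale[where f=f, OF sub a(1)]
      absolutely_integrable_scale[where f="\<lambda>x. (norm (f x))\<^sup>2", OF sub a(1)] by blast
qed

text \<open>Restriction to \<open>[p, p+a]\<close>, rescaled to the unit interval; subtracting the linear interpolant of the
  boundary values makes the map linear on the whole space.\<close>

definition rescale :: "real \<Rightarrow> real \<Rightarrow> (real \<Rightarrow> complex) \<Rightarrow> real \<Rightarrow> complex" where
  "rescale p a y = (\<lambda>t. if t \<in> {0..1} then y (p + a * t) - (1 - t) *\<^sub>R y p - t *\<^sub>R y (p + a) else 0)"

lemma sob_rescale:
  assumes y: "sob y g" and a: "a > 0" "0 \<le> p" "p + a \<le> 1"
  shows "sob (rescale p a y) (\<lambda>t. a *\<^sub>R g (p + a * t) + (y p - y (p + a)))"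
proof -
  have L2: "(\<lambda>t. a *\<^sub>R g (p + a * t) + (y p - y (p + a))) \<in> L2"
    unfolding scaleR_conv_of_real
    by (intro L2_add L2_complex_mult_cont continuous_intros L2_scale[OF sobD(1)[OF y] a] const_L2)
  have lin: "ac 0 1 (\<lambda>t. r + c * t) (\<lambda>t. c)" for r c
    by (rule ac_C1) (auto intro!: derivative_eq_intros continuous_intros)
  have re: "ac (p + a * 0) (p + a * 1) (\<lambda>x. Re (y x)) (\<lambda>x. Re (g x))"
    by (rule ac_subinterval[OF sobD(2)[OF y]]) (use a in auto)
  have im: "ac (p + a * 0) (p + a * 1) (\<lambda>x. Im (y x)) (\<lambda>x. Im (g x))"
    by (rule ac_subinterval[OF sobD(3)[OF y]]) (use a in auto)
  have "ac 0 1 (\<lambda>t. Re (rescale p a y t)) (\<lambda>t. Re (a *\<^sub>R g (p + a * t) + (y p - y (p + a))))"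
    by (rule ac_cong[OF ac_add[OF ac_scale[OF re a(1)] lin[of "- Re (y p)" "Re (y p - y (p + a))"]]])
      (auto simp: rescale_def algebra_simps)
  moreover have "ac 0 1 (\<lambda>t. Im (rescale p a y t)) (\<lambda>t. Im (a *\<^sub>R g (p + a * t) + (y p - y (p + a))))"
    by (rule ac_cong[OF ac_add[OF ac_scale[OF im a(1)] lin[of "- Im (y p)" "Im (y p - y (p + a))"]]])
      (auto simp: rescale_def algebra_simps)
  ultimately show ?thesis using L2 unfolding sob_def by (simp add: rescale_def)
qed

lemma rescale_add: "rescale p a (x + y) = rescale p a x + rescale p a y"
  by (auto simp: rescale_def fun_eq_iff algebra_simps)

lemma rescale_cscale: "rescale p a (cscale c x) = cscale c (rescale p a x)"
  by (auto simp: rescale_def cscale_def fun_eq_iff algebra_simps)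

lemma rescale_zero: "rescale p a 0 = 0"
  by (auto simp: rescale_def fun_eq_iff)

lemma rescale_sum: "rescale p a (\<Sum>i\<in>I. cscale (c i) (e i)) = (\<Sum>i\<in>I. cscale (c i) (rescale p a (e i)))"
proof (cases "finite I")
  case True
  then show ?thesis
  proof (induction I)
    case empty then show ?case unfolding sum.empty by (intro rescale_zero)
  next
    case (insert i I)
    show ?case unfolding sum.insert[OF insert.hyps] rescale_add rescale_cscale insert.IH by (rule refl)
  qed
next
  case False
  show ?thesis unfolding sum.infinite[OF False] by (rule rescale_zero)
qed

text \<open>A right inverse of \<open>rescale\<close> on \<open>W21_0\<close>; extension by zero is
  automatic, as the elements of that space vanish outside [0,1].\<close>

definition spread :: "real \<Rightarrow> real \<Rightarrow> (real \<Rightarrow> complex) \<Rightarrow> real \<Rightarrow> complex" where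
  "spread p a u = (\<lambda>x. u ((x - p) / a))"

lemma absolutely_integrable_extend_zero:
  fixes f :: "real \<Rightarrow> 'a::euclidean_space"
  assumes "f absolutely_integrable_on {p..q}"
  shows "(\<lambda>x. if x \<in> {p..q} then f x else 0) absolutely_integrable_on {a..b}"
proof -
  have "(\<lambda>x. if x \<in> {p..q} then f x else 0) absolutely_integrable_on UNIV"
    using assms by (simp only: absolutely_integrable_restrict_UNIV)
  then show ?thesis by (rule set_integrable_subset) auto
qed

lemma ac_extend_zero:
  assumes F: "ac p q F f" and pq: "a \<le> p" "p \<le> q" "q \<le> b" and z: "F p = 0" "F q = 0"
  shows "ac a b (\<lambda>x. if x \<in> {p..q} then F x else 0) (\<lambda>x. if x \<in> {p..q} then f x else 0)"
proof (rule acI[where c=0])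
  show "(\<lambda>x. if x \<in> {p..q} then f x else 0) absolutely_integrable_on {a..b}"
    by (rule absolutely_integrable_extend_zero[OF acD(1)[OF F]])
  fix x assume x: "a \<le> x" "x \<le> b"
  have eq: "integral {a..x} (\<lambda>x. if x \<in> {p..q} then f x else 0) = integral ({p..q} \<inter> {a..x}) f"
    by (rule Henstock_Kurzweil_Integration.integral_restrict_Int)
  consider "x < p" | "p \<le> x" "x \<le> q" | "q < x" by linarith
  then show "(if x \<in> {p..q} then F x else 0) = 0 + integral {a..x} (\<lambda>x. if x \<in> {p..q} then f x else 0)"
  proof cases
    case 1
    then have "{p..q} \<inter> {a..x} = {}" by auto
    then show ?thesis using 1 unfolding eq by simp
  next
    case 2
    then have "{p..q} \<inter> {a..x} = {p..x}" using pq by auto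
    then show ?thesis using 2 acD(2)[OF F, of p x] z unfolding eq by simp
  next
    case 3
    then have "{p..q} \<inter> {a..x} = {p..q}" using pq by auto
    then show ?thesis using 3 acD(2)[OF F, of p q] z pq unfolding eq by simp
  qed
qed

lemma sob_spread:
  assumes u: "sob u h" and a: "a > 0" "0 \<le> p" "p + a \<le> 1"
  shows "sob (spread p a u) (\<lambda>x. if x \<in> {p..p + a} then (1 / a) *\<^sub>R h ((x - p) / a) else 0)"
proof -
  have sc: "- p / a + (1 / a) * x = (x - p) / a" for x using a by (simp add: field_simps)
  have ends: "- p / a + (1 / a) * p = 0" "- p / a + (1 / a) * (p + a) = 1" using a by (auto simp: field_simps)
  have in01: "(x - p) / a \<in> {0..1} \<longleftrightarrow> x \<in> {p..p + a}" for x
    using a by (auto simp: field_simps)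
  have sp: "spread p a u = (\<lambda>x. if x \<in> {p..p + a} then u ((x - p) / a) else 0)"
    unfolding spread_def using sobD(6)[OF u] in01 by (auto simp: fun_eq_iff)
  have L2: "(\<lambda>x. if x \<in> {p..p + a} then (1 / a) *\<^sub>R h ((x - p) / a) else 0) \<in> L2"
  proof -
    note h = sobD(1)[OF u, unfolded L2_iff]
    have 1: "(\<lambda>x. h ((x - p) / a)) absolutely_integrable_on {p..p + a}"
      using absolutely_integrable_scale[where f=h and p="- p / a" and a="1 / a" and s=p and t="p + a"] h a unfolding ends sc by simp
    have 2: "(\<lambda>x. (norm (h ((x - p) / a)))\<^sup>2) absolutely_integrable_on {p..p + a}"
      using absolutely_integrable_scale[where f="\<lambda>x. (norm (h x))\<^sup>2" and p="- p / a" and a="1 / a" and s=p and t="p + a"] h a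
      unfolding ends sc by simp
    have 3: "(\<lambda>x. (1 / a) *\<^sub>R h ((x - p) / a)) absolutely_integrable_on {p..p + a}"
      using set_integrable_scaleR_right[of "1 / a" lebesgue "{p..p + a}", OF 1] by simp
    have 4: "(\<lambda>x. (1 / a)\<^sup>2 * (norm (h ((x - p) / a)))\<^sup>2) absolutely_integrable_on {p..p + a}"
      by (rule set_integrable_mult_right[OF 2])
    have "(\<lambda>x. if x \<in> {p..p + a} then (1 / a)\<^sup>2 * (norm (h ((x - p) / a)))\<^sup>2 else 0) =
      (\<lambda>x. (norm (if x \<in> {p..p + a} then (1 / a) *\<^sub>R h ((x - p) / a) else 0))\<^sup>2)"
      by (auto simp: fun_eq_iff power_mult_distrib power_divide)
    then show ?thesis unfolding L2_iff
      using absolutely_integrable_extend_zero[OF 3, of 0 1] absolutely_integrable_extend_zero[OF 4, of 0 1] by simp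
  qed
  have re: "ac p (p + a) (\<lambda>x. Re (u ((x - p) / a))) (\<lambda>x. (1 / a) * Re (h ((x - p) / a)))"
    using ac_scale[where p="- p / a" and a="1 / a" and s=p and t="p + a" and F="\<lambda>x. Re (u x)" and f="\<lambda>x. Re (h x)"] sobD(2)[OF u] a
    unfolding ends sc by simp
  have im: "ac p (p + a) (\<lambda>x. Im (u ((x - p) / a))) (\<lambda>x. (1 / a) * Im (h ((x - p) / a)))"
    using ac_scale[where p="- p / a" and a="1 / a" and s=p and t="p + a" and F="\<lambda>x. Im (u x)" and f="\<lambda>x. Im (h x)"] sobD(3)[OF u] a
    unfolding ends sc by simp
  have z: "u ((p - p) / a) = 0" "u ((p + a - p) / a) = 0" using sobD(4,5)[OF u] a by auto
  have "ac 0 1 (\<lambda>x. Re (spread p a u x)) (\<lambda>x. Re (if x \<in> {p..p + a} then (1 / a) *\<^sub>R h ((x - p) / a) else 0))"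
    by (rule ac_cong[OF ac_extend_zero[OF re a(2) _ a(3)]]) (use a z in \<open>auto simp: sp\<close>)
  moreover have "ac 0 1 (\<lambda>x. Im (spread p a u x)) (\<lambda>x. Im (if x \<in> {p..p + a} then (1 / a) *\<^sub>R h ((x - p) / a) else 0))"
    by (rule ac_cong[OF ac_extend_zero[OF im a(2) _ a(3)]]) (use a z in \<open>auto simp: sp\<close>)
  moreover have "spread p a u 0 = 0"
    using a z(1) unfolding sp by (cases "p = 0") auto
  moreover have "spread p a u 1 = 0"
    using a z(2) unfolding sp by (cases "p + a = 1") auto
  moreover have "spread p a u x = 0" if "x \<notin> {0..1}" for x using that a unfolding sp by auto
  ultimately show ?thesis using L2 unfolding sob_def by blast
qed

section \<open>Self-similar bracketing of the index\<close>

text \<open>The integrand is the derivative of \<open>\<bar>u\<bar>^2\<close>, which vanishes at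
  both ends. This is why an additive constant in P drops out of the form.\<close>

lemma sob_boundary:
  assumes u: "sob u h"
  shows "((\<lambda>t. 2 * Re (h t * cnj (u t))) has_integral 0) {0..1}"
proof -
  note re = sobD(2)[OF u] and im = sobD(3)[OF u]
  have ac: "ac 0 1 (\<lambda>x. Re (u x) * Re (u x) + Im (u x) * Im (u x))
    (\<lambda>x. (Re (h x) * Re (u x) + Re (u x) * Re (h x)) + (Im (h x) * Im (u x) + Im (u x) * Im (h x)))"
    by (intro ac_add ac_mult re im)
  have "ac 0 1 (\<lambda>x. Re (u x) * Re (u x) + Im (u x) * Im (u x)) (\<lambda>t. 2 * Re (h t * cnj (u t)))"
    by (rule ac_cong[OF ac]) (simp_all add: algebra_simps)
  from integrable_integral[OF acD(3)[OF this, of 0 1]] acD(2)[OF this, of 0 1] sobD(4,5)[OF u]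
  show ?thesis by simp
qed

text \<open>Under x = p + a t the derivative becomes \<open>h t / a\<close> and dx becomes a dt, so
  the energy scales by 1 / a and the cross term by d alone; pulling out 1 / a leaves the parameter
  \<open>l * (a * d)\<close>.\<close>

lemma pencil_piece:
  assumes P: "P \<in> L2" and y: "sob y g" and a: "a > 0" "0 \<le> p" "p + a \<le> 1"
    and z: "y p = 0" "y (p + a) = 0"
    and ss: "AE x in lebesgue. x \<in> {p<..<p + a} \<longrightarrow> P x = \<beta> + d * P ((x - p) / a)"
  shows "integral {p..p + a} (\<lambda>x. (cmod (g x))\<^sup>2 + l * (2 * P x * Re (g x * cnj (y x))))
    = (1 / a) * Re (T_pencil P (l * (a * d)) (rescale p a y) (rescale p a y))"
proof -
  define u where "u = rescale p a y"
  define h where "h t = a *\<^sub>R g (p + a * t)" for t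
  have u: "sob u h" unfolding u_def using sob_rescale[OF y a] by (simp add: z h_def[abs_def])
  have ut: "u t = y (p + a * t)" if "t \<in> {0..1}" for t using that by (simp add: u_def rescale_def z)
  define F where "F x = (cmod (g x))\<^sup>2 + l * (2 * P x * Re (g x * cnj (y x)))" for x
  \<comment> \<open>P is replaced by its self-similar expression, which changes F only on a null set
    and at the two end points.\<close>
  define G where "G x = (cmod (g x))\<^sup>2 + l * (2 * (\<beta> + d * P ((x - p) / a)) * Re (g x * cnj (y x)))" for x
  have Fi: "F integrable_on {p..p + a}"
  proof -
    have "F absolutely_integrable_on {0..1}" unfolding F_def
      by (intro set_integral_add(1) set_integrable_mult_right impI L2_square[OF sobD(1)[OF y]] cross_integrable[OF P y])
    then show ?thesis by (rule absolutely_integrable_Icc_subset(2)) (use a in auto)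
  qed
  obtain M where M: "\<And>x. x \<in> space lebesgue - M \<Longrightarrow>
      x \<in> {p<..<p + a} \<longrightarrow> P x = \<beta> + d * P ((x - p) / a)" "M \<in> null_sets lebesgue"
    by (rule AE_E3[OF ss]) (rule that)
  have neg: "negligible (M \<union> {p, p + a})"
    using M(2) by (simp add: negligible_iff_null_sets[symmetric] negligible_insert)
  have FG: "G x = F x" if "x \<in> {p..p + a} - (M \<union> {p, p + a})" for x
    using M(1)[of x] that unfolding F_def G_def by auto
  have Gi: "G integrable_on {p..p + a}"
    by (rule integrable_spike[OF Fi neg]) (rule FG)
  have FGint: "integral {p..p + a} F = integral {p..p + a} G"
    by (rule integral_spike[OF neg]) (rule FG)
  note b0 = sob_boundary[OF u]
  have e: "((\<lambda>t. (cmod (h t))\<^sup>2) has_integral energy h) {0..1}"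
    unfolding energy_def by (intro integrable_integral set_lebesgue_integral_eq_integral(1) L2_square sobD(1)[OF u])
  have c: "((\<lambda>t. 2 * P t * Re (h t * cnj (u t))) has_integral cross P u h) {0..1}"
    unfolding cross_def by (intro integrable_integral set_lebesgue_integral_eq_integral(1) cross_integrable[OF P u])
  \<comment> \<open>The rescaled form carries \<open>1 / a^2\<close> here and not
    \<open>1 / a\<close>, because G is merely composed with \<open>p + a * t\<close>, without the
    Jacobian a; the last summand is the contribution of \<beta>, with integral 0.\<close>
  have "((\<lambda>t. (1 / a\<^sup>2) * ((cmod (h t))\<^sup>2 + (l * (a * d)) * (2 * P t * Re (h t * cnj (u t))))
      + (l * \<beta> / a) * (2 * Re (h t * cnj (u t)))) has_integral
      (1 / a\<^sup>2) * (energy h + (l * (a * d)) * cross P u h) + (l * \<beta> / a) * 0) {0..1}"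
    by (intro has_integral_add has_integral_mult_right e c b0)
  moreover have "(1 / a\<^sup>2) * ((cmod (h t))\<^sup>2 + (l * (a * d)) * (2 * P t * Re (h t * cnj (u t))))
      + (l * \<beta> / a) * (2 * Re (h t * cnj (u t))) = G (p + a * t)" if t: "t \<in> {0..1}" for t
  proof -
    have 1: "(cmod (h t))\<^sup>2 = a\<^sup>2 * (cmod (g (p + a * t)))\<^sup>2" by (simp add: h_def power_mult_distrib)
    have 2: "Re (h t * cnj (u t)) = a * Re (g (p + a * t) * cnj (y (p + a * t)))"
      unfolding ut[OF t] h_def by (simp add: algebra_simps)
    have 3: "(p + a * t - p) / a = t" using a by simp
    show ?thesis unfolding G_def 1 2 3 using a by (simp add: field_simps power2_eq_square)
  qed
  ultimately have "((\<lambda>t. G (p + a * t)) has_integral (1 / a\<^sup>2) * (energy h + (l * (a * d)) * cross P u h)) {0..1}"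
    by (subst (asm) has_integral_cong) auto
  moreover have "((\<lambda>t. G (p + a * t)) has_integral integral {p..p + a} G /\<^sub>R a) {0..1}"
    using has_integral_scale[where f=G and p=p and a=a and s=0 and t=1, OF _ a(1)] integrable_integral[OF Gi] by simp
  ultimately have "(1 / a\<^sup>2) * (energy h + (l * (a * d)) * cross P u h) = integral {p..p + a} G /\<^sub>R a"
    by (rule has_integral_unique)
  then have "a * ((1 / a\<^sup>2) * (energy h + (l * (a * d)) * cross P u h)) = a * (integral {p..p + a} G /\<^sub>R a)"
    by (rule arg_cong)
  then have "integral {p..p + a} G = (1 / a) * (energy h + (l * (a * d)) * cross P u h)"
    using a by (simp add: power2_eq_square)
  then show ?thesis
    unfolding u_def[symmetric] Re_T_pencil[OF P u] FGint[symmetric] F_def[abs_def] .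
qed

locale similarity =
  fixes N :: nat and a d \<beta> :: "nat \<Rightarrow> real" and P :: "real \<Rightarrow> real"
  assumes params: "self_similarity_parameters N a d" and similar: "self_similar N a d \<beta> P"
begin

lemma P_L2: "P \<in> L2"
  using similar by (simp add: self_similar_def)

lemma a_pos: "k \<in> {1..N} \<Longrightarrow> a k > 0" and a_sum: "(\<Sum>k=1..N. a k) = 1"
  using params by (auto simp: self_similarity_parameters_def)

lemma alpha_1: "\<alpha> a 1 = 0"
  by (simp add: \<alpha>_def)

lemma alpha_Suc: "k \<ge> 1 \<Longrightarrow> \<alpha> a (Suc k) = \<alpha> a k + a k"
  by (simp add: \<alpha>_def)

lemma alpha_last: "\<alpha> a (Suc N) = 1"
  using a_sum by (simp add: \<alpha>_def atLeastLessThanSuc_atLeastAtMost)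

lemma alpha_mono:
  assumes "1 \<le> j" "j \<le> k" "k \<le> Suc N" shows "\<alpha> a j \<le> \<alpha> a k"
proof -
  have "(\<Sum>i=1..<j. a i) \<le> (\<Sum>i=1..<k. a i)"
    by (rule sum_mono2) (use assms a_pos in \<open>auto simp: less_imp_le\<close>)
  then show ?thesis by (simp add: \<alpha>_def)
qed

lemma piece_bounds:
  assumes "k \<in> {1..N}"
  shows "a k > 0" "0 \<le> \<alpha> a k" "\<alpha> a k + a k \<le> 1"
  using assms a_pos[OF assms] alpha_mono[of 1 k] alpha_1 alpha_mono[of "Suc k" "Suc N"] alpha_last alpha_Suc[of k]
  by auto

lemma integral_pieces:
  fixes f :: "real \<Rightarrow> real"
  assumes f: "f integrable_on {0..1}"
  shows "integral {0..1} f = (\<Sum>k=1..N. integral {\<alpha> a k..\<alpha> a k + a k} f)"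
proof -
  have "integral {0..\<alpha> a (Suc m)} f = (\<Sum>k=1..m. integral {\<alpha> a k..\<alpha> a k + a k} f)" if "m \<le> N" for m
    using that
  proof (induction m)
    case 0 then show ?case using alpha_1 by simp
  next
    case (Suc m)
    have le: "0 \<le> \<alpha> a (Suc m)" "\<alpha> a (Suc m) \<le> \<alpha> a (Suc (Suc m))" "\<alpha> a (Suc (Suc m)) \<le> 1"
      using Suc.prems alpha_mono[of 1 "Suc m"] alpha_mono[of "Suc m" "Suc (Suc m)"]
        alpha_mono[of "Suc (Suc m)" "Suc N"] alpha_1 alpha_last by auto
    have "f integrable_on {0..\<alpha> a (Suc (Suc m))}"
      by (rule integrable_on_subinterval[OF f]) (use le in auto)
    from Henstock_Kurzweil_Integration.integral_combine[OF le(1,2) this]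
    show ?case using Suc alpha_Suc[of "Suc m"] by simp
  qed
  from this[of N] show ?thesis using alpha_last by simp
qed

text \<open>Vanishing at the division points gives every piece the zero boundary values that
  \<open>pencil_piece\<close> requires; at 0 and 1 they come from the space itself.\<close>

lemma pencil_decomposition:
  assumes y: "sob y g" and z: "\<And>k. k \<in> {2..N} \<Longrightarrow> y (\<alpha> a k) = 0"
  shows "Re (T_pencil P l y y) = (\<Sum>k=1..N. (1 / a k) *
    Re (T_pencil P (l * (a k * d k)) (rescale (\<alpha> a k) (a k) y) (rescale (\<alpha> a k) (a k) y)))"
proof -
  have zz: "y (\<alpha> a k) = 0" if "1 \<le> k" "k \<le> Suc N" for k
  proof -
    have "k = 1 \<or> k = Suc N \<or> k \<in> {2..N}" using that by auto
    then consider "k = 1" | "k = Suc N" | "k \<in> {2..N}" by blast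
    then show ?thesis using z sobD(4,5)[OF y] alpha_1 alpha_last by cases auto
  qed
  note e = L2_square[OF sobD(1)[OF y], THEN set_lebesgue_integral_eq_integral(1)]
  note c = cross_integrable[OF P_L2 y, THEN set_lebesgue_integral_eq_integral(1)]
  have "Re (T_pencil P l y y) = integral {0..1} (\<lambda>x. (cmod (g x))\<^sup>2 + l * (2 * P x * Re (g x * cnj (y x))))"
    unfolding Re_T_pencil[OF P_L2 y] energy_def cross_def
    using Henstock_Kurzweil_Integration.integral_add[OF e integrable_on_mult_right[OF c, of l]] by simp
  also have "\<dots> = (\<Sum>k=1..N. integral {\<alpha> a k..\<alpha> a k + a k} (\<lambda>x. (cmod (g x))\<^sup>2 + l * (2 * P x * Re (g x * cnj (y x)))))"
    by (intro integral_pieces integrable_add e integrable_on_mult_right c)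
  also have "\<dots> = (\<Sum>k=1..N. (1 / a k) *
    Re (T_pencil P (l * (a k * d k)) (rescale (\<alpha> a k) (a k) y) (rescale (\<alpha> a k) (a k) y)))"
  proof (rule sum.cong[OF refl])
    fix k assume k: "k \<in> {1..N}"
    have ss: "AE x in lebesgue. x \<in> {\<alpha> a k<..<\<alpha> a k + a k} \<longrightarrow> P x = \<beta> k + d k * P ((x - \<alpha> a k) / a k)"
      using similar k alpha_Suc[of k] unfolding self_similar_def by fastforce
    show "integral {\<alpha> a k..\<alpha> a k + a k} (\<lambda>x. (cmod (g x))\<^sup>2 + l * (2 * P x * Re (g x * cnj (y x))))
      = (1 / a k) * Re (T_pencil P (l * (a k * d k)) (rescale (\<alpha> a k) (a k) y) (rescale (\<alpha> a k) (a k) y))"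
      using zz[of k] zz[of "Suc k"] k alpha_Suc[of k]
      by (intro pencil_piece[OF P_L2 y piece_bounds[OF k] _ _ ss]) auto
  qed
  finally show ?thesis .
qed

text \<open>Passing to natural numbers is safe because the mesh bound makes the index finite for
  every l.\<close>

definition nind :: "real \<Rightarrow> nat" where
  "nind l = the_enat (ind (T_pencil P l))"

lemma ind_eq_nind: "ind (T_pencil P l) = enat (nind l)"
  using ind_finite[OF P_L2, of l] by (auto simp: nind_def)

lemma spread_outside:
  assumes u: "u \<in> W21_0" and b: "b > 0" and x: "x \<le> p \<or> p + b \<le> x"
  shows "spread p b u x = 0"
proof -
  note z = sobD[OF sob_weak_deriv[OF u]]
  have "(x - p) / b \<le> 0 \<or> 1 \<le> (x - p) / b"
    using x b by (auto simp: divide_le_0_iff le_divide_eq)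
  then show ?thesis unfolding spread_def
    using z(4,5) z(6)[of "(x - p) / b"] by (cases "(x - p) / b = 0 \<or> (x - p) / b = 1") auto
qed

lemma pieces_disjoint:
  assumes "j \<in> {1..N}" "k \<in> {1..N}" "j \<noteq> k"
  shows "\<alpha> a j + a j \<le> \<alpha> a k \<or> \<alpha> a k + a k \<le> \<alpha> a j"
proof (cases "j < k")
  case True
  then show ?thesis using alpha_mono[of "Suc j" k] alpha_Suc[of j] assms by auto
next
  case False
  then show ?thesis using alpha_mono[of "Suc k" j] alpha_Suc[of k] assms by auto
qed

text \<open>The pieces do not interact, so a combination of spread functions is decoupled by
  rescaling to each piece; where two pieces touch, the spread functions already vanish.\<close>

lemma rescale_spread:
  assumes j: "j \<in> {1..N}" and k: "k \<in> {1..N}" and u: "u \<in> W21_0"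
  shows "rescale (\<alpha> a k) (a k) (spread (\<alpha> a j) (a j) u) = (if j = k then u else 0)"
proof (cases "j = k")
  case True
  have out: "spread (\<alpha> a k) (a k) u (\<alpha> a k) = 0" "spread (\<alpha> a k) (a k) u (\<alpha> a k + a k) = 0"
    by (rule spread_outside[OF u a_pos[OF k]], simp)+
  have "rescale (\<alpha> a k) (a k) (spread (\<alpha> a k) (a k) u) t = u t" for t
  proof (cases "t \<in> {0..1}")
    case True
    then show ?thesis unfolding rescale_def out using a_pos[OF k] by (simp add: spread_def)
  next
    case False
    then show ?thesis using sobD(6)[OF sob_weak_deriv[OF u] False] by (auto simp: rescale_def)
  qed
  then show ?thesis using True by auto
next
  case False
  have out: "spread (\<alpha> a j) (a j) u x = 0" if "x \<in> {\<alpha> a k..\<alpha> a k + a k}" for x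
    by (rule spread_outside[OF u a_pos[OF j]]) (use pieces_disjoint[OF j k False] that in auto)
  have "rescale (\<alpha> a k) (a k) (spread (\<alpha> a j) (a j) u) t = 0" for t
  proof (cases "t \<in> {0..1}")
    case True
    then have "\<alpha> a k + a k * t \<in> {\<alpha> a k..\<alpha> a k + a k}"
      using a_pos[OF k] by (auto simp: mult_left_le)
    then show ?thesis unfolding rescale_def
      using out[of "\<alpha> a k + a k * t"] out[of "\<alpha> a k"] out[of "\<alpha> a k + a k"] a_pos[OF k] by simp
  qed (auto simp: rescale_def)
  then show ?thesis using False by (auto simp: fun_eq_iff)
qed

text \<open>Negative families of all pieces, spread to their own intervals, are jointly negative:
  the form of a combination is the sum of the forms of its blocks \<open>v k\<close> with positive
  weights \<open>1 / a k\<close>.\<close>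

lemma nind_lower: "(\<Sum>k=1..N. nind (l * (a k * d k))) \<le> nind l"
proof -
  define n where "n k = nind (l * (a k * d k))" for k
  have "\<exists>e. neg_family (T_pencil P (l * (a k * d k))) {..<n k} e" for k
    by (rule ind_neg_family) (simp add: ind_eq_nind n_def)
  then obtain e where e: "\<And>k. neg_family (T_pencil P (l * (a k * d k))) {..<n k} (e k)" by metis
  then have W: "e k i \<in> W21_0" if "i < n k" for k i using that by (auto simp: neg_family_def)
  define I where "I = (SIGMA k:{1..N}. {..<n k})"
  define E where "E = (\<lambda>(k, i). spread (\<alpha> a k) (a k) (e k i))"
  have fI: "finite I" by (simp add: I_def)
  have EW: "E q \<in> W21_0" if qI: "q \<in> I" for q
  proof -
    obtain k i where "q = (k, i)" by (cases q)
    with qI have q: "q = (k, i)" "k \<in> {1..N}" "i < n k" unfolding I_def by simp_all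
    show ?thesis unfolding q(1) E_def prod.case
      by (rule sob_W21_0[OF sob_spread[OF sob_weak_deriv[OF W[OF q(3)]] piece_bounds[OF q(2)]]])
  qed
  have "neg_family (T_pencil P l) I E"
    unfolding neg_family_def
  proof (intro conjI allI impI ballI fI EW)
    fix c :: "nat \<times> nat \<Rightarrow> complex" assume c: "\<exists>q\<in>I. c q \<noteq> 0"
    define y where "y = (\<Sum>q\<in>I. cscale (c q) (E q))"
    define v where "v k = (\<Sum>i<n k. cscale (c (k, i)) (e k i))" for k
    have "y \<in> W21_0" unfolding y_def by (rule lincomb_W21_0) (rule EW)
    then obtain g where y: "sob y g" unfolding W21_0_iff by blast
    have yz: "y (\<alpha> a k) = 0" if k: "k \<in> {2..N}" for k
    proof -
      have Ez: "E q (\<alpha> a k) = 0" if qI: "q \<in> I" for q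
      proof -
        obtain j i where "q = (j, i)" by (cases q)
        with qI have q: "q = (j, i)" "j \<in> {1..N}" "i < n j" unfolding I_def by simp_all
        have "\<alpha> a k \<le> \<alpha> a j \<or> \<alpha> a j + a j \<le> \<alpha> a k"
          using pieces_disjoint[OF q(2), of k] a_pos[of k] k by (cases "j = k") auto
        then show ?thesis unfolding q(1) E_def prod.case
          by (rule spread_outside[OF W[OF q(3)] a_pos[OF q(2)]])
      qed
      have "y (\<alpha> a k) = (\<Sum>q\<in>I. c q * E q (\<alpha> a k))"
        unfolding y_def using functional_sum[OF functional_eval[of "\<alpha> a k"] EW] .
      then show ?thesis using Ez by simp
    qed
    have yv: "rescale (\<alpha> a k) (a k) y = v k" if k: "k \<in> {1..N}" for k
    proof -
      have "rescale (\<alpha> a k) (a k) y = (\<Sum>q\<in>I. cscale (c q) (rescale (\<alpha> a k) (a k) (E q)))"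
        unfolding y_def by (rule rescale_sum)
      also have "\<dots> = (\<Sum>j=1..N. \<Sum>i<n j. cscale (c (j, i)) (rescale (\<alpha> a k) (a k) (E (j, i))))"
        unfolding I_def by (subst sum.Sigma) (auto simp: split_def)
      also have "\<dots> = (\<Sum>j=1..N. if j = k then v k else 0)"
      proof (rule sum.cong[OF refl])
        fix j assume j: "j \<in> {1..N}"
        have "(\<Sum>i<n j. cscale (c (j, i)) (rescale (\<alpha> a k) (a k) (E (j, i))))
          = (\<Sum>i<n j. cscale (c (j, i)) (if j = k then e j i else 0))"
          unfolding E_def prod.case by (intro sum.cong refl arg_cong2[where f=cscale] rescale_spread[OF j k] W) auto
        also have "\<dots> = (if j = k then v k else 0)"
          by (cases "j = k") (simp_all only: v_def if_True if_False cfun.scale_zero_right sum.neutral_const simp_thms)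
        finally show "(\<Sum>i<n j. cscale (c (j, i)) (rescale (\<alpha> a k) (a k) (E (j, i)))) = (if j = k then v k else 0)" .
      qed
      also have "\<dots> = v k" using k by (simp only: sum.delta finite_atLeastAtMost if_True)
      finally show ?thesis .
    qed
    have "Re (T_pencil P l y y) = (\<Sum>k=1..N. (1 / a k) * Re (T_pencil P (l * (a k * d k)) (v k) (v k)))"
      by (rule trans[OF pencil_decomposition[OF y yz] sum.cong[OF refl]]) (simp_all only: yv)
    also have "\<dots> < (\<Sum>k=1..N. 0)"
    \<comment> \<open>No block is positive, and a nonzero coefficient \<open>c (k, i)\<close> makes
      block k strictly negative.\<close>
    proof (rule sum_strict_mono_ex1)
      have neg: "(1 / a k) * Re (T_pencil P (l * (a k * d k)) (v k) (v k)) < 0"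
        if "k \<in> {1..N}" "\<exists>i<n k. c (k, i) \<noteq> 0" for k
        using e[of k] that a_pos[OF that(1)] unfolding neg_family_def v_def
        by (intro mult_pos_neg) (auto elim!: allE[of _ "\<lambda>i. c (k, i)"])
      have zero: "(1 / a k) * Re (T_pencil P (l * (a k * d k)) (v k) (v k)) = 0"
        if "\<not> (\<exists>i<n k. c (k, i) \<noteq> 0)" for k
      proof -
        have "v k = 0" unfolding v_def by (rule sum.neutral) (use that in auto)
        then have "T_pencil P (l * (a k * d k)) (v k) (v k) = 0"
          using hermitianD(4)[OF hermitian_T_pencil[OF P_L2] cfun.subspace_0[OF W21_0_subspace]] by metis
        then show ?thesis by simp
      qed
      show "\<forall>k\<in>{1..N}. (1 / a k) * Re (T_pencil P (l * (a k * d k)) (v k) (v k)) \<le> 0"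
      proof
        fix k assume "k \<in> {1..N}"
        then show "(1 / a k) * Re (T_pencil P (l * (a k * d k)) (v k) (v k)) \<le> 0"
          using neg[of k] zero[of k] by (cases "\<exists>i<n k. c (k, i) \<noteq> 0") auto
      qed
      show "\<exists>k\<in>{1..N}. (1 / a k) * Re (T_pencil P (l * (a k * d k)) (v k) (v k)) < 0"
        using c neg unfolding I_def by blast
    qed simp
    finally show "Re (T_pencil P l (\<Sum>q\<in>I. cscale (c q) (E q)) (\<Sum>q\<in>I. cscale (c q) (E q))) < 0"
      by (simp add: y_def)
  qed
  from neg_family_ind[OF hermitian_T_pencil[OF P_L2] this]
  show ?thesis unfolding ind_eq_nind I_def n_def by simp
qed

text \<open>The N - 1 extra conditions are the values at the inner division points. With the
  conditions of the pieces, pulled back along \<open>rescale\<close>, they make every summand of the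
  decomposition nonnegative.\<close>

lemma nind_upper: "nind l \<le> (\<Sum>k=1..N. nind (l * (a k * d k))) + (N - 1)"
proof -
  define n where "n k = nind (l * (a k * d k))" for k
  have "\<exists>\<xi>. (\<forall>j<n k. functional (\<xi> j)) \<and>
    (\<forall>y\<in>W21_0. (\<forall>j<n k. \<xi> j y = 0) \<longrightarrow> Re (T_pencil P (l * (a k * d k)) y y) \<ge> 0)" for k
    by (rule ind_functionals[OF hermitian_T_pencil[OF P_L2]]) (simp add: ind_eq_nind n_def)
  then obtain \<xi> where \<xi>: "\<And>k j. j < n k \<Longrightarrow> functional (\<xi> k j)"
    and nonneg: "\<And>k y. y \<in> W21_0 \<Longrightarrow> (\<And>j. j < n k \<Longrightarrow> \<xi> k j y = 0) \<Longrightarrow> Re (T_pencil P (l * (a k * d k)) y y) \<ge> 0"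
    by metis
  define S where "S = (SIGMA k:{1..N}. {..<n k})"
  define J where "J = {2..N} <+> S"
  \<comment> \<open>\<open>rescale\<close> is linear on the whole space, so the pulled back
    conditions are functionals even on functions that do not vanish at the division points.\<close>
  define f where "f q y = (case q of Inl k \<Rightarrow> y (\<alpha> a k)
    | Inr (k, j) \<Rightarrow> \<xi> k j (rescale (\<alpha> a k) (a k) y))" for q y
  have rW: "rescale (\<alpha> a k) (a k) y \<in> W21_0" if "k \<in> {1..N}" "y \<in> W21_0" for k y
    by (rule sob_W21_0[OF sob_rescale[OF sob_weak_deriv[OF that(2)] piece_bounds[OF that(1)]]])
  have "ind (T_pencil P l) \<le> enat (card J)"
  proof (rule ind_le_card_functionals[where \<xi>=f])
    show "finite J" by (simp add: J_def S_def)
    fix q assume "q \<in> J"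
    then consider k where "q = Inl k" | k j where "q = Inr (k, j)" "k \<in> {1..N}" "j < n k"
      by (auto simp: J_def S_def)
    then show "functional (f q)"
    proof cases
      case 1 then show ?thesis unfolding f_def using functional_eval by simp
    next
      case 2
      note l = functionalD[OF \<xi>[OF 2(3)]]
      show ?thesis unfolding functional_def f_def 2(1) sum.case prod.case rescale_add rescale_cscale
        using l rW[OF 2(2)] by blast
    qed
  next
    fix y assume yW: "y \<in> W21_0" and z: "\<And>q. q \<in> J \<Longrightarrow> f q y = 0"
    have z1: "y (\<alpha> a k) = 0" if "k \<in> {2..N}" for k
    proof -
      have "Inl k \<in> J" using that unfolding J_def by blast
      from z[OF this] show ?thesis by (simp add: f_def)
    qed
    have z2: "\<xi> k j (rescale (\<alpha> a k) (a k) y) = 0" if "k \<in> {1..N}" "j < n k" for k j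
    proof -
      have "Inr (k, j) \<in> J" using that unfolding J_def S_def by blast
      from z[OF this] show ?thesis by (simp add: f_def)
    qed
    have "(\<Sum>k=1..N. (1 / a k) *
      Re (T_pencil P (l * (a k * d k)) (rescale (\<alpha> a k) (a k) y) (rescale (\<alpha> a k) (a k) y))) \<ge> 0"
    proof (rule sum_nonneg)
      fix k assume k: "k \<in> {1..N}"
      have "Re (T_pencil P (l * (a k * d k)) (rescale (\<alpha> a k) (a k) y) (rescale (\<alpha> a k) (a k) y)) \<ge> 0"
        by (rule nonneg[OF rW[OF k yW] z2[OF k]])
      then show "0 \<le> 1 / a k * Re (T_pencil P (l * (a k * d k)) (rescale (\<alpha> a k) (a k) y) (rescale (\<alpha> a k) (a k) y))"
        using a_pos[OF k] by simp
    qed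
    then show "Re (T_pencil P l y y) \<ge> 0"
      using pencil_decomposition[OF sob_weak_deriv[OF yW] z1, of l] by simp
  qed
  moreover have "card J = (N - 1) + (\<Sum>k=1..N. n k)"
    unfolding J_def by (subst card_Plus) (auto simp: S_def)
  ultimately show ?thesis unfolding ind_eq_nind n_def by simp
qed

end

section \<open>Nontriviality of the index\<close>

lemma sob_of_real:
  assumes u: "ac 0 1 u f" "f \<in> L2" "u 0 = 0" "u 1 = 0"
  shows "sob (\<lambda>x. if x \<in> {0..1} then complex_of_real (u x) else 0) (\<lambda>x. complex_of_real (f x))"
proof -
  have "ac 0 1 (\<lambda>x. Re (if x \<in> {0..1} then complex_of_real (u x) else 0)) (\<lambda>x. Re (complex_of_real (f x)))"
    by (rule ac_cong[OF u(1)]) auto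
  moreover have "ac 0 1 (\<lambda>x. Im (if x \<in> {0..1} then complex_of_real (u x) else 0)) (\<lambda>x. Im (complex_of_real (f x)))"
    by (rule ac_cong[OF ac_const[of 0 1 0]]) auto
  ultimately show ?thesis unfolding sob_def using of_real_L2[OF u(2)] u by simp
qed

text \<open>The functions \<open>u\<^sup>2 / (u\<^sup>2 + \<epsilon>)\<close> are cutoffs subordinate to \<open>u\<close>: multiplying by them writes \<open>u\<close> as a
  limit of products of two elements of the space.\<close>

lemma orthogonal_to_products:
  assumes P: "P \<in> L2"
    and orth: "\<And>u f v g. ac 0 1 u f \<Longrightarrow> f \<in> L2 \<Longrightarrow> u 0 = 0 \<Longrightarrow> u 1 = 0 \<Longrightarrow>
      ac 0 1 v g \<Longrightarrow> g \<in> L2 \<Longrightarrow> v 0 = 0 \<Longrightarrow> v 1 = 0 \<Longrightarrow>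
      integral {0..1} (\<lambda>x. P x * (f x * v x + u x * g x)) = 0"
    and u: "ac 0 1 u f" "f \<in> L2" "u 0 = 0" "u 1 = (0::real)"
  shows "integral {0..1} (\<lambda>x. P x * f x) = 0"
proof -
  define \<epsilon> where "\<epsilon> n = 1 / (real n + 1)" for n
  have \<epsilon>: "\<epsilon> n > 0" for n by (simp add: \<epsilon>_def)
  have \<epsilon>0: "\<epsilon> \<longlonglongrightarrow> 0" unfolding \<epsilon>_def by (rule lim_1_over_n[THEN LIMSEQ_Suc, simplified, unfolded add.commute[of 1]])
  define \<psi> where "\<psi> n s = s\<^sup>2 / (s\<^sup>2 + \<epsilon> n)" for n and s :: real
  define \<psi>' where "\<psi>' n s = 2 * \<epsilon> n * s / (s\<^sup>2 + \<epsilon> n)\<^sup>2" for n and s :: real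
  \<comment> \<open>The derivative of \<open>s * \<psi> n s\<close>, so that
    \<open>u x * \<psi> n (u x)\<close> has derivative
    \<open>\<theta> n (u x) * f x\<close>.\<close>
  define \<theta> where "\<theta> n s = \<psi> n s + s * \<psi>' n s" for n and s :: real
  have pos: "s\<^sup>2 + \<epsilon> n > 0" for n and s :: real using \<epsilon>[of n] by (simp add: add_nonneg_pos)
  then have ne: "s\<^sup>2 + \<epsilon> n \<noteq> 0" for n and s :: real by (metis less_irrefl)
  note uc = ac_continuous_on[OF u(1)]
  have der: "(\<psi> n has_real_derivative \<psi>' n s) (at s)" for n s
    unfolding \<psi>_def \<psi>'_def
    by (rule derivative_eq_intros refl ne | simp)+ (simp add: power2_eq_square algebra_simps)
  have \<psi>'c: "continuous_on S (\<psi>' n)" for S n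
    unfolding \<psi>'_def by (intro continuous_intros) (simp add: ne)
  have \<psi>c: "continuous_on S (\<psi> n)" for S n
    unfolding \<psi>_def by (intro continuous_intros) (simp add: ne)
  have \<theta>c: "continuous_on {0..1} (\<lambda>x. \<theta> n (u x))" for n
    unfolding \<theta>_def
    by (intro continuous_intros uc continuous_on_compose2[OF \<psi>c uc subset_UNIV]
        continuous_on_compose2[OF \<psi>'c uc subset_UNIV])
  have v: "ac 0 1 (\<lambda>x. \<psi> n (u x)) (\<lambda>x. \<psi>' n (u x) * f x)" for n
    by (rule ac_chain[OF u(1) der \<psi>'c])
  have vL2: "(\<lambda>x. \<psi>' n (u x) * f x) \<in> L2" for n
    by (rule L2_real_mult_cont[OF continuous_on_compose2[OF \<psi>'c uc subset_UNIV] u(2)])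
  have prod: "f x * \<psi> n (u x) + u x * (\<psi>' n (u x) * f x) = \<theta> n (u x) * f x" for n x
    by (simp add: \<theta>_def algebra_simps)
  have uv: "ac 0 1 (\<lambda>x. u x * \<psi> n (u x)) (\<lambda>x. \<theta> n (u x) * f x)" for n
    using ac_mult[OF u(1) v[of n]] unfolding prod .
  have zero: "integral {0..1} (\<lambda>x. \<theta> n (u x) * (P x * f x)) = 0" for n
  proof -
    have "integral {0..1} (\<lambda>x. P x * (f x * \<psi> n (u x) + u x * (\<psi>' n (u x) * f x))) = 0"
      by (rule orth[OF u v vL2]) (simp_all add: u \<psi>_def)
    then show ?thesis unfolding prod by (simp add: mult_ac)
  qed
  \<comment> \<open>\<open>s * \<psi>' n s\<close> equals
    \<open>2 * \<psi> n s * (1 - \<psi> n s)\<close>, so the bound is uniform in n and in s.\<close>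
  have bound: "\<bar>\<theta> n s\<bar> \<le> 3" for n s
  proof -
    have 1: "0 \<le> \<psi> n s" "\<psi> n s \<le> 1" unfolding \<psi>_def using pos[of s n] \<epsilon>[of n] by (auto simp: divide_le_eq_1)
    have "s * \<psi>' n s = 2 * (\<psi> n s * (\<epsilon> n / (s\<^sup>2 + \<epsilon> n)))"
      unfolding \<psi>'_def \<psi>_def by (simp add: power2_eq_square)
    moreover have "0 \<le> \<epsilon> n / (s\<^sup>2 + \<epsilon> n)" "\<epsilon> n / (s\<^sup>2 + \<epsilon> n) \<le> 1"
      using pos[of s n] \<epsilon>[of n] by (auto simp: divide_le_eq_1)
    moreover have "0 \<le> a * b" "a * b \<le> 1" if "0 \<le> a" "a \<le> 1" "0 \<le> b" "b \<le> 1" for a b :: real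
      using that mult_mono[of a 1 b 1] by auto
    ultimately have "0 \<le> s * \<psi>' n s" "s * \<psi>' n s \<le> 2"
      using 1 by (metis mult.commute mult_1_right mult_left_mono mult_nonneg_nonneg zero_le_numeral)+
    then show ?thesis using 1 unfolding \<theta>_def by linarith
  qed
  have lim: "(\<lambda>n. \<theta> n s) \<longlonglongrightarrow> (if s = 0 then 0 else 1)" for s
  proof (cases "s = 0")
    case True then show ?thesis by (simp add: \<theta>_def \<psi>_def)
  next
    case False
    have "(\<lambda>n. s\<^sup>2 / (s\<^sup>2 + \<epsilon> n) + s * (2 * \<epsilon> n * s / (s\<^sup>2 + \<epsilon> n)\<^sup>2)) \<longlonglongrightarrow>
        s\<^sup>2 / (s\<^sup>2 + 0) + s * (2 * 0 * s / (s\<^sup>2 + 0)\<^sup>2)"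
      by (intro tendsto_intros \<epsilon>0) (use False in auto)
    then show ?thesis using False by (simp add: \<theta>_def \<psi>_def \<psi>'_def)
  qed
  define \<omega> where "\<omega> x = (if u x = 0 then 0 else 1 :: real)" for x
  have dct: "(\<lambda>x. \<omega> x * h x) absolutely_integrable_on {0..t} \<and>
      (\<lambda>n. integral {0..t} (\<lambda>x. \<theta> n (u x) * h x)) \<longlonglongrightarrow> integral {0..t} (\<lambda>x. \<omega> x * h x)"
    if h: "h absolutely_integrable_on {0..1}" and t: "t \<in> {0..1}" for h t
  proof -
    have hn: "(\<lambda>x. \<theta> n (u x) * h x) absolutely_integrable_on {0..t}" for n
      by (rule absolutely_integrable_Icc_subset(1)[OF absolutely_integrable_continuous_mult[OF \<theta>c h]]) (use t in auto)
    have h3: "(\<lambda>x. 3 * \<bar>h x\<bar>) integrable_on {0..t}"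
      by (rule integrable_on_mult_right[OF absolutely_integrable_Icc_subset(2)[OF set_integrable_abs[OF h]]]) (use t in auto)
    have b: "norm (\<theta> n (u x) * h x) \<le> 3 * \<bar>h x\<bar>" for n x
      using bound[of n "u x"] by (simp add: abs_mult mult_right_mono)
    have l: "(\<lambda>n. \<theta> n (u x) * h x) \<longlonglongrightarrow> \<omega> x * h x" for x
      unfolding \<omega>_def by (intro tendsto_intros lim)
    have b': "norm (\<omega> x * h x) \<le> 3 * \<bar>h x\<bar>" for x by (simp add: \<omega>_def)
    show ?thesis
      using dominated_convergence_absolutely_integrable[OF hn h3 b' l]
        dominated_convergence(2)[OF set_lebesgue_integral_eq_integral(1)[OF hn] h3 b l] by blast
  qed
  have fi: "f absolutely_integrable_on {0..1}" by (rule L2_absolutely_integrable[OF u(2)])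
  \<comment> \<open>The limit exhibits \<open>\<omega> x * f x\<close> as a second derivative
    function of u; by uniqueness f vanishes almost everywhere on the zero set of u, the only place
    where the cutoffs do not tend to 1.\<close>
  have acu: "ac 0 1 u (\<lambda>x. \<omega> x * f x)"
  proof (rule acI[where c=0])
    show "(\<lambda>x. \<omega> x * f x) absolutely_integrable_on {0..1}" using dct[OF fi, of 1] by simp
    fix x assume x: "(0::real) \<le> x" "x \<le> 1"
    have "u x * \<psi> n (u x) = integral {0..x} (\<lambda>x. \<theta> n (u x) * f x)" for n
      using acD(2)[OF uv[of n], of 0 x] x u(3) by simp
    then have 1: "(\<lambda>n. u x * \<psi> n (u x)) \<longlonglongrightarrow> integral {0..x} (\<lambda>x. \<omega> x * f x)"
      using dct[OF fi, of x] x by simp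
    have "(\<lambda>n. u x * \<psi> n (u x)) \<longlonglongrightarrow> u x"
    proof (cases "u x = 0")
      case False
      have "(\<lambda>n. u x * ((u x)\<^sup>2 / ((u x)\<^sup>2 + \<epsilon> n))) \<longlonglongrightarrow> u x * ((u x)\<^sup>2 / ((u x)\<^sup>2 + 0))"
        by (intro tendsto_intros \<epsilon>0) (use False in auto)
      then show ?thesis using False by (simp add: \<psi>_def)
    qed simp
    from LIMSEQ_unique[OF this 1] show "u x = 0 + integral {0..x} (\<lambda>x. \<omega> x * f x)" by simp
  qed
  obtain M where M: "\<And>x. x \<in> space lebesgue - M \<Longrightarrow> x \<in> {0..1} \<longrightarrow> f x = \<omega> x * f x" "M \<in> null_sets lebesgue"
    by (rule AE_E3[OF ac_unique[OF u(1) acu]]) (rule that)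
  have "integral {0..1} (\<lambda>x. P x * f x) = integral {0..1} (\<lambda>x. \<omega> x * (P x * f x))"
  proof (rule integral_spike)
    show "negligible M" using M(2) by (simp add: negligible_iff_null_sets)
    fix x assume "x \<in> {0..1} - M"
    then have "f x = \<omega> x * f x" using M(1)[of x] by simp
    then show "\<omega> x * (P x * f x) = P x * f x" by (metis mult.left_commute)
  qed
  moreover have "(\<lambda>n. 0) \<longlonglongrightarrow> integral {0..1} (\<lambda>x. \<omega> x * (P x * f x))"
    using dct[OF L2_real_mult[OF P u(2)], of 1] unfolding zero by simp
  ultimately show ?thesis using LIMSEQ_unique[OF tendsto_const] by metis
qed

text \<open>If the quadratic form vanished identically, polarisation would make P orthogonal to the
  derivative of every product u v, hence by \<open>orthogonal_to_products\<close> to every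
  derivative of an element of the space, and \<rho> would be zero.\<close>

lemma cross_nonzero:
  assumes P: "P \<in> L2" and gd: "\<exists>y\<in>W21_0. generalized_derivative P y \<noteq> 0"
  shows "\<exists>y g. sob y g \<and> cross P y g \<noteq> 0"
proof (rule ccontr)
  assume "\<not> ?thesis"
  then have cr: "cross P y g = 0" if "sob y g" for y g using that by blast
  have quad: "integral {0..1} (\<lambda>x. P x * (f x * u x)) = 0"
    if u: "ac 0 1 u f" "f \<in> L2" "u 0 = 0" "u 1 = 0" for u f
  proof -
    have "cross P (\<lambda>x. if x \<in> {0..1} then complex_of_real (u x) else 0) (\<lambda>x. complex_of_real (f x))
      = integral {0..1} (\<lambda>x. 2 * (P x * (f x * u x)))"
      unfolding cross_def by (rule Henstock_Kurzweil_Integration.integral_cong) simp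
    then show ?thesis using cr[OF sob_of_real[OF u]] by simp
  qed
  have zero: "integral {0..1} (\<lambda>x. P x * f x) = 0" if u: "ac 0 1 u f" "f \<in> L2" "u 0 = 0" "u 1 = 0" for u f
  proof (rule orthogonal_to_products[OF P _ u])
    fix u f v g :: "real \<Rightarrow> real"
    assume u: "ac 0 1 u f" "f \<in> L2" "u 0 = 0" "u 1 = 0" and v: "ac 0 1 v g" "g \<in> L2" "v 0 = 0" "v 1 = 0"
    have int: "(\<lambda>x. P x * (f x * v x)) integrable_on {0..1}" if "ac 0 1 v g" "f \<in> L2" for v g f
      using set_lebesgue_integral_eq_integral(1)[OF L2_real_mult[OF P L2_real_mult_cont[OF ac_continuous_on[OF that(1)] that(2)]]]
      by (simp add: mult.commute)
    note i = int[OF u(1) u(2)] int[OF v(1) v(2)] int[OF v(1) u(2)] int[OF u(1) v(2)]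
    have "0 = integral {0..1} (\<lambda>x. P x * ((f x + g x) * (u x + v x)))"
      by (rule quad[symmetric]) (use ac_add[OF u(1) v(1)] L2_add[OF u(2) v(2)] u v in auto)
    also have "\<dots> = integral {0..1} (\<lambda>x. (P x * (f x * u x) + P x * (g x * v x)) + P x * (f x * v x + u x * g x))"
      by (rule Henstock_Kurzweil_Integration.integral_cong) (simp add: algebra_simps)
    also have "\<dots> = integral {0..1} (\<lambda>x. P x * (f x * u x) + P x * (g x * v x)) + integral {0..1} (\<lambda>x. P x * (f x * v x + u x * g x))"
    proof (rule Henstock_Kurzweil_Integration.integral_add)
      show "(\<lambda>x. P x * (f x * u x) + P x * (g x * v x)) integrable_on {0..1}"
        by (rule integrable_add[OF i(1,2)])
      show "(\<lambda>x. P x * (f x * v x + u x * g x)) integrable_on {0..1}"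
        using integrable_add[OF i(3,4)] by (simp add: algebra_simps)
    qed
    also have "integral {0..1} (\<lambda>x. P x * (f x * u x) + P x * (g x * v x)) = 0"
      using Henstock_Kurzweil_Integration.integral_add[OF i(1,2)] quad[OF u] quad[OF v] by simp
    finally show "integral {0..1} (\<lambda>x. P x * (f x * v x + u x * g x)) = 0" by simp
  qed
  obtain y where y: "y \<in> W21_0" "generalized_derivative P y \<noteq> 0" using gd by blast
  define g where "g = weak_deriv y"
  have s: "sob y g" unfolding g_def by (rule sob_weak_deriv[OF y(1)])
  have ai: "(\<lambda>x. of_real (P x) * cnj (g x)) absolutely_integrable_on {0..1}"
    by (rule L2_cmult[OF of_real_L2[OF P] cnj_L2[OF sobD(1)[OF s]]])
  have gd: "generalized_derivative P y = - integral {0..1} (\<lambda>x. of_real (P x) * cnj (g x))"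
    unfolding generalized_derivative_def g_def[symmetric] unit_meas_integral[OF ai] ..
  note i = set_lebesgue_integral_eq_integral(1)[OF ai]
  have "Re (generalized_derivative P y) = 0"
    using zero[OF sobD(2)[OF s] L2_ReIm(1)[OF sobD(1)[OF s]]] sobD(4,5)[OF s]
    unfolding gd by (simp add: integral_ReIm[OF i])
  moreover have "Im (generalized_derivative P y) = 0"
    using zero[OF sobD(3)[OF s] L2_ReIm(2)[OF sobD(1)[OF s]]] sobD(4,5)[OF s]
    unfolding gd by (simp add: integral_ReIm[OF i])
  ultimately show False using y(2) by (simp add: complex_eq_iff)
qed

lemma ind_pos_of_negative:
  assumes P: "P \<in> L2" and y: "sob y g" and neg: "energy g + l * cross P y g < 0"
  shows "1 \<le> ind (T_pencil P l)"
proof -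
  have "neg_family (T_pencil P l) {0::nat} (\<lambda>_. y)"
    unfolding neg_family_def
  proof (intro conjI allI impI ballI)
    show "y \<in> W21_0" by (rule sob_W21_0[OF y])
    fix c :: "nat \<Rightarrow> complex" assume "\<exists>i\<in>{0}. c i \<noteq> 0"
    then have c: "c 0 \<noteq> 0" by simp
    have cy: "cscale (c 0) y \<in> W21_0" by (rule sob_W21_0[OF sob_cscale[OF y]])
    note H = hermitianD[OF hermitian_T_pencil[OF P]]
    have "T_pencil P l (cscale (c 0) y) (cscale (c 0) y) = c 0 * T_pencil P l y (cscale (c 0) y)"
      by (rule H(2)[OF sob_W21_0[OF y] cy])
    also have "T_pencil P l y (cscale (c 0) y) = cnj (c 0) * T_pencil P l y y"
      using H(3)[OF cy sob_W21_0[OF y]] H(2)[OF sob_W21_0[OF y] sob_W21_0[OF y], of l "c 0"]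
        H(3)[OF sob_W21_0[OF y] sob_W21_0[OF y], of l] by simp
    finally have "Re (T_pencil P l (cscale (c 0) y) (cscale (c 0) y)) = (cmod (c 0))\<^sup>2 * Re (T_pencil P l y y)"
      by (simp add: mult.assoc[symmetric] del: mult.assoc flip: complex_norm_square)
    also have "\<dots> < 0" using c neg unfolding Re_T_pencil[OF P y] by (intro mult_pos_neg) auto
    finally show "Re (T_pencil P l (\<Sum>i\<in>{0}. cscale (c i) y) (\<Sum>i\<in>{0}. cscale (c i) y)) < 0" by simp
  qed simp
  from neg_family_ind[OF hermitian_T_pencil[OF P] this] show ?thesis by (simp add: one_enat_def)
qed

context similarity
begin

text \<open>The form is affine in l, so a y with nonzero cross term makes it negative for all large
  l of one sign. The sign of the cross term is not known, hence the disjunction.\<close>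

lemma nind_eventually_pos:
  assumes gd: "\<exists>y\<in>W21_0. generalized_derivative P y \<noteq> 0"
  shows "\<exists>L. (\<forall>l\<ge>L. nind l \<ge> 1) \<or> (\<forall>l\<ge>L. nind (- l) \<ge> 1)"
proof -
  obtain y g where y: "sob y g" and c: "cross P y g \<noteq> 0" using cross_nonzero[OF P_L2 gd] by blast
  have pos: "nind l \<ge> 1" if "energy g + l * cross P y g < 0" for l
    using ind_pos_of_negative[OF P_L2 y that] unfolding ind_eq_nind by (simp add: one_enat_def)
  define L where "L = (energy g + 1) / \<bar>cross P y g\<bar>"
  have L: "energy g < l * \<bar>cross P y g\<bar>" if "l \<ge> L" for l
  proof -
    have "energy g + 1 = L * \<bar>cross P y g\<bar>" using c by (simp add: L_def)
    also have "\<dots> \<le> l * \<bar>cross P y g\<bar>" by (rule mult_right_mono[OF that]) simp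
    finally show ?thesis by simp
  qed
  show ?thesis
  proof (cases "cross P y g < 0")
    case True
    then have "nind l \<ge> 1" if "l \<ge> L" for l using L[OF that] by (intro pos) simp
    then show ?thesis by blast
  next
    case False
    then have "nind (- l) \<ge> 1" if "l \<ge> L" for l using L[OF that] c by (intro pos) simp
    then show ?thesis by blast
  qed
qed

end

section \<open>A parametric Volterra system\<close>

text \<open>Dominated convergence along sequences: once the variable end point is written as an
  indicator, the integrands converge except at the single point \<open>r = snd p\<close>.\<close>

lemma parametric_integral_continuous:
  fixes k :: "real \<times> real \<Rightarrow> real"
  assumes k: "continuous_on ({a..b} \<times> {0..1}) k" and m: "m absolutely_integrable_on {0..1}"
  shows "continuous_on ({a..b} \<times> {0..1}) (\<lambda>p. integral {0..snd p} (\<lambda>r. k (fst p, r) * m r))"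
  unfolding continuous_on_sequentially
proof (intro allI ballI impI)
  fix X :: "nat \<Rightarrow> real \<times> real" and p
  assume p: "p \<in> {a..b} \<times> {0..1}" and X: "(\<forall>n. X n \<in> {a..b} \<times> {0..1}) \<and> X \<longlonglongrightarrow> p"
  have "compact (k ` ({a..b} \<times> {0..1}))"
    by (intro compact_continuous_image k compact_Times) auto
  then obtain B where B: "\<And>q. q \<in> {a..b} \<times> {0..1} \<Longrightarrow> \<bar>k q\<bar> \<le> B"
    using compact_imp_bounded[of "k ` ({a..b} \<times> {0..1})"] unfolding bounded_iff by auto
  define F where "F q r = (if r \<in> {0..snd q} then k (fst q, r) * m r else 0)" for q r
  have kc: "continuous_on {0..1} (\<lambda>r. k (fst q, r))" if "q \<in> {a..b} \<times> {0..1}" for q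
    by (rule continuous_on_compose2[OF k]) (use that in \<open>auto intro!: continuous_intros\<close>)
  have Fint: "integral {0..1} (F q) = integral {0..snd q} (\<lambda>r. k (fst q, r) * m r)"
    if "q \<in> {a..b} \<times> {0..1}" for q
  proof -
    have "{0..snd q} \<inter> {0..1} = {0..snd q}" using that by auto
    then show ?thesis
      unfolding F_def[abs_def]
      using Henstock_Kurzweil_Integration.integral_restrict_Int[of "{0..1}" "{0..snd q}" "\<lambda>r. k (fst q, r) * m r"]
      by (simp only:)
  qed
  have Fi: "F q integrable_on {0..1}" if q: "q \<in> {a..b} \<times> {0..1}" for q
  proof -
    have "(\<lambda>r. k (fst q, r) * m r) integrable_on {0..snd q}"
      by (rule absolutely_integrable_Icc_subset(2)[OF absolutely_integrable_continuous_mult[OF kc[OF q] m]]) (use q in auto)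
    moreover have "{0..snd q} \<inter> {0..1} = {0..snd q}" using q by auto
    ultimately show ?thesis unfolding F_def[abs_def] integrable_restrict_Int[of "{0..snd q}" _ "{0..1}"] by (simp only:)
  qed
  \<comment> \<open>The exceptional point is removed from the domain, which leaves all integrals
    unchanged.\<close>
  have spike: "integral ({0..1} - {snd p}) f = integral {0..1} f" for f :: "real \<Rightarrow> real"
    by (rule integral_spike_set) (auto intro: negligible_subset[of "{snd p}"])
  have spikei: "f integrable_on ({0..1} - {snd p})" if "f integrable_on {0..1}" for f :: "real \<Rightarrow> real"
    using that by (rule integrable_spike_set) (auto intro: negligible_subset[of "{snd p}"])
  have "(\<lambda>n. integral ({0..1} - {snd p}) (F (X n))) \<longlonglongrightarrow> integral ({0..1} - {snd p}) (F p)"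
  proof (rule dominated_convergence(2)[where h="\<lambda>r. B * \<bar>m r\<bar>"])
    show "F (X n) integrable_on ({0..1} - {snd p})" for n by (rule spikei[OF Fi]) (use X in auto)
    show "(\<lambda>r. B * \<bar>m r\<bar>) integrable_on ({0..1} - {snd p})"
      by (rule spikei[OF integrable_on_mult_right[OF set_lebesgue_integral_eq_integral(1)[OF set_integrable_abs[OF m]]]])
    have B0: "B \<ge> 0" using B[OF p] by linarith
    show "norm (F (X n) r) \<le> B * \<bar>m r\<bar>" if "r \<in> {0..1} - {snd p}" for n r
    proof -
      have "X n \<in> {a..b} \<times> {0..1}" using X by blast
      then have "(fst (X n), r) \<in> {a..b} \<times> {0..1}" using that by auto
      from B[OF this] show ?thesis unfolding F_def using B0 by (simp add: abs_mult mult_right_mono)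
    qed
    show "(\<lambda>n. F (X n) r) \<longlonglongrightarrow> F p r" if r: "r \<in> {0..1} - {snd p}" for r
    proof -
      have f: "(\<lambda>n. fst (X n)) \<longlonglongrightarrow> fst p" and s: "(\<lambda>n. snd (X n)) \<longlonglongrightarrow> snd p"
        using X by (auto intro: tendsto_fst tendsto_snd)
      have c: "continuous_on {a..b} (\<lambda>\<mu>. k (\<mu>, r))"
        by (rule continuous_on_compose2[OF k]) (use r in \<open>auto intro!: continuous_intros\<close>)
      have "fst (X n) \<in> {a..b}" for n using X by (metis mem_Times_iff)
      then have ev: "\<forall>\<^sub>F n in sequentially. fst (X n) \<in> {a..b}" by simp
      have "fst p \<in> {a..b}" using p by auto
      from continuous_on_tendsto_compose[OF c f this ev]
      have kl: "(\<lambda>n. k (fst (X n), r)) \<longlonglongrightarrow> k (fst p, r)" .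
      show ?thesis
      proof (cases "r < snd p")
        case True
        have "\<forall>\<^sub>F n in sequentially. r < snd (X n)" by (rule order_tendstoD(1)[OF s True])
        then have "\<forall>\<^sub>F n in sequentially. k (fst (X n), r) * m r = F (X n) r"
          by eventually_elim (use r in \<open>auto simp: F_def\<close>)
        moreover have "(\<lambda>n. k (fst (X n), r) * m r) \<longlonglongrightarrow> F p r"
          using True r unfolding F_def by (auto intro!: tendsto_intros kl)
        ultimately show ?thesis by (rule Lim_transform_eventually[rotated])
      next
        case False
        then have "snd p < r" using r by auto
        have "\<forall>\<^sub>F n in sequentially. snd (X n) < r" by (rule order_tendstoD(2)[OF s \<open>snd p < r\<close>])
        then have "\<forall>\<^sub>F n in sequentially. 0 = F (X n) r"
          by eventually_elim (auto simp: F_def)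
        from Lim_transform_eventually[OF tendsto_const this]
        have "(\<lambda>n. F (X n) r) \<longlonglongrightarrow> 0" .
        moreover have "F p r = 0" using \<open>snd p < r\<close> by (auto simp: F_def)
        ultimately show ?thesis by simp
      qed
    qed
  qed
  then have "(\<lambda>n. integral {0..1} (F (X n))) \<longlonglongrightarrow> integral {0..1} (F p)" unfolding spike .
  moreover have "X n \<in> {a..b} \<times> {0..1}" for n using X by blast
  ultimately show "((\<lambda>p. integral {0..snd p} (\<lambda>r. k (fst p, r) * m r)) \<circ> X) \<longlonglongrightarrow>
     integral {0..snd p} (\<lambda>r. k (fst p, r) * m r)"
    by (simp only: o_def Fint p)
qed

text \<open>A fixed point among bounded continuous functions of the pair (\<mu>, x), so joint
  continuity comes with the construction. The unknown is z times \<open>exp (- c * x)\<close>, a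
  weight that makes the map contracting on the whole interval at once.\<close>

lemma parametric_volterra:
  fixes A k :: "real \<times> real \<Rightarrow> real"
  assumes ab: "a \<le> b" and A: "continuous_on ({a..b} \<times> {0..1}) A" and k: "continuous_on ({a..b} \<times> {0..1}) k"
    and m: "m absolutely_integrable_on {0..1}"
  obtains z w where "continuous_on ({a..b} \<times> {0..1}) z" "continuous_on ({a..b} \<times> {0..1}) w"
    "\<And>\<mu> x. \<mu> \<in> {a..b} \<Longrightarrow> x \<in> {0..1} \<Longrightarrow> z (\<mu>, x) = integral {0..x} (\<lambda>s. A (\<mu>, s) * w (\<mu>, s))"
    "\<And>\<mu> x. \<mu> \<in> {a..b} \<Longrightarrow> x \<in> {0..1} \<Longrightarrow> w (\<mu>, x) = 1 - integral {0..x} (\<lambda>r. k (\<mu>, r) * z (\<mu>, r) * m r)"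
proof -
  define K where "K = {a..b} \<times> {0..1::real}"
  have Kcb: "K = cbox (a, 0) (b, 1)" unfolding K_def by (simp add: cbox_Pair_eq)
  have bdd: "\<exists>B>0. \<forall>q\<in>K. \<bar>f q\<bar> \<le> B" if "continuous_on K f" for f :: "real \<times> real \<Rightarrow> real"
  proof -
    have "compact (f ` K)" unfolding Kcb by (rule compact_continuous_image[OF that[unfolded Kcb] compact_cbox])
    then obtain B where "B > 0" "\<And>y. y \<in> f ` K \<Longrightarrow> norm y \<le> B"
      using compact_imp_bounded bounded_pos by metis
    then show ?thesis by (intro exI[of _ B]) auto
  qed
  obtain CA where CA: "CA > 0" "\<And>q. q \<in> K \<Longrightarrow> \<bar>A q\<bar> \<le> CA" using bdd[OF A[folded K_def]] by blast
  obtain Ck where Ck: "Ck > 0" "\<And>q. q \<in> K \<Longrightarrow> \<bar>k q\<bar> \<le> Ck" using bdd[OF k[folded K_def]] by blast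
  define Q where "Q = integral {0..1} (\<lambda>r. \<bar>m r\<bar>)"
  note mi = absolutely_integrable_Icc_subset(2)[OF set_integrable_abs[OF m]]
  have Q0: "Q \<ge> 0" unfolding Q_def using mi[of 0 1] by (intro Henstock_Kurzweil_Integration.integral_nonneg) auto
  \<comment> \<open>The contraction constant comes out as \<open>CA * Ck * Q / c\<close>, at most
    1/2 for this c; the summand 1 keeps c positive when Q = 0.\<close>
  define c where "c = 2 * CA * Ck * Q + 1"
  have c: "c > 0" unfolding c_def using CA(1) Ck(1) Q0 by (simp add: add_nonneg_pos)
  define inner where "inner \<zeta> p = integral {0..snd p} (\<lambda>r. (k (fst p, r) * (exp (c * r) * \<zeta> (fst p, r))) * m r)" for \<zeta> p
  define outer where "outer \<zeta> p = integral {0..snd p} (\<lambda>s. (A (fst p, s) * (1 - inner \<zeta> (fst p, s))) * 1)" for \<zeta> p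
  define \<Phi> where "\<Phi> \<zeta> p = exp (- c * snd p) * outer \<zeta> p" for \<zeta> p
  have ic: "continuous_on K (inner \<zeta>)" if "continuous_on K \<zeta>" for \<zeta>
    unfolding inner_def K_def
    using parametric_integral_continuous[of a b "\<lambda>p. k p * (exp (c * snd p) * \<zeta> p)" m] m k that
    by (simp add: K_def continuous_intros)
  have one: "(\<lambda>_. 1::real) absolutely_integrable_on {0..1::real}"
    by (rule absolutely_integrable_continuous_real) simp
  have oc: "continuous_on K (outer \<zeta>)" if "continuous_on K \<zeta>" for \<zeta>
    unfolding outer_def K_def
    using parametric_integral_continuous[of a b "\<lambda>p. A p * (1 - inner \<zeta> p)" "\<lambda>_. 1"] one A ic[OF that]
    by (simp add: K_def continuous_intros)
  have \<Phi>c: "continuous_on K (\<Phi> \<zeta>)" if "continuous_on K \<zeta>" for \<zeta>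
    unfolding \<Phi>_def by (intro continuous_intros oc that)
  have slice: "continuous_on {0..1} (\<lambda>r. f (\<mu>, r))" if "continuous_on K f" "\<mu> \<in> {a..b}" for f :: "real \<times> real \<Rightarrow> real" and \<mu>
    by (rule continuous_on_compose2[OF that(1)]) (use that(2) in \<open>auto simp: K_def intro!: continuous_intros\<close>)
  \<comment> \<open>Clamping to the rectangle turns a continuous function there into a bounded
    continuous one on the plane, an element of the complete space used.\<close>
  have "\<exists>g :: (real \<times> real) \<Rightarrow>\<^sub>C real. \<forall>p. g p = \<Phi> \<zeta> (clamp (a, 0) (b, 1) p)" for \<zeta> :: "(real \<times> real) \<Rightarrow>\<^sub>C real"
  proof -
    have "continuous_on (cbox (a, 0) (b, 1)) (\<Phi> \<zeta>)"
      using \<Phi>c[of \<zeta>] unfolding Kcb by simp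
    then obtain g :: "(real \<times> real) \<Rightarrow>\<^sub>C real" where "\<And>x. g x = \<Phi> \<zeta> (clamp (a, 0) (b, 1) x)"
      by (rule continuous_on_cbox_bcontfunE) blast
    then show ?thesis by blast
  qed
  then obtain \<Psi> :: "((real \<times> real) \<Rightarrow>\<^sub>C real) \<Rightarrow> ((real \<times> real) \<Rightarrow>\<^sub>C real)"
    where \<Psi>: "\<And>\<zeta> p. \<Psi> \<zeta> p = \<Phi> \<zeta> (clamp (a, 0) (b, 1) p)" by metis
  have contr: "dist (\<Psi> \<zeta>1) (\<Psi> \<zeta>2) \<le> 1 / 2 * dist \<zeta>1 \<zeta>2" for \<zeta>1 \<zeta>2
  proof (rule dist_bound)
    fix p0 :: "real \<times> real"
    define p where "p = clamp (a, 0) (b, 1) p0"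
    have pK: "p \<in> K" unfolding p_def Kcb by (rule clamp_in_interval) (use ab in \<open>auto simp: Basis_prod_def\<close>)
    obtain \<mu> x where px: "p = (\<mu>, x)" by (cases p)
    have \<mu>: "\<mu> \<in> {a..b}" and x: "x \<in> {0..1}" using pK unfolding px K_def by auto
    define D where "D = dist \<zeta>1 \<zeta>2"
    have D0: "D \<ge> 0" by (simp add: D_def)
    have D: "\<bar>\<zeta>1 q - \<zeta>2 q\<bar> \<le> D" for q using dist_bounded[of \<zeta>1 q \<zeta>2] by (simp add: D_def dist_real_def)
    have \<zeta>c: "continuous_on K (apply_bcontfun \<zeta>)" for \<zeta> :: "(real \<times> real) \<Rightarrow>\<^sub>C real" by simp
    have inn_int: "(\<lambda>r. (k (\<mu>, r) * (exp (c * r) * \<zeta> (\<mu>, r))) * m r) integrable_on {0..s}"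
      if "s \<in> {0..1}" for s and \<zeta> :: "(real \<times> real) \<Rightarrow>\<^sub>C real"
    proof -
      have "continuous_on {0..1} (\<lambda>r. k (\<mu>, r) * (exp (c * r) * \<zeta> (\<mu>, r)))"
        by (intro continuous_intros slice[OF k[folded K_def] \<mu>] slice[OF \<zeta>c \<mu>])
      from absolutely_integrable_Icc_subset(2)[OF absolutely_integrable_continuous_mult[OF this m]]
      show ?thesis using that by auto
    qed
    \<comment> \<open>The inner integral merely reproduces the weight \<open>exp (c * s)\<close>;
      the gain 1 / c comes from integrating that weight in the outer integral.\<close>
    have inn: "\<bar>inner \<zeta>1 (\<mu>, s) - inner \<zeta>2 (\<mu>, s)\<bar> \<le> Ck * D * Q * exp (c * s)" if s: "s \<in> {0..1}" for s
    proof -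
      have eq: "inner \<zeta>1 (\<mu>, s) - inner \<zeta>2 (\<mu>, s) = integral {0..s} (\<lambda>r. (k (\<mu>, r) * (exp (c * r) * \<zeta>1 (\<mu>, r))) * m r
          - (k (\<mu>, r) * (exp (c * r) * \<zeta>2 (\<mu>, r))) * m r)"
        unfolding inner_def fst_conv snd_conv
        by (rule Henstock_Kurzweil_Integration.integral_diff[OF inn_int[OF s] inn_int[OF s], symmetric])
      have "norm (inner \<zeta>1 (\<mu>, s) - inner \<zeta>2 (\<mu>, s)) \<le> integral {0..s} (\<lambda>r. (Ck * D * exp (c * s)) * \<bar>m r\<bar>)"
        unfolding eq
      proof (rule integral_norm_bound_integral)
        show "(\<lambda>r. (k (\<mu>, r) * (exp (c * r) * \<zeta>1 (\<mu>, r))) * m r - (k (\<mu>, r) * (exp (c * r) * \<zeta>2 (\<mu>, r))) * m r) integrable_on {0..s}"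
          by (rule integrable_diff[OF inn_int[OF s] inn_int[OF s]])
        show "(\<lambda>r. (Ck * D * exp (c * s)) * \<bar>m r\<bar>) integrable_on {0..s}"
          by (rule integrable_on_mult_right[OF mi]) (use s in auto)
        fix r assume r: "r \<in> {0..s}"
        have kr: "\<bar>k (\<mu>, r)\<bar> \<le> Ck" by (rule Ck(2)) (use r s \<mu> in \<open>auto simp: K_def\<close>)
        have er: "exp (c * r) \<le> exp (c * s)" using r c by simp
        have "norm ((k (\<mu>, r) * (exp (c * r) * \<zeta>1 (\<mu>, r))) * m r - (k (\<mu>, r) * (exp (c * r) * \<zeta>2 (\<mu>, r))) * m r)
          = (\<bar>k (\<mu>, r)\<bar> * \<bar>\<zeta>1 (\<mu>, r) - \<zeta>2 (\<mu>, r)\<bar>) * exp (c * r) * \<bar>m r\<bar>"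
          by (simp add: abs_mult flip: left_diff_distrib right_diff_distrib)
        also have "\<dots> \<le> (Ck * D) * exp (c * s) * \<bar>m r\<bar>"
          using Ck(1) D0 by (intro mult_right_mono mult_mono kr D er) auto
        finally show "norm ((k (\<mu>, r) * (exp (c * r) * \<zeta>1 (\<mu>, r))) * m r - (k (\<mu>, r) * (exp (c * r) * \<zeta>2 (\<mu>, r))) * m r)
          \<le> (Ck * D * exp (c * s)) * \<bar>m r\<bar>" .
      qed
      also have "\<dots> = (Ck * D * exp (c * s)) * integral {0..s} (\<lambda>r. \<bar>m r\<bar>)"
        by (rule Henstock_Kurzweil_Integration.integral_mult_right)
      also have "\<dots> \<le> (Ck * D * exp (c * s)) * Q"
        unfolding Q_def using Ck(1) D0 s mi[of 0 s] mi[of 0 1] by (intro mult_left_mono integral_subset_le) auto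
      finally show ?thesis by (simp only: real_norm_def mult_ac)
    qed
    have out_int: "(\<lambda>s. (A (\<mu>, s) * (1 - inner \<zeta> (\<mu>, s))) * 1) integrable_on {0..x}" for \<zeta> :: "(real \<times> real) \<Rightarrow>\<^sub>C real"
    proof (rule integrable_continuous_real)
      have "continuous_on {0..1} (\<lambda>s. (A (\<mu>, s) * (1 - inner \<zeta> (\<mu>, s))) * 1)"
        by (intro continuous_intros slice[OF A[folded K_def] \<mu>] slice[OF ic[OF \<zeta>c] \<mu>])
      then show "continuous_on {0..x} (\<lambda>s. (A (\<mu>, s) * (1 - inner \<zeta> (\<mu>, s))) * 1)"
        by (rule continuous_on_subset) (use x in auto)
    qed
    have expi: "((\<lambda>s. exp (c * s)) has_integral (exp (c * x) / c - exp (c * 0) / c)) {0..x}"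
      using x c by (intro fundamental_theorem_of_calculus)
        (auto intro!: derivative_eq_intros simp flip: has_real_derivative_iff_has_vector_derivative)
    have eq: "outer \<zeta>1 p - outer \<zeta>2 p = integral {0..x} (\<lambda>s. (A (\<mu>, s) * (1 - inner \<zeta>1 (\<mu>, s))) * 1
        - (A (\<mu>, s) * (1 - inner \<zeta>2 (\<mu>, s))) * 1)"
      unfolding outer_def px fst_conv snd_conv
      by (rule Henstock_Kurzweil_Integration.integral_diff[OF out_int out_int, symmetric])
    have "norm (outer \<zeta>1 p - outer \<zeta>2 p) \<le> integral {0..x} (\<lambda>s. (CA * (Ck * D * Q)) * exp (c * s))"
      unfolding eq
    proof (rule integral_norm_bound_integral)
      show "(\<lambda>s. (A (\<mu>, s) * (1 - inner \<zeta>1 (\<mu>, s))) * 1 - (A (\<mu>, s) * (1 - inner \<zeta>2 (\<mu>, s))) * 1) integrable_on {0..x}"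
        by (rule integrable_diff[OF out_int out_int])
      show "(\<lambda>s. (CA * (Ck * D * Q)) * exp (c * s)) integrable_on {0..x}"
        by (rule integrable_on_mult_right) (use expi in \<open>auto simp: integrable_on_def\<close>)
      fix s assume "s \<in> {0..x}"
      then have s: "s \<in> {0..1}" using x by auto
      have As: "\<bar>A (\<mu>, s)\<bar> \<le> CA" by (rule CA(2)) (use s \<mu> in \<open>auto simp: K_def\<close>)
      have "norm ((A (\<mu>, s) * (1 - inner \<zeta>1 (\<mu>, s))) * 1 - (A (\<mu>, s) * (1 - inner \<zeta>2 (\<mu>, s))) * 1)
        = \<bar>A (\<mu>, s)\<bar> * \<bar>inner \<zeta>1 (\<mu>, s) - inner \<zeta>2 (\<mu>, s)\<bar>"
      proof -
        have "(A (\<mu>, s) * (1 - inner \<zeta>1 (\<mu>, s))) * 1 - (A (\<mu>, s) * (1 - inner \<zeta>2 (\<mu>, s))) * 1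
          = - (A (\<mu>, s) * (inner \<zeta>1 (\<mu>, s) - inner \<zeta>2 (\<mu>, s)))" by (simp add: algebra_simps)
        then show ?thesis by (simp only: norm_minus_cancel real_norm_def abs_minus_cancel abs_mult)
      qed
      also have "\<dots> \<le> CA * (Ck * D * Q * exp (c * s))"
        using CA(1) by (intro mult_mono As inn s) auto
      finally show "norm ((A (\<mu>, s) * (1 - inner \<zeta>1 (\<mu>, s))) * 1 - (A (\<mu>, s) * (1 - inner \<zeta>2 (\<mu>, s))) * 1)
        \<le> (CA * (Ck * D * Q)) * exp (c * s)" by (simp only: mult.assoc)
    qed
    also have "\<dots> = (CA * (Ck * D * Q)) * (exp (c * x) / c - exp (c * 0) / c)"
      by (simp only: Henstock_Kurzweil_Integration.integral_mult_right integral_unique[OF expi])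
    also have "\<dots> \<le> (CA * (Ck * D * Q)) * (exp (c * x) / c)"
      using CA(1) Ck(1) D0 Q0 c by (intro mult_left_mono) auto
    finally have o: "\<bar>outer \<zeta>1 p - outer \<zeta>2 p\<bar> \<le> (CA * (Ck * D * Q)) * (exp (c * x) / c)" by simp
    have "dist (\<Psi> \<zeta>1 p0) (\<Psi> \<zeta>2 p0) = \<bar>exp (- c * x) * outer \<zeta>1 p - exp (- c * x) * outer \<zeta>2 p\<bar>"
      unfolding \<Psi> p_def[symmetric] \<Phi>_def dist_real_def by (simp add: px)
    also have "\<dots> = exp (- c * x) * \<bar>outer \<zeta>1 p - outer \<zeta>2 p\<bar>"
      by (simp add: abs_mult flip: right_diff_distrib)
    also have "\<dots> \<le> exp (- c * x) * ((CA * (Ck * D * Q)) * (exp (c * x) / c))"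
      by (rule mult_left_mono[OF o]) simp
    also have "\<dots> = (CA * Ck * Q / c) * D" by (simp add: exp_minus field_simps)
    also have "\<dots> \<le> 1 / 2 * D"
      using c by (intro mult_right_mono D0) (simp add: c_def field_simps)
    finally show "dist (\<Psi> \<zeta>1 p0) (\<Psi> \<zeta>2 p0) \<le> 1 / 2 * dist \<zeta>1 \<zeta>2" unfolding D_def .
  qed
  have "\<exists>!\<zeta>. \<Psi> \<zeta> = \<zeta>" by (rule banach_fix_type[of "1/2"]) (use contr in auto)
  then obtain \<zeta> where \<zeta>: "\<Psi> \<zeta> = \<zeta>" by blast
  have \<zeta>K: "\<zeta> p = \<Phi> \<zeta> p" if "p \<in> K" for p
    using \<Psi>[of \<zeta> p] that unfolding \<zeta> Kcb by simp
  \<comment> \<open>The weight is removed again.\<close>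
  define z where "z p = exp (c * snd p) * \<zeta> p" for p
  define w where "w p = 1 - inner \<zeta> p" for p
  have \<zeta>c: "continuous_on K (apply_bcontfun \<zeta>)" by simp
  show ?thesis
  proof (rule that)
    show "continuous_on ({a..b} \<times> {0..1}) z" unfolding z_def by (intro continuous_intros) auto
    show "continuous_on ({a..b} \<times> {0..1}) w" unfolding w_def K_def[symmetric] by (intro continuous_intros ic \<zeta>c)
    fix \<mu> x :: real assume \<mu>: "\<mu> \<in> {a..b}" and x: "x \<in> {0..1}"
    then have "(\<mu>, x) \<in> K" by (simp add: K_def)
    then have "z (\<mu>, x) = outer \<zeta> (\<mu>, x)"
      unfolding z_def using \<zeta>K[of "(\<mu>, x)"] by (simp add: \<Phi>_def exp_minus)
    then show "z (\<mu>, x) = integral {0..x} (\<lambda>s. A (\<mu>, s) * w (\<mu>, s))"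
      by (simp add: outer_def w_def)
    show "w (\<mu>, x) = 1 - integral {0..x} (\<lambda>r. k (\<mu>, r) * z (\<mu>, r) * m r)"
      by (simp add: w_def inner_def z_def mult.assoc)
  qed
qed

section \<open>The differential equation of the pencil\<close>

text \<open>The substitution \<open>y = exp (- \<mu> \<integral>P) z\<close> turns the equation \<open>- y'' - \<mu> P' y = 0\<close>, written as the system
  \<open>y' = v - \<mu> P y\<close>, \<open>v' = \<mu> P y'\<close>, into \<open>z' = exp (2 \<mu> \<integral>P) w\<close>, \<open>w' = - \<mu>\<^sup>2 P\<^sup>2 exp (- 2 \<mu> \<integral>P) z\<close>,
  whose first component is continuously differentiable.\<close>

definition primitive :: "(real \<Rightarrow> real) \<Rightarrow> real \<Rightarrow> real" where
  "primitive P x = integral {0..x} P"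

text \<open>Two views of one solution: the C1 function z has the same zeros as y, and they are
  simple since z and w never vanish together; the pair of y and the quasi-derivative
  \<open>v = y' + \<mu> P y\<close> obeys the system used in integration by parts.\<close>

definition pencil_ode :: "(real \<Rightarrow> real) \<Rightarrow> real \<Rightarrow> (real \<Rightarrow> real) \<Rightarrow> (real \<Rightarrow> real) \<Rightarrow> bool" where
  "pencil_ode P \<mu> z w \<longleftrightarrow> z 0 = 0 \<and> (\<forall>x\<in>{0..1}. z x = 0 \<longrightarrow> w x \<noteq> 0) \<and>
    (\<forall>x\<in>{0..1}. (z has_real_derivative exp (2 * (\<mu> * primitive P x)) * w x) (at x within {0..1})) \<and>
    (let y = (\<lambda>x. exp (- (\<mu> * primitive P x)) * z x); v = (\<lambda>x. exp (\<mu> * primitive P x) * w x) in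
      ac 0 1 y (\<lambda>x. v x - \<mu> * P x * y x) \<and> ac 0 1 v (\<lambda>x. \<mu> * P x * (v x - \<mu> * P x * y x)))"

lemma ac_primitive: "P absolutely_integrable_on {0..1} \<Longrightarrow> ac 0 1 (primitive P) P"
  by (rule acI[where c=0]) (auto simp: primitive_def)

lemma ac_nonneg_mono:
  assumes "ac a b F f" "AE x in lebesgue. x \<in> {a..b} \<longrightarrow> f x \<ge> 0" "a \<le> s" "s \<le> t" "t \<le> b"
  shows "F s \<le> F t"
proof -
  obtain M where M: "\<And>x. x \<in> space lebesgue - M \<Longrightarrow> x \<in> {a..b} \<longrightarrow> f x \<ge> 0" "M \<in> null_sets lebesgue"
    by (rule AE_E3[OF assms(2)]) (rule that)
  have "integral {s..t} f \<ge> 0"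
  proof -
    have "integral {s..t} f = integral {s..t} (\<lambda>x. if x \<in> M then 0 else f x)"
      by (rule integral_spike[of M]) (use M(2) in \<open>auto simp: negligible_iff_null_sets\<close>)
    also have "\<dots> \<ge> 0"
    proof (rule Henstock_Kurzweil_Integration.integral_nonneg)
      show "(\<lambda>x. if x \<in> M then 0 else f x) integrable_on {s..t}"
        by (rule integrable_spike[OF acD(3)[OF assms(1,3-5)], of M])
          (use M(2) in \<open>auto simp: negligible_iff_null_sets\<close>)
      show "0 \<le> (if x \<in> M then 0 else f x)" if "x \<in> {s..t}" for x
        using M(1)[of x] that assms by auto
    qed
    finally show ?thesis .
  qed
  then show ?thesis using acD(2)[OF assms(1,3-5)] by simp
qed

text \<open>The system for z and w has coefficients that are jointly continuous in \<mu> and x, up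
  to the integrable factor \<open>(P x)^2\<close>; this is the shape that
  \<open>parametric_volterra\<close> solves.\<close>

lemma pencil_ode_exists:
  assumes P: "P \<in> L2" and M: "M \<ge> 0"
  obtains z w where "continuous_on ({0..M} \<times> {0..1}) z" "continuous_on ({0..M} \<times> {0..1}) w"
    "\<And>\<mu>. \<mu> \<in> {0..M} \<Longrightarrow> pencil_ode P \<mu> (\<lambda>x. z (\<mu>, x)) (\<lambda>x. w (\<mu>, x))"
proof -
  have Pi: "P absolutely_integrable_on {0..1}" by (rule L2_absolutely_integrable[OF P])
  have P2: "(\<lambda>x. (P x)\<^sup>2) absolutely_integrable_on {0..1}" using L2_square[OF P] by simp
  note W = ac_primitive[OF Pi] and Wc = ac_continuous_on[OF ac_primitive[OF Pi]]
  define A where "A q = exp (2 * (fst q * primitive P (snd q)))" for q :: "real \<times> real"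
  define k where "k q = (fst q)\<^sup>2 * exp (- (2 * (fst q * primitive P (snd q))))" for q :: "real \<times> real"
  have Wc': "continuous_on ({0..M} \<times> {0..1}) (\<lambda>q. primitive P (snd q))"
    by (rule continuous_on_compose2[OF Wc]) (auto intro!: continuous_intros)
  have Ac: "continuous_on ({0..M} \<times> {0..1}) A" unfolding A_def by (intro continuous_intros Wc')
  have kc: "continuous_on ({0..M} \<times> {0..1}) k" unfolding k_def by (intro continuous_intros Wc')
  obtain z w where z: "continuous_on ({0..M} \<times> {0..1}) z" and w: "continuous_on ({0..M} \<times> {0..1}) w"
    and zi: "\<And>\<mu> x. \<mu> \<in> {0..M} \<Longrightarrow> x \<in> {0..1} \<Longrightarrow> z (\<mu>, x) = integral {0..x} (\<lambda>s. A (\<mu>, s) * w (\<mu>, s))"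
    and wi: "\<And>\<mu> x. \<mu> \<in> {0..M} \<Longrightarrow> x \<in> {0..1} \<Longrightarrow>
        w (\<mu>, x) = 1 - integral {0..x} (\<lambda>r. k (\<mu>, r) * z (\<mu>, r) * (P r)\<^sup>2)"
    using parametric_volterra[OF M Ac kc P2] by blast
  have ode: "pencil_ode P \<mu> (\<lambda>x. z (\<mu>, x)) (\<lambda>x. w (\<mu>, x))" if \<mu>: "\<mu> \<in> {0..M}" for \<mu>
  proof -
    have slice: "continuous_on {0..1} (\<lambda>r. f (\<mu>, r))" if "continuous_on ({0..M} \<times> {0..1}) f" for f :: "real \<times> real \<Rightarrow> real"
      by (rule continuous_on_compose2[OF that]) (use \<mu> in \<open>auto intro!: continuous_intros\<close>)
    note zc = slice[OF z] and wc = slice[OF w] and Ac' = slice[OF Ac] and kc' = slice[OF kc]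
    have Awc: "continuous_on {0..1} (\<lambda>x. A (\<mu>, x) * w (\<mu>, x))" by (intro continuous_intros Ac' wc)
    have zac: "ac 0 1 (\<lambda>x. z (\<mu>, x)) (\<lambda>x. A (\<mu>, x) * w (\<mu>, x))"
      by (rule acI[where c=0, OF absolutely_integrable_continuous_real[OF Awc]]) (use zi[OF \<mu>] in auto)
    have kzm: "(\<lambda>x. k (\<mu>, x) * z (\<mu>, x) * (P x)\<^sup>2) absolutely_integrable_on {0..1}"
      by (rule absolutely_integrable_continuous_mult[OF _ P2]) (intro continuous_intros kc' zc)
    have "ac 0 1 (\<lambda>x. integral {0..x} (\<lambda>r. k (\<mu>, r) * z (\<mu>, r) * (P r)\<^sup>2)) (\<lambda>x. k (\<mu>, x) * z (\<mu>, x) * (P x)\<^sup>2)"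
      by (rule acI[where c=0, OF kzm]) simp
    from ac_add[OF ac_const[of 0 1 1] ac_cmult[OF this, of "-1"]]
    have wac: "ac 0 1 (\<lambda>x. w (\<mu>, x)) (\<lambda>x. - (k (\<mu>, x) * z (\<mu>, x) * (P x)\<^sup>2))"
      by (rule ac_cong) (use wi[OF \<mu>] in auto)
    have z0: "z (\<mu>, 0) = 0" and w0: "w (\<mu>, 0) = 1" using zi[OF \<mu>, of 0] wi[OF \<mu>, of 0] by simp_all
    have zder: "((\<lambda>x. z (\<mu>, x)) has_real_derivative A (\<mu>, x) * w (\<mu>, x)) (at x within {0..1})" if x: "x \<in> {0..1}" for x
    proof (rule has_field_derivative_transform_within[OF _ zero_less_one x])
      show "((\<lambda>x. integral {0..x} (\<lambda>s. A (\<mu>, s) * w (\<mu>, s))) has_real_derivative A (\<mu>, x) * w (\<mu>, x)) (at x within {0..1})"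
        by (rule integral_has_real_derivative[OF Awc x])
      show "integral {0..t} (\<lambda>s. A (\<mu>, s) * w (\<mu>, s)) = z (\<mu>, t)" if "t \<in> {0..1}" for t
        by (rule zi[OF \<mu> that, symmetric])
    qed
    \<comment> \<open>Gronwall: with \<open>b = A + k * P^2\<close> the function
      \<open>(z^2 + w^2) * exp (primitive b x)\<close> has as derivative a sum of squares with
      nonnegative weights, so it cannot fall from 1 at x = 0 to 0.\<close>
    have nondeg: "w (\<mu>, x) \<noteq> 0" if x: "x \<in> {0..1}" "z (\<mu>, x) = 0" for x
    proof
      assume wx: "w (\<mu>, x) = 0"
      define b where "b x = A (\<mu>, x) + k (\<mu>, x) * (P x)\<^sup>2" for x
      have bi: "b absolutely_integrable_on {0..1}" unfolding b_def
        by (intro set_integral_add(1) absolutely_integrable_continuous_mult kc' P2 absolutely_integrable_continuous_real Ac')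
      have B: "ac 0 1 (primitive b) b" by (rule ac_primitive[OF bi])
      have eB: "ac 0 1 (\<lambda>x. exp (primitive b x)) (\<lambda>x. exp (primitive b x) * b x)"
        by (rule ac_chain[OF B]) (auto intro!: derivative_eq_intros continuous_intros)
      note N = ac_add[OF ac_mult[OF zac zac] ac_mult[OF wac wac]]
      have "(z (\<mu>, 0) * z (\<mu>, 0) + w (\<mu>, 0) * w (\<mu>, 0)) * exp (primitive b 0)
        \<le> (z (\<mu>, x) * z (\<mu>, x) + w (\<mu>, x) * w (\<mu>, x)) * exp (primitive b x)"
      proof (rule ac_nonneg_mono[OF ac_mult[OF N eB]])
        have "(A (\<mu>, x) * w (\<mu>, x) * z (\<mu>, x) + z (\<mu>, x) * (A (\<mu>, x) * w (\<mu>, x)) +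
              (- (k (\<mu>, x) * z (\<mu>, x) * (P x)\<^sup>2) * w (\<mu>, x) + w (\<mu>, x) * - (k (\<mu>, x) * z (\<mu>, x) * (P x)\<^sup>2))) *
             exp (primitive b x) +
             (z (\<mu>, x) * z (\<mu>, x) + w (\<mu>, x) * w (\<mu>, x)) * (exp (primitive b x) * b x)
           = exp (primitive b x) * (A (\<mu>, x) * (z (\<mu>, x) + w (\<mu>, x))\<^sup>2 + k (\<mu>, x) * (P x)\<^sup>2 * (z (\<mu>, x) - w (\<mu>, x))\<^sup>2)" for x
          by (simp add: b_def algebra_simps power2_eq_square)
        moreover have "\<dots> x \<ge> 0" for x unfolding A_def k_def by simp
        ultimately show "AE x in lebesgue. x \<in> {0..1} \<longrightarrow>
            0 \<le> (A (\<mu>, x) * w (\<mu>, x) * z (\<mu>, x) + z (\<mu>, x) * (A (\<mu>, x) * w (\<mu>, x)) +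
              (- (k (\<mu>, x) * z (\<mu>, x) * (P x)\<^sup>2) * w (\<mu>, x) + w (\<mu>, x) * - (k (\<mu>, x) * z (\<mu>, x) * (P x)\<^sup>2))) *
             exp (primitive b x) +
             (z (\<mu>, x) * z (\<mu>, x) + w (\<mu>, x) * w (\<mu>, x)) * (exp (primitive b x) * b x)" by simp
      qed (use x in auto)
      then show False using x(2) wx z0 w0 by (simp add: primitive_def)
    qed
    have eW: "ac 0 1 (\<lambda>x. exp (c * primitive P x)) (\<lambda>x. exp (c * primitive P x) * (c * P x))" for c
      by (rule ac_chain[OF ac_cmult[OF W, of c]]) (auto intro!: derivative_eq_intros continuous_intros)
    have yac: "ac 0 1 (\<lambda>x. exp (- (\<mu> * primitive P x)) * z (\<mu>, x))
       (\<lambda>x. exp (\<mu> * primitive P x) * w (\<mu>, x) - \<mu> * P x * (exp (- (\<mu> * primitive P x)) * z (\<mu>, x)))"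
    proof (rule ac_cong[OF ac_mult[OF eW[of "- \<mu>"] zac]])
      fix x
      have "exp (- (\<mu> * primitive P x)) * A (\<mu>, x) = exp (\<mu> * primitive P x)"
        unfolding A_def by (simp flip: exp_add)
      then show "exp (- \<mu> * primitive P x) * (- \<mu> * P x) * z (\<mu>, x) + exp (- \<mu> * primitive P x) * (A (\<mu>, x) * w (\<mu>, x))
        = exp (\<mu> * primitive P x) * w (\<mu>, x) - \<mu> * P x * (exp (- (\<mu> * primitive P x)) * z (\<mu>, x))"
        by (simp add: mult.assoc[symmetric])
    qed simp
    have vac: "ac 0 1 (\<lambda>x. exp (\<mu> * primitive P x) * w (\<mu>, x))
       (\<lambda>x. \<mu> * P x * (exp (\<mu> * primitive P x) * w (\<mu>, x) - \<mu> * P x * (exp (- (\<mu> * primitive P x)) * z (\<mu>, x))))"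
    proof (rule ac_cong[OF ac_mult[OF eW[of \<mu>] wac]])
      fix x
      have "exp (\<mu> * primitive P x) * k (\<mu>, x) = \<mu>\<^sup>2 * exp (- (\<mu> * primitive P x))"
        unfolding k_def by (simp add: mult.left_commute flip: exp_add)
      then have "exp (\<mu> * primitive P x) * (k (\<mu>, x) * z (\<mu>, x) * (P x)\<^sup>2)
        = \<mu>\<^sup>2 * exp (- (\<mu> * primitive P x)) * (z (\<mu>, x) * (P x)\<^sup>2)"
        by (simp only: mult.assoc[symmetric])
      then show "exp (\<mu> * primitive P x) * (\<mu> * P x) * w (\<mu>, x) + exp (\<mu> * primitive P x) * - (k (\<mu>, x) * z (\<mu>, x) * (P x)\<^sup>2)
        = \<mu> * P x * (exp (\<mu> * primitive P x) * w (\<mu>, x) - \<mu> * P x * (exp (- (\<mu> * primitive P x)) * z (\<mu>, x)))"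
        by (simp only: mult_minus_right) (simp add: algebra_simps power2_eq_square)
    qed simp
    show ?thesis unfolding pencil_ode_def Let_def
      using z0 nondeg zder[unfolded A_def fst_conv snd_conv] yac vac by blast
  qed
  show ?thesis by (rule that[OF z w ode])
qed

section \<open>Zeros of a family of solutions\<close>

lemma within_nonzero_nbhd:
  fixes f :: "real \<times> real \<Rightarrow> real"
  assumes f: "continuous_on (S \<times> T) f" and p: "(\<mu>, x) \<in> S \<times> T" and nz: "f (\<mu>, x) \<noteq> 0"
  shows "\<exists>e>0. \<forall>\<mu>'\<in>S. \<forall>x'\<in>T. \<bar>\<mu>' - \<mu>\<bar> < e \<longrightarrow> \<bar>x' - x\<bar> < e \<longrightarrow> f (\<mu>', x') * f (\<mu>, x) > 0"
proof -
  obtain d where d: "d > 0" "\<And>q. q \<in> S \<times> T \<Longrightarrow> dist q (\<mu>, x) < d \<Longrightarrow> dist (f q) (f (\<mu>, x)) < \<bar>f (\<mu>, x)\<bar>"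
    using f[unfolded continuous_on_iff, rule_format, OF p, of "\<bar>f (\<mu>, x)\<bar>"] nz by auto
  have "f (\<mu>', x') * f (\<mu>, x) > 0" if "\<mu>' \<in> S" "x' \<in> T" "\<bar>\<mu>' - \<mu>\<bar> < d / 2" "\<bar>x' - x\<bar> < d / 2" for \<mu>' x'
  proof -
    have "dist (\<mu>', x') (\<mu>, x) \<le> \<bar>\<mu>' - \<mu>\<bar> + \<bar>x' - x\<bar>"
      unfolding dist_Pair_Pair dist_real_def by (simp add: sqrt_sum_squares_le_sum_abs)
    also have "\<dots> < d" using that by linarith
    finally have "\<bar>f (\<mu>', x') - f (\<mu>, x)\<bar> < \<bar>f (\<mu>, x)\<bar>" using d(2)[of "(\<mu>', x')"] that unfolding dist_real_def by blast
    then show ?thesis by (cases "f (\<mu>, x) > 0") (auto simp: zero_less_mult_iff abs_if split: if_splits)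
  qed
  then show ?thesis using d(1) by (intro exI[of _ "d / 2"]) auto
qed

text \<open>Only what makes zeros simple is retained: the derivative of z is a positive function
  times w, and w is nonzero at the zeros of z.\<close>

locale zero_count =
  fixes z w A :: "real \<times> real \<Rightarrow> real" and M :: real
  assumes zc: "continuous_on ({0..M} \<times> {0..1}) z" and wc: "continuous_on ({0..M} \<times> {0..1}) w"
    and der: "\<And>\<mu> x. \<mu> \<in> {0..M} \<Longrightarrow> x \<in> {0..1} \<Longrightarrow>
      ((\<lambda>x. z (\<mu>, x)) has_real_derivative A (\<mu>, x) * w (\<mu>, x)) (at x within {0..1})"
    and A: "\<And>q. A q > 0"
    and nondeg: "\<And>\<mu> x. \<mu> \<in> {0..M} \<Longrightarrow> x \<in> {0..1} \<Longrightarrow> z (\<mu>, x) = 0 \<Longrightarrow> w (\<mu>, x) \<noteq> 0"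
begin

definition zeros :: "real \<Rightarrow> real set" where
  "zeros \<mu> = {x \<in> {0..1}. z (\<mu>, x) = 0}"

text \<open>By compactness finitely many balls cover [0,1] such that, for \<mu> near l, z or w has
  no zero in the ball. By Rolle a ball of the second kind holds at most one zero of z, so sending a
  zero to the centre of its ball is injective, and that centre is a zero for l.\<close>

lemma zeros_nearby_inj:
  assumes l: "l \<in> {0..M}"
  shows "\<exists>X \<delta>. finite X \<and> \<delta> > 0 \<and> (\<forall>\<mu>\<in>{0..M}. \<bar>\<mu> - l\<bar> < \<delta> \<longrightarrow>
    (\<exists>f. inj_on f (zeros \<mu>) \<and> f ` zeros \<mu> \<subseteq> X \<inter> zeros l))"
proof -
  have "\<exists>e>0. \<forall>\<mu>'\<in>{0..M}. \<forall>x'\<in>{0..1}. \<bar>\<mu>' - l\<bar> < e \<longrightarrow> \<bar>x' - x\<bar> < e \<longrightarrow>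
      (if z (l, x) \<noteq> 0 then z (\<mu>', x') \<noteq> 0 else w (\<mu>', x') \<noteq> 0)" if x: "x \<in> {0..1}" for x
  proof (cases "z (l, x) = 0")
    case True
    from within_nonzero_nbhd[OF wc _ nondeg[OF l x True]] l x
    obtain e where "e > 0" "\<forall>\<mu>'\<in>{0..M}. \<forall>x'\<in>{0..1}. \<bar>\<mu>' - l\<bar> < e \<longrightarrow> \<bar>x' - x\<bar> < e \<longrightarrow> w (\<mu>', x') * w (l, x) > 0"
      by auto
    then show ?thesis using True by (intro exI[of _ e]) (auto, fastforce)
  next
    case False
    from within_nonzero_nbhd[OF zc _ False] l x
    obtain e where "e > 0" "\<forall>\<mu>'\<in>{0..M}. \<forall>x'\<in>{0..1}. \<bar>\<mu>' - l\<bar> < e \<longrightarrow> \<bar>x' - x\<bar> < e \<longrightarrow> z (\<mu>', x') * z (l, x) > 0"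
      by auto
    then show ?thesis using False by (intro exI[of _ e]) (auto, fastforce)
  qed
  then obtain e where e0: "\<And>x. x \<in> {0..1} \<Longrightarrow> e x > 0" and e: "\<And>x \<mu>' x'. x \<in> {0..1} \<Longrightarrow> \<mu>' \<in> {0..M} \<Longrightarrow> x' \<in> {0..1} \<Longrightarrow>
      \<bar>\<mu>' - l\<bar> < e x \<Longrightarrow> \<bar>x' - x\<bar> < e x \<Longrightarrow> (if z (l, x) \<noteq> 0 then z (\<mu>', x') \<noteq> 0 else w (\<mu>', x') \<noteq> 0)"
    by metis
  have "{0..1} \<subseteq> (\<Union>x\<in>{0..1}. ball x (e x))" using e0 by (auto intro!: bexI centre_in_ball[THEN iffD2])
  then obtain X where X: "X \<subseteq> {0..1}" "finite X" "{0..1} \<subseteq> (\<Union>x\<in>X. ball x (e x))"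
    using compactE_image[of "{0..1::real}" "{0..1}" "\<lambda>x. ball x (e x)"] by auto
  have Xne: "X \<noteq> {}" using X(3) by force
  define \<delta> where "\<delta> = Min (e ` X)"
  have \<delta>: "\<delta> > 0" "\<And>x. x \<in> X \<Longrightarrow> \<delta> \<le> e x"
    unfolding \<delta>_def using X e0 Xne by (auto simp: Min_gr_iff)
  have "\<exists>f. inj_on f (zeros \<mu>) \<and> f ` zeros \<mu> \<subseteq> X \<inter> zeros l" if \<mu>: "\<mu> \<in> {0..M}" "\<bar>\<mu> - l\<bar> < \<delta>" for \<mu>
  proof -
    have "\<exists>c\<in>X. \<bar>x - c\<bar> < e c" if "x \<in> zeros \<mu>" for x
      using X(3) that unfolding zeros_def by (fastforce simp: dist_real_def abs_minus_commute)
    then obtain f where f: "\<And>x. x \<in> zeros \<mu> \<Longrightarrow> f x \<in> X" "\<And>x. x \<in> zeros \<mu> \<Longrightarrow> \<bar>x - f x\<bar> < e (f x)" by metis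
    have near: "if z (l, c) \<noteq> 0 then z (\<mu>, x) \<noteq> 0 else w (\<mu>, x) \<noteq> 0"
      if "c \<in> X" "x \<in> {0..1}" "\<bar>x - c\<bar> < e c" for c x
    proof -
      have "\<bar>\<mu> - l\<bar> < e c" using \<mu>(2) \<delta>(2)[OF that(1)] by linarith
      moreover have "c \<in> {0..1}" using that(1) X(1) by blast
      ultimately show ?thesis using e that \<mu>(1) by blast
    qed
    have fz: "f x \<in> zeros l" if x: "x \<in> zeros \<mu>" for x
      using near[OF f(1)[OF x] _ f(2)[OF x]] x X(1) f(1)[OF x] unfolding zeros_def by (auto split: if_splits)
    have no: False if x: "x1 \<in> zeros \<mu>" "x2 \<in> zeros \<mu>" "x1 < x2" "f x1 = f x2" for x1 x2
    proof -
      have x01: "x1 \<in> {0..1}" "x2 \<in> {0..1}" "z (\<mu>, x1) = 0" "z (\<mu>, x2) = 0" using x by (auto simp: zeros_def)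
      have d: "((\<lambda>x. z (\<mu>, x)) has_real_derivative A (\<mu>, \<xi>) * w (\<mu>, \<xi>)) (at \<xi>)" if "x1 < \<xi>" "\<xi> < x2" for \<xi>
      proof -
        have "\<xi> \<in> interior {0..1}" using that x01 by simp
        then have "at \<xi> within {0..1} = at \<xi>" by (rule at_within_interior)
        then show ?thesis using der[OF \<mu>(1), of \<xi>] that x01 by simp
      qed
      have "continuous_on {x1..x2} (\<lambda>x. z (\<mu>, x))"
        by (rule continuous_on_compose2[OF zc]) (use \<mu> x01 in \<open>auto intro!: continuous_intros\<close>)
      from Rolle_deriv[OF x(3) _ this d[THEN has_field_derivative_imp_has_derivative]] x01
      obtain \<xi> where \<xi>: "x1 < \<xi>" "\<xi> < x2" "(*) (A (\<mu>, \<xi>) * w (\<mu>, \<xi>)) = (\<lambda>v. 0)"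
        by auto
      have "A (\<mu>, \<xi>) * w (\<mu>, \<xi>) * 1 = 0" using fun_cong[OF \<xi>(3), of 1] .
      then have "w (\<mu>, \<xi>) = 0" using A[of "(\<mu>, \<xi>)"] by simp
      moreover have "\<bar>\<xi> - f x1\<bar> < e (f x1)" using f(2)[OF x(1)] f(2)[OF x(2)] x(4) \<xi> by (auto simp: abs_less_iff)
      then have "w (\<mu>, \<xi>) \<noteq> 0" using near[OF f(1)[OF x(1)], of \<xi>] fz[OF x(1)] \<xi> x01 unfolding zeros_def by auto
      ultimately show False by simp
    qed
    have "inj_on f (zeros \<mu>)"
      by (rule inj_onI) (metis no linorder_neqE)
    then show ?thesis using f(1) fz by blast
  qed
  then show ?thesis using X(2) \<delta>(1) by blast
qed

text \<open>The case \<mu> = l: the zeros embed into the finite set of centres.\<close>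

lemma finite_zeros:
  assumes "l \<in> {0..M}" shows "finite (zeros l)"
proof -
  obtain X f where "finite X" "inj_on f (zeros l)" "f ` zeros l \<subseteq> X \<inter> zeros l"
    using zeros_nearby_inj[OF assms] assms by fastforce
  then show ?thesis by (meson finite_Int finite_subset finite_imageD)
qed

lemma card_zeros_upper:
  assumes l: "l \<in> {0..M}"
  shows "\<exists>\<delta>>0. \<forall>\<mu>\<in>{0..M}. \<bar>\<mu> - l\<bar> < \<delta> \<longrightarrow> card (zeros \<mu>) \<le> card (zeros l)"
proof -
  obtain X \<delta> where *: "\<delta> > 0" "\<forall>\<mu>\<in>{0..M}. \<bar>\<mu> - l\<bar> < \<delta> \<longrightarrow>
    (\<exists>f. inj_on f (zeros \<mu>) \<and> f ` zeros \<mu> \<subseteq> X \<inter> zeros l)"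
    using zeros_nearby_inj[OF l] by blast
  have "card (zeros \<mu>) \<le> card (zeros l)" if "\<mu> \<in> {0..M}" "\<bar>\<mu> - l\<bar> < \<delta>" for \<mu>
  proof -
    from *(2)[rule_format, OF that] obtain f where f: "inj_on f (zeros \<mu>)" "f ` zeros \<mu> \<subseteq> X \<inter> zeros l" by blast
    then have "f ` zeros \<mu> \<subseteq> zeros l" by blast
    with f(1) show ?thesis by (rule card_inj_on_le[OF _ _ finite_zeros[OF l]])
  qed
  then show ?thesis using *(1) by blast
qed

lemma zero_isolated:
  assumes l: "l \<in> {0..M}" and x: "x \<in> {0..1}" "z (l, x) = 0"
  shows "((\<lambda>t. z (l, t) / (t - x)) \<longlongrightarrow> A (l, x) * w (l, x)) (at x within {0..1})"
  using der[OF l x(1)] x(2) unfolding has_field_derivative_iff by simp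

text \<open>The difference quotient tends to \<open>A * w\<close>, which is nonzero; multiplied by
  its own limit it is positive on both sides of x, so z has opposite signs there.\<close>

lemma sign_change:
  assumes l: "l \<in> {0..M}" and x: "0 < x" "x < 1" "z (l, x) = 0" and e: "e > 0"
  shows "\<exists>x1 x2. x - e < x1 \<and> 0 < x1 \<and> x1 < x \<and> x < x2 \<and> x2 < x + e \<and> x2 < 1 \<and> z (l, x1) * z (l, x2) < 0"
proof -
  define D where "D = A (l, x) * w (l, x)"
  have D: "D \<noteq> 0" unfolding D_def using A[of "(l, x)"] nondeg[OF l _ x(3)] x by auto
  have "x \<in> interior {0..1}" using x by simp
  then have at: "at x within {0..1} = at x" by (rule at_within_interior)
  have "((\<lambda>t. z (l, t) / (t - x) * D) \<longlongrightarrow> D * D) (at x)"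
    using tendsto_mult_right[OF zero_isolated[OF l _ x(3)], of D] x unfolding at D_def by (simp add: mult.commute)
  moreover have "D * D > 0" using D by (simp add: zero_less_mult_iff) linarith
  ultimately have "\<forall>\<^sub>F t in at x. z (l, t) / (t - x) * D > 0" by (rule order_tendstoD(1))
  then obtain d where d: "d > 0" "\<And>t. t \<noteq> x \<Longrightarrow> dist t x < d \<Longrightarrow> z (l, t) / (t - x) * D > 0"
    unfolding eventually_at by auto
  define h where "h = min (min (d / 2) (e / 2)) (min (x / 2) ((1 - x) / 2))"
  have h: "h > 0" "h < d" "h < e" "h < x" "h < 1 - x" unfolding h_def using d e x by (auto simp: min_def)
  have 1: "z (l, x - h) / (- h) * D > 0" using d(2)[of "x - h"] h by (simp add: dist_real_def)
  have 2: "z (l, x + h) / h * D > 0" using d(2)[of "x + h"] h by (simp add: dist_real_def)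
  have "(z (l, x - h) / (- h) * D) * (z (l, x + h) / h * D) > 0" by (rule mult_pos_pos[OF 1 2])
  moreover have "(z (l, x - h) / (- h) * D) * (z (l, x + h) / h * D) = - (z (l, x - h) * z (l, x + h)) * (D / h)\<^sup>2"
    by (simp add: power2_eq_square)
  ultimately have "z (l, x - h) * z (l, x + h) < 0"
    by (simp add: zero_less_mult_iff mult_less_0_iff)
  then show ?thesis using h by (intro exI[of _ "x - h"] exI[of _ "x + h"]) auto
qed

text \<open>Each sign change survives a small change of parameter and yields a zero nearby; zeros
  arising from different points stay distinct because they move by less than half of the least
  distance. End points are excluded, since a zero there can leave the interval.\<close>

lemma card_interior_zeros_lower:
  assumes l: "l \<in> {0..M}"
  shows "\<exists>\<delta>>0. \<forall>\<mu>\<in>{0..M}. \<bar>\<mu> - l\<bar> < \<delta> \<longrightarrow> card (zeros l \<inter> {0<..<1}) \<le> card (zeros \<mu> \<inter> {0<..<1})"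
proof -
  define F where "F = zeros l \<inter> {0<..<1}"
  have fF: "finite F" unfolding F_def using finite_zeros[OF l] by simp
  obtain e where e: "e > 0" "\<And>x y. x \<in> F \<Longrightarrow> y \<in> F \<Longrightarrow> x \<noteq> y \<Longrightarrow> 2 * e \<le> \<bar>x - y\<bar>"
  proof -
    \<comment> \<open>The element 1 keeps the minimum defined when there are fewer than two
      zeros.\<close>
    define S where "S = insert 1 ((\<lambda>(x, y). \<bar>x - y\<bar>) ` {(x, y). x \<in> F \<and> y \<in> F \<and> x \<noteq> y})"
    have fS: "finite S" unfolding S_def
    proof -
      have "{(x, y). x \<in> F \<and> y \<in> F \<and> x \<noteq> y} \<subseteq> F \<times> F" by auto
      from finite_subset[OF this finite_cartesian_product[OF fF fF]]
      show "finite (insert 1 ((\<lambda>(x, y). \<bar>x - y\<bar>) ` {(x, y). x \<in> F \<and> y \<in> F \<and> x \<noteq> y}))"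
        by (intro finite.insertI finite_imageI)
    qed
    have pos: "Min S > 0" using fS by (subst Min_gr_iff) (auto simp: S_def)
    have "Min S \<le> \<bar>x - y\<bar>" if "x \<in> F" "y \<in> F" "x \<noteq> y" for x y
      by (rule Min_le[OF fS]) (use that in \<open>auto simp: S_def\<close>)
    then show ?thesis using pos by (intro that[of "Min S / 2"]) auto
  qed
  have "\<exists>d>0. \<forall>\<mu>\<in>{0..M}. \<bar>\<mu> - l\<bar> < d \<longrightarrow> (\<exists>t\<in>zeros \<mu> \<inter> {0<..<1}. \<bar>t - x\<bar> < e)" if x: "x \<in> F" for x
  proof -
    have "0 < x" "x < 1" "z (l, x) = 0" using x by (auto simp: F_def zeros_def)
    from sign_change[OF l this e(1)] obtain x1 x2 where
      s: "x - e < x1" "0 < x1" "x1 < x" "x < x2" "x2 < x + e" "x2 < 1" "z (l, x1) * z (l, x2) < 0" by blast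
    have "z (l, x1) \<noteq> 0" "z (l, x2) \<noteq> 0" using s(7) by auto
    have near: "\<exists>d>0. \<forall>\<mu>\<in>{0..M}. \<bar>\<mu> - l\<bar> < d \<longrightarrow> z (\<mu>, t) * z (l, t) > 0"
      if t: "t \<in> {0..1}" "z (l, t) \<noteq> 0" for t
    proof -
      have "(l, t) \<in> {0..M} \<times> {0..1}" using l t by simp
      from within_nonzero_nbhd[OF zc this t(2)] obtain d where d: "d > 0"
        "\<forall>\<mu>'\<in>{0..M}. \<forall>x'\<in>{0..1}. \<bar>\<mu>' - l\<bar> < d \<longrightarrow> \<bar>x' - t\<bar> < d \<longrightarrow> z (\<mu>', x') * z (l, t) > 0" by blast
      have "z (\<mu>, t) * z (l, t) > 0" if "\<mu> \<in> {0..M}" "\<bar>\<mu> - l\<bar> < d" for \<mu>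
        using d(2)[rule_format, OF that(1) t(1) that(2)] d(1) by simp
      then show ?thesis using d(1) by blast
    qed
    have x12: "x1 \<in> {0..1}" "x2 \<in> {0..1}" using s by auto
    obtain d1 where d1: "d1 > 0" "\<forall>\<mu>\<in>{0..M}. \<bar>\<mu> - l\<bar> < d1 \<longrightarrow> z (\<mu>, x1) * z (l, x1) > 0"
      using near[OF x12(1) \<open>z (l, x1) \<noteq> 0\<close>] by blast
    obtain d2 where d2: "d2 > 0" "\<forall>\<mu>\<in>{0..M}. \<bar>\<mu> - l\<bar> < d2 \<longrightarrow> z (\<mu>, x2) * z (l, x2) > 0"
      using near[OF x12(2) \<open>z (l, x2) \<noteq> 0\<close>] by blast
    have "\<exists>t\<in>zeros \<mu> \<inter> {0<..<1}. \<bar>t - x\<bar> < e" if \<mu>: "\<mu> \<in> {0..M}" "\<bar>\<mu> - l\<bar> < min d1 d2" for \<mu>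
    proof -
      have c: "continuous_on {x1..x2} (\<lambda>x. z (\<mu>, x))"
        by (rule continuous_on_compose2[OF zc]) (use \<mu> s in \<open>auto intro!: continuous_intros\<close>)
      have p: "z (\<mu>, x1) * z (l, x1) > 0" "z (\<mu>, x2) * z (l, x2) > 0" using d1(2) d2(2) \<mu> by auto
      have "z (\<mu>, x1) * z (\<mu>, x2) < 0"
        using p s(7) by (auto simp: zero_less_mult_iff mult_less_0_iff)
      then consider "z (\<mu>, x1) < 0" "0 < z (\<mu>, x2)" | "z (\<mu>, x2) < 0" "0 < z (\<mu>, x1)"
        by (auto simp: mult_less_0_iff)
      then have "\<exists>t. x1 \<le> t \<and> t \<le> x2 \<and> z (\<mu>, t) = 0"
      proof cases
        case 1 then show ?thesis using IVT'[of "\<lambda>x. z (\<mu>, x)" x1 0 x2] s c by auto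
      next
        case 2 then show ?thesis using IVT2'[of "\<lambda>x. z (\<mu>, x)" x2 0 x1] s c by auto
      qed
      then obtain t where "x1 \<le> t" "t \<le> x2" "z (\<mu>, t) = 0" by blast
      then show ?thesis using s by (intro bexI[of _ t]) (auto simp: zeros_def)
    qed
    then show ?thesis using d1(1) d2(1) by (intro exI[of _ "min d1 d2"]) simp
  qed
  then obtain d where d: "\<And>x. x \<in> F \<Longrightarrow> d x > 0"
    "\<And>x \<mu>. x \<in> F \<Longrightarrow> \<mu> \<in> {0..M} \<Longrightarrow> \<bar>\<mu> - l\<bar> < d x \<Longrightarrow> \<exists>t\<in>zeros \<mu> \<inter> {0<..<1}. \<bar>t - x\<bar> < e" by metis
  define \<delta> where "\<delta> = Min (insert 1 (d ` F))"
  have \<delta>: "\<delta> > 0" "\<And>x. x \<in> F \<Longrightarrow> \<delta> \<le> d x" unfolding \<delta>_def using fF d(1) by (auto simp: Min_gr_iff)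
  have "card F \<le> card (zeros \<mu> \<inter> {0<..<1})" if \<mu>: "\<mu> \<in> {0..M}" "\<bar>\<mu> - l\<bar> < \<delta>" for \<mu>
  proof -
    have "\<exists>t\<in>zeros \<mu> \<inter> {0<..<1}. \<bar>t - x\<bar> < e" if "x \<in> F" for x
      using d(2)[OF that \<mu>(1)] \<mu>(2) \<delta>(2)[OF that] by linarith
    then obtain g where g: "\<And>x. x \<in> F \<Longrightarrow> g x \<in> zeros \<mu> \<inter> {0<..<1}" "\<And>x. x \<in> F \<Longrightarrow> \<bar>g x - x\<bar> < e" by metis
    have "inj_on g F"
    proof (rule inj_onI, rule ccontr)
      fix x y assume xy: "x \<in> F" "y \<in> F" "g x = g y" "x \<noteq> y"
      then show False using e(2)[OF xy(1,2,4)] g(2)[OF xy(1)] g(2)[OF xy(2)] by linarith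
    qed
    then show ?thesis by (rule card_inj_on_le) (use g(1) finite_zeros[OF \<mu>(1)] in auto)
  qed
  then show ?thesis using \<delta>(1) unfolding F_def by blast
qed

end

section \<open>Index and zeros; bounded oscillation of the index\<close>

text \<open>By Cauchy-Schwarz \<open>(u t)^2\<close> is at most the distance times the integral of
  \<open>f^2\<close> between x and t, and that integral tends to 0. This disposes of the boundary
  term \<open>v / y * u^2\<close> at a zero of y.\<close>

lemma square_over_distance_tendsto_0:
  assumes u: "ac 0 1 u f" and f2: "(\<lambda>t. (f t)\<^sup>2) absolutely_integrable_on {0..1}"
    and x: "x \<in> {0..1}" "u x = 0"
  shows "((\<lambda>t. (u t)\<^sup>2 / (t - x)) \<longlongrightarrow> 0) (at x within {0..1})"
proof -
  define F where "F = primitive (\<lambda>t. (f t)\<^sup>2)"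
  have F: "ac 0 1 F (\<lambda>t. (f t)\<^sup>2)" unfolding F_def by (rule ac_primitive[OF f2])
  have "(F \<longlongrightarrow> F x) (at x within {0..1})"
    using ac_continuous_on[OF F] x(1) by (simp add: continuous_on_def)
  then have lim: "((\<lambda>t. \<bar>F t - F x\<bar>) \<longlongrightarrow> 0) (at x within {0..1})"
    using tendsto_rabs[OF LIM_zero] by fastforce
  have bound: "norm ((u t)\<^sup>2 / (t - x)) \<le> \<bar>F t - F x\<bar>" if t: "t \<in> {0..1}" "t \<noteq> x" for t
  proof (cases "t < x")
    case True
    have "(u x - u t)\<^sup>2 \<le> (x - t) * integral {t..x} (\<lambda>t. (f t)\<^sup>2)"
      by (rule ac_difference_square_le[OF u f2]) (use True t x in auto)
    also have "integral {t..x} (\<lambda>t. (f t)\<^sup>2) = F x - F t" using acD(2)[OF F, of t x] True t x by simp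
    finally have "(u t)\<^sup>2 \<le> (x - t) * (F x - F t)" using x by simp
    then have "(u t)\<^sup>2 / (x - t) \<le> F x - F t" using True by (simp add: divide_le_eq mult.commute)
    then show ?thesis using True by (simp add: abs_divide)
  next
    case False
    then have tx: "x < t" using t by simp
    have "(u t - u x)\<^sup>2 \<le> (t - x) * integral {x..t} (\<lambda>t. (f t)\<^sup>2)"
      by (rule ac_difference_square_le[OF u f2]) (use tx t x in auto)
    also have "integral {x..t} (\<lambda>t. (f t)\<^sup>2) = F t - F x" using acD(2)[OF F, of x t] tx t x by simp
    finally have "(u t)\<^sup>2 \<le> (t - x) * (F t - F x)" using x by simp
    then have "(u t)\<^sup>2 / (t - x) \<le> F t - F x" using tx by (simp add: divide_le_eq mult.commute)
    then show ?thesis using tx by (simp add: abs_divide)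
  qed
  show ?thesis
    by (rule Lim_null_comparison[OF _ lim]) (use bound in \<open>auto simp: eventually_at intro!: exI[of _ 1]\<close>)
qed

section \<open>Picone's identity and the two zero counts\<close>

locale pencil_solution =
  fixes P :: "real \<Rightarrow> real" and \<mu> :: real and z w :: "real \<Rightarrow> real"
  assumes P: "P \<in> L2" and ode: "pencil_ode P \<mu> z w"
begin

definition "y x = exp (- (\<mu> * primitive P x)) * z x"
definition "v x = exp (\<mu> * primitive P x) * w x"
definition "y' x = v x - \<mu> * P x * y x"

lemma y_ac: "ac 0 1 y y'" and v_ac: "ac 0 1 v (\<lambda>x. \<mu> * P x * y' x)"
  using ode unfolding pencil_ode_def Let_def y'_def[abs_def] y_def[abs_def] v_def[abs_def] by blast+

lemma y_0: "y 0 = 0" and y_eq_0_iff: "y x = 0 \<longleftrightarrow> z x = 0"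
  using ode by (simp_all add: pencil_ode_def y_def)

lemma y_continuous: "continuous_on {0..1} y" and v_continuous: "continuous_on {0..1} v"
  by (rule ac_continuous_on[OF y_ac], rule ac_continuous_on[OF v_ac])

lemma y'_L2: "y' \<in> L2"
proof -
  have "(\<lambda>x. v x + (- \<mu> * y x) * P x) \<in> L2"
    by (intro L2_add continuous_on_L2[OF v_continuous] L2_real_mult_cont P continuous_intros y_continuous)
  then show ?thesis by (simp add: y'_def[abs_def] mult_ac)
qed

text \<open>y is merely absolutely continuous, but it is the C1 function z times a continuous
  positive factor, so at its zeros the quotient still has a nonzero limit.\<close>

lemma y_quotient_tendsto:
  assumes x: "x \<in> {0..1}" "y x = 0"
  shows "\<exists>D. D \<noteq> 0 \<and> ((\<lambda>t. y t / (t - x)) \<longlongrightarrow> D) (at x within {0..1})"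
proof -
  define D where "D = exp (2 * (\<mu> * primitive P x)) * w x"
  have z: "z x = 0" using x(2) by (simp add: y_eq_0_iff)
  have "(z has_real_derivative D) (at x within {0..1})" "w x \<noteq> 0"
    using ode x(1) z by (auto simp: pencil_ode_def D_def)
  then have 1: "((\<lambda>t. z t / (t - x)) \<longlongrightarrow> D) (at x within {0..1})" "D \<noteq> 0"
    using z by (auto simp: has_field_derivative_iff D_def)
  have "continuous_on {0..1} (\<lambda>t. exp (- (\<mu> * primitive P t)))"
    by (intro continuous_intros ac_continuous_on[OF ac_primitive[OF L2_absolutely_integrable[OF P]]])
  then have "((\<lambda>t. exp (- (\<mu> * primitive P t))) \<longlongrightarrow> exp (- (\<mu> * primitive P x))) (at x within {0..1})"
    using x(1) by (simp add: continuous_on_def)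
  from tendsto_mult[OF this 1(1)] 1(2) show ?thesis
    by (intro exI[of _ "exp (- (\<mu> * primitive P x)) * D"]) (simp add: y_def)
qed

lemma y_isolated:
  assumes x: "x \<in> {0..1}" "y x = 0"
  shows "\<exists>d>0. \<forall>t\<in>{0..1}. t \<noteq> x \<longrightarrow> \<bar>t - x\<bar> < d \<longrightarrow> y t \<noteq> 0"
proof -
  obtain D where D: "D \<noteq> 0" "((\<lambda>t. y t / (t - x)) \<longlongrightarrow> D) (at x within {0..1})"
    using y_quotient_tendsto[OF x] by blast
  have "\<forall>\<^sub>F t in at x within {0..1}. y t / (t - x) \<noteq> 0"
    by (rule tendsto_imp_eventually_ne[OF D(2,1)])
  then obtain d where "d > 0" "\<forall>t\<in>{0..1}. t \<noteq> x \<and> dist t x < d \<longrightarrow> y t / (t - x) \<noteq> 0"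
    unfolding eventually_at by blast
  then show ?thesis by (intro exI[of _ d]) (auto simp: dist_real_def)
qed

text \<open>With \<open>R = v / y\<close> one has \<open>R' = - (R - \<mu> P)\<^sup>2\<close>, so that
  \<open>f\<^sup>2 + 2 \<mu> P f u = (R u\<^sup>2)' + (f - (R - \<mu> P) u)\<^sup>2\<close> for \<open>f = u'\<close>.  The function \<open>R u\<^sup>2\<close> extends continuously by
  \<open>0\<close> (the value of \<open>v / 0 * u\<^sup>2\<close>) to the zeros of \<open>y\<close>, where \<open>u\<close> vanishes too.\<close>

lemma Picone:
  assumes u: "ac 0 1 u f" "f \<in> L2" "u 0 = 0" "u 1 = 0"
    and uz: "\<And>x. x \<in> {0<..<1} \<Longrightarrow> z x = 0 \<Longrightarrow> u x = 0"
  shows "0 \<le> integral {0..1} (\<lambda>x. (f x)\<^sup>2 + \<mu> * (2 * P x * (f x * u x)))"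
proof -
  define q where "q x = (f x)\<^sup>2 + \<mu> * (2 * P x * (f x * u x))" for x
  have f2: "(\<lambda>x. (f x)\<^sup>2) absolutely_integrable_on {0..1}" using L2_square[OF u(2)] by simp
  note uc = ac_continuous_on[OF u(1)]
  have "(\<lambda>x. P x * (u x * f x)) absolutely_integrable_on {0..1}"
    by (rule L2_real_mult[OF P L2_real_mult_cont[OF uc u(2)]])
  then have "(\<lambda>x. (f x)\<^sup>2 + (2 * \<mu>) * (P x * (u x * f x))) absolutely_integrable_on {0..1}"
    by (intro set_integral_add(1) f2 set_integrable_mult_right)
  then have qi: "q absolutely_integrable_on {0..1}" by (simp add: q_def[abs_def] mult_ac)
  note Q = ac_primitive[OF qi]
  \<comment> \<open>The integral of the form minus \<open>R * u^2\<close>. Its derivative is the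
    square in Picone's identity, and \<open>\<Theta> 1 - \<Theta> 0\<close> is the integral to be
    estimated because u vanishes at both ends. As the inverse of 0 is 0, the formula also gives the
    right value at zeros of y.\<close>
  define \<Theta> where "\<Theta> x = primitive q x + (-1) * (v x * inverse (y x) * (u x * u x))" for x
  have u0: "u x = 0" if "x \<in> {0..1}" "y x = 0" for x
  proof (cases "x = 0 \<or> x = 1")
    case False
    then show ?thesis using that uz[of x] by (simp add: y_eq_0_iff)
  qed (use u in auto)
  have noz: "\<Theta> s \<le> \<Theta> t" if st: "0 \<le> s" "s \<le> t" "t \<le> 1" and nz: "\<And>x. s \<le> x \<Longrightarrow> x \<le> t \<Longrightarrow> y x \<noteq> 0" for s t
  proof -
    note sub = ac_subinterval[OF _ st(1,3)]
    have inv: "ac s t (\<lambda>x. inverse (y x)) (\<lambda>x. - (inverse (y x) * inverse (y x)) * y' x)"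
    proof (rule ac_chain[OF sub[OF y_ac]])
      show "(inverse has_real_derivative - (inverse (y x) * inverse (y x))) (at (y x))" if "s \<le> x" "x \<le> t" for x
        using nz[OF that] by (auto intro!: derivative_eq_intros simp: power2_eq_square)
      show "continuous_on (y ` {s..t}) (\<lambda>x. - (inverse x * inverse x))"
        by (intro continuous_intros) (use nz in auto)
    qed
    have ac: "ac s t \<Theta> (\<lambda>x. q x + (-1) * ((\<mu> * P x * y' x * inverse (y x) + v x * (- (inverse (y x) * inverse (y x)) * y' x)) * (u x * u x)
        + v x * inverse (y x) * (f x * u x + u x * f x)))"
      unfolding \<Theta>_def[abs_def] by (intro ac_add ac_cmult ac_mult inv sub[OF Q] sub[OF v_ac] sub[OF u(1)])
    show ?thesis
    proof (rule ac_nonneg_mono[OF ac _ order_refl st(2) order_refl])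
      have "q x + (-1) * ((\<mu> * P x * y' x * inverse (y x) + v x * (- (inverse (y x) * inverse (y x)) * y' x)) * (u x * u x)
        + v x * inverse (y x) * (f x * u x + u x * f x)) = (f x - (v x * inverse (y x) - \<mu> * P x) * u x)\<^sup>2"
        if x: "x \<in> {s..t}" for x
      proof -
        define r where "r = inverse (y x)"
        have yr: "y x * r = 1" using nz[of x] x by (simp add: r_def)
        have 1: "y' x * r = v x * r - \<mu> * P x"
        proof -
          have "y' x * r = v x * r - \<mu> * P x * (y x * r)" by (simp add: y'_def algebra_simps)
          then show ?thesis by (simp add: yr)
        qed
        have "\<mu> * P x * y' x * r + v x * (- (r * r) * y' x) = (\<mu> * P x - v x * r) * (y' x * r)" by (simp add: algebra_simps)
        also have "\<dots> = - (v x * r - \<mu> * P x)\<^sup>2" unfolding 1 by (simp add: algebra_simps power2_eq_square)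
        finally have "\<mu> * P x * y' x * r + v x * (- (r * r) * y' x) = - (v x * r - \<mu> * P x)\<^sup>2" .
        then show ?thesis unfolding r_def[symmetric] q_def by (simp only:) (simp add: algebra_simps power2_eq_square)
      qed
      then show "AE x in lebesgue. x \<in> {s..t} \<longrightarrow> 0 \<le> q x + (-1) * ((\<mu> * P x * y' x * inverse (y x) + v x * (- (inverse (y x) * inverse (y x)) * y' x)) * (u x * u x)
        + v x * inverse (y x) * (f x * u x + u x * f x))" by simp
    qed
  qed
  have lim: "(\<Theta> \<longlongrightarrow> \<Theta> x) (at x within {0..1})" if x: "x \<in> {0..1}" "y x = 0" for x
  proof -
    obtain D where D: "D \<noteq> 0" "((\<lambda>t. y t / (t - x)) \<longlongrightarrow> D) (at x within {0..1})"
      using y_quotient_tendsto[OF x] by blast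
    have vl: "(v \<longlongrightarrow> v x) (at x within {0..1})" using v_continuous x(1) by (simp add: continuous_on_def)
    have ql: "(primitive q \<longlongrightarrow> primitive q x) (at x within {0..1})"
      using ac_continuous_on[OF Q] x(1) by (simp add: continuous_on_def)
    \<comment> \<open>Both y and \<open>u^2\<close> are divided by t - x: the first quotient has a
      nonzero limit, the second tends to 0.\<close>
    have "((\<lambda>t. primitive q t + (-1) * (v t * inverse (y t / (t - x)) * ((u t)\<^sup>2 / (t - x)))) \<longlongrightarrow>
        primitive q x + (-1) * (v x * inverse D * 0)) (at x within {0..1})"
      by (intro tendsto_intros ql vl D square_over_distance_tendsto_0[OF u(1) f2 x(1) u0[OF x]])
    then have "((\<lambda>t. primitive q t + (-1) * (v t * inverse (y t / (t - x)) * ((u t)\<^sup>2 / (t - x)))) \<longlongrightarrow> \<Theta> x) (at x within {0..1})"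
      using u0[OF x] by (simp add: \<Theta>_def)
    moreover have "\<forall>\<^sub>F t in at x within {0..1}. primitive q t + (-1) * (v t * inverse (y t / (t - x)) * ((u t)\<^sup>2 / (t - x))) = \<Theta> t"
      unfolding eventually_at
      by (intro exI[of _ 1]) (auto simp: \<Theta>_def power2_eq_square divide_inverse mult_ac)
    ultimately show ?thesis by (rule Lim_transform_eventually)
  qed
  have mono1: "\<Theta> s \<le> \<Theta> x" if s: "0 \<le> s" "s < x" "x \<le> 1" "y x = 0" and nz: "\<And>t. s \<le> t \<Longrightarrow> t < x \<Longrightarrow> y t \<noteq> 0" for s x
  proof (rule tendsto_lowerbound)
    have "(\<Theta> \<longlongrightarrow> \<Theta> x) (at x within {0..1})" by (rule lim) (use s in auto)
    then show "(\<Theta> \<longlongrightarrow> \<Theta> x) (at x within {s..<x})" by (rule tendsto_within_subset) (use s in auto)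
    show "\<forall>\<^sub>F t in at x within {s..<x}. \<Theta> s \<le> \<Theta> t"
      unfolding eventually_at using noz nz s by (intro exI[of _ 1]) auto
    show "at x within {s..<x} \<noteq> bot" using s by (simp add: trivial_limit_within islimpt_Ico)
  qed
  have mono2: "\<Theta> x \<le> \<Theta> t" if t: "0 \<le> x" "x < t" "t \<le> 1" "y x = 0" and nz: "\<And>s. x < s \<Longrightarrow> s \<le> t \<Longrightarrow> y s \<noteq> 0" for t x
  proof (rule tendsto_upperbound)
    have "(\<Theta> \<longlongrightarrow> \<Theta> x) (at x within {0..1})" by (rule lim) (use t in auto)
    then show "(\<Theta> \<longlongrightarrow> \<Theta> x) (at x within {x<..t})" by (rule tendsto_within_subset) (use t in auto)
    show "\<forall>\<^sub>F s in at x within {x<..t}. \<Theta> s \<le> \<Theta> t"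
      unfolding eventually_at using noz nz t by (intro exI[of _ 1]) auto
    show "at x within {x<..t} \<noteq> bot" using t by (simp add: trivial_limit_within islimpt_Ioc)
  qed
  \<comment> \<open>Monotonicity holds away from zeros and on either side of each zero; bisection
    joins the pieces.\<close>
  define B where "B s t \<longleftrightarrow> (0 \<le> s \<longrightarrow> t \<le> 1 \<longrightarrow> \<Theta> s \<le> \<Theta> t)" for s t
  have "B 0 1"
  proof (induction rule: Bolzano[OF zero_le_one])
    case (1 a b c) then show ?case unfolding B_def by (meson order_trans)
  next
    case (2 x)
    then have x: "x \<in> {0..1}" by simp
    show ?case
    proof (cases "y x = 0")
      case True
      obtain d where d: "d > 0" "\<And>t. t \<in> {0..1} \<Longrightarrow> t \<noteq> x \<Longrightarrow> \<bar>t - x\<bar> < d \<Longrightarrow> y t \<noteq> 0"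
        using y_isolated[OF x True] by blast
      have "B s t" if st: "s \<le> x" "x \<le> t" "t - s < d" for s t
        unfolding B_def
      proof (intro impI)
        assume 01: "0 \<le> s" "t \<le> 1"
        have "\<Theta> s \<le> \<Theta> x"
        proof (cases "s = x")
          case False
          show ?thesis by (rule mono1[OF 01(1) _ _ True d(2)]) (use False st 01 in auto)
        qed simp
        also have "\<Theta> x \<le> \<Theta> t"
        proof (cases "t = x")
          case False
          show ?thesis by (rule mono2[OF _ _ 01(2) True d(2)]) (use False st 01 in auto)
        qed simp
        finally show "\<Theta> s \<le> \<Theta> t" .
      qed
      then show ?thesis using d(1) by blast
    next
      case False
      obtain d where d: "d > 0" "\<And>t. t \<in> {0..1} \<Longrightarrow> dist t x < d \<Longrightarrow> dist (y t) (y x) < \<bar>y x\<bar>"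
        using y_continuous[unfolded continuous_on_iff, rule_format, OF x, of "\<bar>y x\<bar>"] False by auto
      have nz: "y t \<noteq> 0" if "t \<in> {0..1}" "\<bar>t - x\<bar> < d" for t
        using d(2)[of t] that by (auto simp: dist_real_def)
      have "B s t" if st: "s \<le> x" "x \<le> t" "t - s < d" for s t
        unfolding B_def by (intro impI noz nz) (use st in auto)
      then show ?thesis using d(1) by blast
    qed
  qed
  then have "\<Theta> 0 \<le> \<Theta> 1" by (simp add: B_def)
  then show ?thesis using u by (simp add: \<Theta>_def primitive_def q_def[abs_def])
qed

text \<open>The values at the inner zeros of z are the linear conditions; under them Picone's
  identity applies to the real and the imaginary part separately.\<close>

lemma ind_le_zeros:
  assumes "finite {x \<in> {0<..<1}. z x = 0}"
  shows "ind (T_pencil P \<mu>) \<le> enat (card {x \<in> {0<..<1}. z x = 0})"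
proof (rule ind_le_card_functionals[where \<xi>="\<lambda>x y. y x"])
  fix Y assume Y: "Y \<in> W21_0" and zero: "\<And>x. x \<in> {x \<in> {0<..<1}. z x = 0} \<Longrightarrow> Y x = 0"
  define g where "g = weak_deriv Y"
  have s: "sob Y g" unfolding g_def by (rule sob_weak_deriv[OF Y])
  note L = L2_ReIm[OF sobD(1)[OF s]]
  have re: "0 \<le> integral {0..1} (\<lambda>x. (Re (g x))\<^sup>2 + \<mu> * (2 * P x * (Re (g x) * Re (Y x))))"
    by (rule Picone[OF sobD(2)[OF s] L(1)]) (use sobD(4,5)[OF s] zero in auto)
  have im: "0 \<le> integral {0..1} (\<lambda>x. (Im (g x))\<^sup>2 + \<mu> * (2 * P x * (Im (g x) * Im (Y x))))"
    by (rule Picone[OF sobD(3)[OF s] L(2)]) (use sobD(4,5)[OF s] zero in auto)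
  have int: "(\<lambda>x. (f x)\<^sup>2 + \<mu> * (2 * P x * (f x * u x))) integrable_on {0..1}"
    if "ac 0 1 u f" "f \<in> L2" for u f
  proof -
    have "(\<lambda>x. P x * (u x * f x)) absolutely_integrable_on {0..1}"
      by (rule L2_real_mult[OF P L2_real_mult_cont[OF ac_continuous_on[OF that(1)] that(2)]])
    then have "(\<lambda>x. (f x)\<^sup>2 + (2 * \<mu>) * (P x * (u x * f x))) absolutely_integrable_on {0..1}"
      using L2_square[OF that(2)] by (intro set_integral_add(1) set_integrable_mult_right) simp_all
    from set_lebesgue_integral_eq_integral(1)[OF this] show ?thesis by (simp add: mult_ac)
  qed
  note i = int[OF sobD(2)[OF s] L(1)] int[OF sobD(3)[OF s] L(2)]
  note e = L2_square[OF sobD(1)[OF s], THEN set_lebesgue_integral_eq_integral(1)]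
  note c = cross_integrable[OF P s, THEN set_lebesgue_integral_eq_integral(1)]
  have "Re (T_pencil P \<mu> Y Y) = integral {0..1} (\<lambda>x. (cmod (g x))\<^sup>2 + \<mu> * (2 * P x * Re (g x * cnj (Y x))))"
    unfolding Re_T_pencil[OF P s] energy_def cross_def
    using Henstock_Kurzweil_Integration.integral_add[OF e integrable_on_mult_right[OF c, of \<mu>]] by simp
  also have "\<dots> = integral {0..1} (\<lambda>x. ((Re (g x))\<^sup>2 + \<mu> * (2 * P x * (Re (g x) * Re (Y x)))) +
      ((Im (g x))\<^sup>2 + \<mu> * (2 * P x * (Im (g x) * Im (Y x)))))"
    by (rule Henstock_Kurzweil_Integration.integral_cong) (simp only: cmod_power2, simp add: algebra_simps)
  also have "\<dots> = integral {0..1} (\<lambda>x. (Re (g x))\<^sup>2 + \<mu> * (2 * P x * (Re (g x) * Re (Y x)))) +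
      integral {0..1} (\<lambda>x. (Im (g x))\<^sup>2 + \<mu> * (2 * P x * (Im (g x) * Im (Y x))))"
    by (rule Henstock_Kurzweil_Integration.integral_add[OF i])
  finally show "0 \<le> Re (T_pencil P \<mu> Y Y)" using re im by linarith
qed (use assms functional_eval in auto)

text \<open>The solution cut off at each of its zeros in (0,1] spans a space on which the form for
  \<mu> vanishes, so \<open>energy + \<mu> * cross = 0\<close>; raising \<mu> to l makes the form
  negative wherever the energy is positive. A zero at 1 counts through the uncut solution.\<close>

lemma ind_ge_zeros:
  assumes fin: "finite {x \<in> {0<..1}. z x = 0}" and \<mu>: "0 < \<mu>" "\<mu> < l"
  shows "enat (card {x \<in> {0<..1}. z x = 0}) \<le> ind (T_pencil P l)"
proof -
  define Z where "Z = {x \<in> {0<..1}. z x = 0}"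
  define e where "e \<zeta> x = (if x \<in> {0..\<zeta>} then complex_of_real (y x) else 0)" for \<zeta> x
  define e' where "e' \<zeta> x = (if x \<in> {0..\<zeta>} then complex_of_real (y' x) else 0)" for \<zeta> x
  have Zd: "0 < \<zeta>" "\<zeta> \<le> 1" "y \<zeta> = 0" if "\<zeta> \<in> Z" for \<zeta>
    using that by (auto simp: Z_def y_eq_0_iff)
  have es: "sob (e \<zeta>) (e' \<zeta>)" if \<zeta>: "\<zeta> \<in> Z" for \<zeta>
  proof -
    note d = Zd[OF \<zeta>]
    have yz: "ac 0 \<zeta> y y'" by (rule ac_subinterval[OF y_ac]) (use d in auto)
    have ext: "ac 0 1 (\<lambda>x. if x \<in> {0..\<zeta>} then y x else 0) (\<lambda>x. if x \<in> {0..\<zeta>} then y' x else 0)"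
      by (rule ac_extend_zero[OF yz]) (use d y_0 in auto)
    have "e' \<zeta> \<in> L2"
    proof -
      note yl = y'_L2[unfolded L2_iff]
      have 1: "y' absolutely_integrable_on {0..\<zeta>}" "(\<lambda>x. (norm (y' x))\<^sup>2) absolutely_integrable_on {0..\<zeta>}"
        using absolutely_integrable_Icc_subset(1)[OF conjunct1[OF yl], of 0 \<zeta>]
          absolutely_integrable_Icc_subset(1)[OF conjunct2[OF yl], of 0 \<zeta>] d by auto
      have "(\<lambda>x. (norm (if x \<in> {0..\<zeta>} then y' x else 0))\<^sup>2) = (\<lambda>x. if x \<in> {0..\<zeta>} then (norm (y' x))\<^sup>2 else 0)"
        by (auto simp: fun_eq_iff)
      then have "(\<lambda>x. if x \<in> {0..\<zeta>} then y' x else 0) \<in> L2"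
        unfolding L2_iff using absolutely_integrable_extend_zero[OF 1(1), of 0 1] absolutely_integrable_extend_zero[OF 1(2), of 0 1] by simp
      from of_real_L2[OF this] show ?thesis by (simp add: e'_def[abs_def] if_distrib[of complex_of_real] cong: if_cong)
    qed
    moreover have "ac 0 1 (\<lambda>x. Re (e \<zeta> x)) (\<lambda>x. Re (e' \<zeta> x))"
      by (rule ac_cong[OF ext]) (auto simp: e_def e'_def)
    moreover have "ac 0 1 (\<lambda>x. Im (e \<zeta> x)) (\<lambda>x. Im (e' \<zeta> x))"
      by (rule ac_cong[OF ac_const[of 0 1 0]]) (auto simp: e_def e'_def)
    moreover have "e \<zeta> 1 = 0" using d by (cases "\<zeta> = 1") (auto simp: e_def)
    ultimately show ?thesis unfolding sob_def using d y_0 by (auto simp: e_def)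
  qed
  have eW: "e \<zeta> \<in> W21_0" if "\<zeta> \<in> Z" for \<zeta> by (rule sob_W21_0[OF es[OF that]])
  have T0: "T_pencil P \<mu> (e \<zeta>) (e \<eta>) = 0" if \<zeta>: "\<zeta> \<in> Z" and \<eta>: "\<eta> \<in> Z" for \<zeta> \<eta>
  proof -
    \<comment> \<open>On [0,m] the integrand is the derivative of y v, and y vanishes at 0 and at m;
      beyond m one of the two cut-off functions is zero.\<close>
    define m where "m = min \<zeta> \<eta>"
    have m: "0 \<le> m" "m \<le> 1" "y m = 0" using Zd[OF \<zeta>] Zd[OF \<eta>] by (auto simp: m_def min_def)
    note yv = ac_mult[OF y_ac v_ac]
    have "integral {0..m} (\<lambda>x. y' x * v x + y x * (\<mu> * P x * y' x)) = 0"
      using acD(2)[OF yv order_refl m(1,2)] m(3) y_0 by simp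
    moreover have "(\<lambda>x. y' x * v x + y x * (\<mu> * P x * y' x)) integrable_on {0..m}"
      by (rule acD(3)[OF yv order_refl m(1,2)])
    ultimately have hi: "((\<lambda>x. y' x * v x + y x * (\<mu> * P x * y' x)) has_integral 0) {0..m}"
      using integrable_integral by metis
    have "((\<lambda>x. complex_of_real (y' x * v x + y x * (\<mu> * P x * y' x))) has_integral of_real 0) {0..m}"
      using has_integral_linear[OF hi bounded_linear_of_real] by (simp add: o_def)
    then have "((\<lambda>x. if x \<in> {0..m} then complex_of_real (y' x * v x + y x * (\<mu> * P x * y' x)) else 0) has_integral of_real 0) {0..1}"
    proof -
      have "{0..m} \<subseteq> {0..1}" using m by auto
      from has_integral_restrict[OF this] \<open>(_ has_integral of_real 0) {0..m}\<close> show ?thesis by (rule iffD2)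
    qed
    moreover have "(if x \<in> {0..m} then complex_of_real (y' x * v x + y x * (\<mu> * P x * y' x)) else 0)
      = e' \<zeta> x * cnj (e' \<eta> x) + of_real \<mu> * of_real (P x) * (e' \<zeta> x * cnj (e \<eta> x) + e \<zeta> x * cnj (e' \<eta> x))" for x
    proof (cases "x \<in> {0..m}")
      case True
      then have "x \<in> {0..\<zeta>}" "x \<in> {0..\<eta>}" by (auto simp: m_def)
      moreover have "v x = y' x + \<mu> * P x * y x" by (simp add: y'_def)
      ultimately show ?thesis using True by (simp add: e_def e'_def algebra_simps)
    next
      case False
      then have "x \<notin> {0..\<zeta>} \<or> x \<notin> {0..\<eta>}" by (auto simp: m_def)
      then show ?thesis using False unfolding e_def e'_def by auto
    qed
    ultimately show ?thesis
      unfolding T_pencil_sob[OF P es[OF \<zeta>] es[OF \<eta>]] by (simp add: integral_unique)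
  qed
  have "neg_family (T_pencil P l) Z e"
    unfolding neg_family_def
  proof (intro conjI allI impI ballI eW)
    show "finite Z" using fin by (simp add: Z_def)
    fix c :: "real \<Rightarrow> complex" assume c: "\<exists>i\<in>Z. c i \<noteq> 0"
    define s where "s = (\<Sum>\<zeta>\<in>Z. cscale (c \<zeta>) (e \<zeta>))"
    have sW: "s \<in> W21_0" unfolding s_def by (rule lincomb_W21_0[OF eW])
    define g where "g = weak_deriv s"
    have ss: "sob s g" unfolding g_def by (rule sob_weak_deriv[OF sW])
    have "T_pencil P \<mu> (e \<zeta>) s = 0" if "\<zeta> \<in> Z" for \<zeta>
      unfolding s_def using hermitian_sum_right[OF hermitian_T_pencil[OF P] eW eW[OF that], where c=c] T0[OF that]
      by simp
    then have "T_pencil P \<mu> s s = 0"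
      using hermitian_sum_left[OF hermitian_T_pencil[OF P] eW sW, where c=c] unfolding s_def by simp
    then have E0: "energy g + \<mu> * cross P s g = 0" using Re_T_pencil[OF P ss, of \<mu>] by simp
    \<comment> \<open>Zero energy would force s = 0. But between the largest \<zeta> with nonzero
      coefficient and the zero before it only one term of s survives, and y is nonzero
      there.\<close>
    have "energy g \<noteq> 0"
    proof
      assume e0: "energy g = 0"
      have s0: "s x = 0" if "x \<in> {0..1}" for x
        using sob_difference_square_le[OF ss, of 0 x] that e0 sobD(4)[OF ss] by (simp add: energy_def)
      define Z' where "Z' = {\<zeta> \<in> Z. c \<zeta> \<noteq> 0}"
      have Z': "finite Z'" "Z' \<noteq> {}" using \<open>finite Z\<close> c by (auto simp: Z'_def)
      define \<zeta> where "\<zeta> = Max Z'"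
      have \<zeta>: "\<zeta> \<in> Z" "c \<zeta> \<noteq> 0" using Max_in[OF Z'] by (auto simp: \<zeta>_def Z'_def)
      have above: "c \<eta> = 0" if "\<eta> \<in> Z" "\<eta> > \<zeta>" for \<eta>
        using Max_ge[OF Z'(1), of \<eta>] that by (auto simp: \<zeta>_def Z'_def)
      \<comment> \<open>The element 0 makes the maximum exist and keeps x strictly positive.\<close>
      define S where "S = insert 0 {\<eta> \<in> Z. \<eta> < \<zeta>}"
      have S: "finite S" using \<open>finite Z\<close> by (simp add: S_def)
      have Sm: "Max S < \<zeta>" "0 \<le> Max S" using S Zd(1)[OF \<zeta>(1)] by (auto simp: S_def)
      define x where "x = (Max S + \<zeta>) / 2"
      have x: "Max S < x" "x < \<zeta>" "0 < x" "x \<le> 1" using Sm Zd(2)[OF \<zeta>(1)] by (auto simp: x_def)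
      have "y x \<noteq> 0"
      proof
        assume "y x = 0"
        then have "x \<in> S" using x by (auto simp: S_def Z_def y_eq_0_iff)
        then show False using Max_ge[OF S, of x] x by simp
      qed
      have "s x = (\<Sum>\<eta>\<in>Z. c \<eta> * e \<eta> x)"
        unfolding s_def using functional_sum[OF functional_eval[of x] eW, where c=c] by simp
      also have "\<dots> = (\<Sum>\<eta>\<in>Z. if \<eta> = \<zeta> then c \<zeta> * y x else 0)"
      proof (rule sum.cong[OF refl])
        fix \<eta> assume \<eta>: "\<eta> \<in> Z"
        show "c \<eta> * e \<eta> x = (if \<eta> = \<zeta> then c \<zeta> * y x else 0)"
        proof (cases \<eta> \<zeta> rule: linorder_cases)
          case less
          then have "\<eta> \<in> S" using \<eta> by (simp add: S_def)
          then have "\<eta> < x" using Max_ge[OF S, of \<eta>] x by simp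
          then show ?thesis using less by (simp add: e_def)
        next
          case equal
          then show ?thesis using x by (simp add: e_def)
        next
          case greater
          then show ?thesis using above[OF \<eta>] by simp
        qed
      qed
      also have "\<dots> = c \<zeta> * y x" using \<zeta>(1) \<open>finite Z\<close> by simp
      finally show False using s0[of x] x \<zeta>(2) \<open>y x \<noteq> 0\<close> by simp
    qed
    then have Ep: "energy g > 0" using energy_nonneg[OF ss] by simp
    then have "\<mu> * cross P s g < 0" using E0 by linarith
    then have "cross P s g < 0" using \<mu> by (simp add: mult_less_0_iff)
    then have "l * cross P s g < \<mu> * cross P s g" by (rule mult_strict_right_mono_neg[OF \<mu>(2)])
    then have "Re (T_pencil P l s s) < 0" unfolding Re_T_pencil[OF P ss] using E0 by linarith
    then show "Re (T_pencil P l (\<Sum>i\<in>Z. cscale (c i) (e i)) (\<Sum>i\<in>Z. cscale (c i) (e i))) < 0"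
      by (simp add: s_def)
  qed
  from neg_family_ind[OF hermitian_T_pencil[OF P] this] show ?thesis by (simp add: Z_def)
qed

end

section \<open>Local oscillation of the index\<close>

context similarity
begin

text \<open>With m the number of zeros in (0,1) at l, the zeros in (0,1] number m, or m + 1 if there
  is one at x = 1. The zero count at \<mu> and the one at a slightly smaller parameter are both
  compared with these.\<close>

lemma nind_local_oscillation:
  assumes l: "l > 0"
  shows "\<exists>\<delta>>0. \<exists>m. \<forall>\<mu>. \<bar>\<mu> - l\<bar> < \<delta> \<longrightarrow> m \<le> nind \<mu> \<and> nind \<mu> \<le> m + 1"
proof -
  define M where "M = l + 1"
  have M: "M \<ge> 0" using l by (simp add: M_def)
  obtain z w where zw: "continuous_on ({0..M} \<times> {0..1}) z" "continuous_on ({0..M} \<times> {0..1}) w"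
    and ode: "\<And>\<mu>. \<mu> \<in> {0..M} \<Longrightarrow> pencil_ode P \<mu> (\<lambda>x. z (\<mu>, x)) (\<lambda>x. w (\<mu>, x))"
    using pencil_ode_exists[OF P_L2 M] by blast
  interpret zero_count z w "\<lambda>q. exp (2 * (fst q * primitive P (snd q)))" M
    by unfold_locales (use zw ode in \<open>auto simp: pencil_ode_def\<close>)
  have lM: "l \<in> {0..M}" using l by (simp add: M_def)
  obtain d1 where d1: "d1 > 0" "\<forall>\<mu>\<in>{0..M}. \<bar>\<mu> - l\<bar> < d1 \<longrightarrow> card (zeros \<mu>) \<le> card (zeros l)"
    using card_zeros_upper[OF lM] by blast
  obtain d2 where d2: "d2 > 0" "\<forall>\<mu>\<in>{0..M}. \<bar>\<mu> - l\<bar> < d2 \<longrightarrow> card (zeros l \<inter> {0<..<1}) \<le> card (zeros \<mu> \<inter> {0<..<1})"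
    using card_interior_zeros_lower[OF lM] by blast
  \<comment> \<open>The bounds l and 1 keep \<mu> positive and inside [0,M], where the solutions are
    available.\<close>
  define \<delta> where "\<delta> = min (min d1 d2) (min l 1)"
  have \<delta>: "\<delta> > 0" "\<delta> \<le> d1" "\<delta> \<le> d2" "\<delta> \<le> l" "\<delta> \<le> 1" unfolding \<delta>_def using d1(1) d2(1) l by auto
  define m where "m = card (zeros l \<inter> {0<..<1})"
  have inM: "\<mu> \<in> {0..M}" if "\<bar>\<mu> - l\<bar> < \<delta>" for \<mu> using that \<delta> by (auto simp: M_def)
  have zero0: "0 \<in> zeros \<mu>" if "\<mu> \<in> {0..M}" for \<mu>
    using ode[OF that] by (simp add: zeros_def pencil_ode_def)
  have sol: "pencil_solution P \<mu> (\<lambda>x. z (\<mu>, x)) (\<lambda>x. w (\<mu>, x))" if "\<mu> \<in> {0..M}" for \<mu>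
    by unfold_locales (use P_L2 ode[OF that] in auto)
  have int: "{x \<in> {0<..<1}. z (\<mu>, x) = 0} = zeros \<mu> \<inter> {0<..<1}" for \<mu> by (auto simp: zeros_def)
  have "nind \<mu> \<le> m + 1" if \<mu>: "\<bar>\<mu> - l\<bar> < \<delta>" for \<mu>
  proof -
    note \<mu>M = inM[OF \<mu>]
    have fin: "finite (zeros \<mu>)" "finite (zeros l)" using finite_zeros \<mu>M lM by auto
    have "enat (nind \<mu>) \<le> enat (card (zeros \<mu> \<inter> {0<..<1}))"
      using pencil_solution.ind_le_zeros[OF sol[OF \<mu>M], unfolded int] fin unfolding ind_eq_nind by simp
    then have "nind \<mu> \<le> card (zeros \<mu> \<inter> {0<..<1})" by simp
    also have "\<dots> \<le> card (zeros \<mu> - {0})" by (rule card_mono) (use fin in auto)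
    \<comment> \<open>The zero at x = 0 belongs to every solution and is discounted at both
      parameters.\<close>
    also have "\<dots> = card (zeros \<mu>) - 1" using zero0[OF \<mu>M] fin by simp
    also have "\<dots> \<le> card (zeros l) - 1" using d1(2) \<mu>M \<mu> \<delta> by (intro diff_le_mono) auto
    also have "\<dots> = card (zeros l - {0})" using zero0[OF lM] fin by simp
    also have "\<dots> \<le> card (insert 1 (zeros l \<inter> {0<..<1}))"
      by (rule card_mono) (use fin in \<open>auto simp: zeros_def\<close>)
    also have "\<dots> \<le> m + 1" unfolding m_def using card_insert_le_m1 by (simp add: card_insert_if fin)
    finally show ?thesis .
  qed
  moreover have "m \<le> nind \<mu>" if \<mu>: "\<bar>\<mu> - l\<bar> < \<delta>" for \<mu>
  proof -
    \<comment> \<open>The lower bound by zeros needs a parameter strictly below \<mu>; the midpoint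
      of \<open>l - \<delta>\<close> and \<mu> is still within \<delta> of l.\<close>
    define \<mu>' where "\<mu>' = ((l - \<delta>) + \<mu>) / 2"
    have m': "\<bar>\<mu>' - l\<bar> < \<delta>" "0 < \<mu>'" "\<mu>' < \<mu>" using \<mu> \<delta> unfolding \<mu>'_def by (auto simp: abs_less_iff field_simps)
    note \<mu>M = inM[OF m'(1)]
    have fin: "finite (zeros \<mu>')" using finite_zeros \<mu>M by auto
    have fin': "finite {x \<in> {0<..1}. z (\<mu>', x) = 0}" by (rule finite_subset[OF _ fin]) (auto simp: zeros_def)
    have "enat (card {x \<in> {0<..1}. z (\<mu>', x) = 0}) \<le> enat (nind \<mu>)"
      using pencil_solution.ind_ge_zeros[OF sol[OF \<mu>M] fin' m'(2,3)] unfolding ind_eq_nind .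
    moreover have "m \<le> card (zeros \<mu>' \<inter> {0<..<1})" unfolding m_def using d2(2) \<mu>M m'(1) \<delta> by auto
    moreover have "card (zeros \<mu>' \<inter> {0<..<1}) \<le> card {x \<in> {0<..1}. z (\<mu>', x) = 0}"
      by (rule card_mono[OF fin']) (auto simp: zeros_def)
    ultimately show ?thesis by simp
  qed
  ultimately show ?thesis using \<delta>(1) by blast
qed

end

section \<open>A discrete renewal theorem\<close>

lemma additive_closed_mult:
  assumes "0 \<in> G" "\<And>x y. x \<in> G \<Longrightarrow> y \<in> G \<Longrightarrow> x + y \<in> (G :: nat set)" "x \<in> G"
  shows "q * x \<in> G"
  by (induction q) (use assms in auto)

text \<open>The least positive difference g of two elements divides every element, because
  \<open>x mod g\<close> is again a difference. So g = 1 and G contains some a and a + 1, and each n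
  from \<open>a * a\<close> on is a combination \<open>(q - r) * a + r * (a + 1)\<close>.\<close>

lemma numerical_semigroup_cofinite:
  fixes G :: "nat set"
  assumes 0: "0 \<in> G" and add: "\<And>x y. x \<in> G \<Longrightarrow> y \<in> G \<Longrightarrow> x + y \<in> G" and gcd: "Gcd G = 1"
  shows "\<exists>s. \<forall>n\<ge>s. n \<in> G"
proof -
  define Q where "Q g \<longleftrightarrow> g > 0 \<and> (\<exists>a\<in>G. a + g \<in> G)" for g
  have "\<exists>x\<in>G. x \<noteq> 0"
  proof (rule ccontr)
    assume "\<not> ?thesis"
    then have "G \<subseteq> {0}" by auto
    then have "Gcd G = 0" by (simp add: Gcd_0_iff)
    then show False using gcd by simp
  qed
  then obtain x where "x \<in> G" "x > 0" by auto
  then have "Q x" using 0 by (auto simp: Q_def intro!: bexI[of _ 0])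
  define g where "g = (LEAST g. Q g)"
  have "Q g" unfolding g_def by (rule LeastI[of Q, OF \<open>Q x\<close>])
  then obtain a where a: "g > 0" "a \<in> G" "a + g \<in> G" by (auto simp: Q_def)
  have min: "\<not> Q h" if "h < g" for h using that not_less_Least unfolding g_def by blast
  have "g dvd x" if x: "x \<in> G" for x
  proof (rule ccontr)
    assume "\<not> g dvd x"
    define q where "q = x div g"
    have "x mod g > 0" "x mod g < g" using \<open>\<not> g dvd x\<close> a(1) by (auto simp: dvd_eq_mod_eq_0)
    moreover have "q * (a + g) + x mod g = q * a + x"
      using div_mult_mod_eq[of x g] by (simp add: q_def algebra_simps)
    moreover have "q * a + x \<in> G" by (intro add additive_closed_mult[OF 0 add] a x)
    moreover have "q * (a + g) \<in> G" by (intro additive_closed_mult[OF 0 add] a)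
    ultimately have "Q (x mod g)" unfolding Q_def by metis
    then show False using min \<open>x mod g < g\<close> by blast
  qed
  then have "g dvd Gcd G" by (rule Gcd_greatest)
  then have "g = 1" using gcd by simp
  have "n \<in> G" if n: "n \<ge> a * a" for n
  proof (cases "a = 0")
    case True
    then have "1 \<in> G" using a \<open>g = 1\<close> by simp
    from additive_closed_mult[OF 0 add this, of n] show ?thesis by simp
  next
    case False
    define q r where "q = n div a" and "r = n mod a"
    have r: "r < a" "n = q * a + r" using False by (auto simp: q_def r_def)
    have "a \<le> q" using n False unfolding q_def by (metis div_le_mono nonzero_mult_div_cancel_right)
    then have "n = (q - r) * a + r * (a + 1)"
      using r by (simp add: algebra_simps flip: add_mult_distrib)
    then show ?thesis using a \<open>g = 1\<close> by (metis add additive_closed_mult[OF 0 add])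
  qed
  then show ?thesis by blast
qed

section \<open>The renewal sequence and its limit\<close>

locale renewal =
  fixes K :: "nat set" and m :: "nat \<Rightarrow> nat" and p :: "nat \<Rightarrow> real"
  assumes fK: "finite K" and m_pos: "\<And>k. k \<in> K \<Longrightarrow> m k > 0"
    and p_pos: "\<And>k. k \<in> K \<Longrightarrow> p k > 0" and p_sum: "(\<Sum>k\<in>K. p k) = 1"
    and gcd: "Gcd (m ` K) = 1"
begin

text \<open>The probability that a sum of independent steps, taking the value m k with probability p
  k, hits j. The guard \<open>0 < m k\<close> provides termination.\<close>

fun u :: "nat \<Rightarrow> real" where
  "u j = (if j = 0 then 1 else \<Sum>k\<in>K. if 0 < m k \<and> m k \<le> j then p k * u (j - m k) else 0)"

declare u.simps [simp del]

lemma u_0: "u 0 = 1"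
  by (simp add: u.simps)

lemma u_step: "j > 0 \<Longrightarrow> u j = (\<Sum>k\<in>K. if m k \<le> j then p k * u (j - m k) else 0)"
  by (subst u.simps) (auto intro!: sum.cong dest: m_pos)

lemma u_bounds: "0 \<le> u j \<and> u j \<le> 1"
proof (induction j rule: less_induct)
  case (less j)
  show ?case
  proof (cases "j = 0")
    case False
    have "0 \<le> (if m k \<le> j then p k * u (j - m k) else 0) \<and> (if m k \<le> j then p k * u (j - m k) else 0) \<le> p k" if k: "k \<in> K" for k
      using less[of "j - m k"] m_pos[OF k] p_pos[OF k] False by (auto simp: mult_left_le)
    then show ?thesis using False p_sum unfolding u_step[OF False[simplified]]
      by (metis (no_types, lifting) sum_mono sum_nonneg)
  qed (simp add: u_0)
qed

definition "mmax = Max (m ` K)"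

lemma K_nonempty: "K \<noteq> {}"
  using p_sum by auto

lemma m_le_mmax: "k \<in> K \<Longrightarrow> m k \<le> mmax"
  unfolding mmax_def using fK by simp

lemma mmax_pos: "mmax > 0"
  using K_nonempty m_pos m_le_mmax by fastforce

lemma u_recursion:
  assumes "j \<ge> mmax" shows "u j = (\<Sum>k\<in>K. p k * u (j - m k))"
proof -
  have "j > 0" using assms mmax_pos by simp
  moreover have "m k \<le> j" if "k \<in> K" for k using m_le_mmax[OF that] assms by simp
  ultimately show ?thesis unfolding u_step[OF \<open>j > 0\<close>] by (intro sum.cong refl) simp
qed

text \<open>Past the window each value is a convex combination of the preceding mmax values.\<close>

lemma lower_bound_propagates:
  assumes w: "\<And>i. j \<le> i \<Longrightarrow> i < j + mmax \<Longrightarrow> c \<le> u i" and i: "j \<le> i"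
  shows "c \<le> u i"
  using i
proof (induction i rule: less_induct)
  case (less i)
  show ?case
  proof (cases "i < j + mmax")
    case False
    have "c = (\<Sum>k\<in>K. p k * c)" using p_sum by (simp flip: sum_distrib_right)
    also have "\<dots> \<le> (\<Sum>k\<in>K. p k * u (i - m k))"
    proof (rule sum_mono)
      fix k assume k: "k \<in> K"
      have "c \<le> u (i - m k)" using less.IH[of "i - m k"] m_pos[OF k] m_le_mmax[OF k] False by simp
      then show "p k * c \<le> p k * u (i - m k)" using p_pos[OF k] by simp
    qed
    also have "\<dots> = u i" using u_recursion[of i] False by simp
    finally show ?thesis .
  qed (use w less.prems in auto)
qed

text \<open>The times that can be hit by sums of steps.\<close>

inductive_set G :: "nat set" where
  zero: "0 \<in> G"
| step: "g \<in> G \<Longrightarrow> k \<in> K \<Longrightarrow> g + m k \<in> G"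

lemma G_add: "y \<in> G \<Longrightarrow> x \<in> G \<Longrightarrow> x + y \<in> G"
proof (induction y rule: G.induct)
  case (step g k) then show ?case using G.step[of "x + g" k] by (simp add: add.assoc)
qed simp

lemma G_cofinite: "\<exists>s. \<forall>n\<ge>s. n \<in> G"
proof (rule numerical_semigroup_cofinite[OF G.zero])
  show "x + y \<in> G" if "x \<in> G" "y \<in> G" for x y by (rule G_add[OF that(2,1)])
  have "m ` K \<subseteq> G" using G.step[OF G.zero] by auto
  then have "Gcd G dvd Gcd (m ` K)" by (intro Gcd_greatest Gcd_dvd) auto
  then show "Gcd G = 1" using gcd by simp
qed

lemma u_pos_on_G: "g \<in> G \<Longrightarrow> u g > 0"
proof (induction rule: G.induct)
  case (step g k)
  have "p k * u g = (if m k \<le> g + m k then p k * u (g + m k - m k) else 0)" by simp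
  also have "\<dots> \<le> (\<Sum>k'\<in>K. if m k' \<le> g + m k then p k' * u (g + m k - m k') else 0)"
  proof (rule member_le_sum[OF step.hyps(2) _ fK])
    fix k' assume "k' \<in> K - {k}"
    then have "p k' > 0" using p_pos by simp
    then show "0 \<le> (if m k' \<le> g + m k then p k' * u (g + m k - m k') else 0)"
      using u_bounds by simp
  qed
  also have "\<dots> = u (g + m k)" using u_step[of "g + m k"] m_pos[OF step.hyps(2)] by simp
  finally show ?case using mult_pos_pos[OF p_pos[OF step.hyps(2)] step.IH] by linarith
qed (simp add: u_0)

text \<open>Let L be the upper limit. A value near L is an average of values hardly exceeding L, so
  each of these is near L too; repeated along elements of G this fills a window of length mmax with
  values near L, and the recursion preserves the lower bound. Positivity follows from a window
  inside G, where u is positive.\<close>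

theorem renewal_limit: "\<exists>c>0. u \<longlonglongrightarrow> c"
proof -
  obtain s0 where s0: "\<And>n. n \<ge> s0 \<Longrightarrow> n \<in> G" using G_cofinite by blast
  define S where "S J = Sup (u ` {J..})" for J
  have bdd: "bdd_above (u ` {J..})" for J using u_bounds by (intro bdd_aboveI[of _ 1]) auto
  have le_S: "u i \<le> S J" if "J \<le> i" for i J
    unfolding S_def by (rule cSup_upper) (use that bdd in auto)
  have "decseq S" unfolding decseq_def S_def by (auto intro!: cSup_subset_mono bdd)
  moreover have "0 \<le> S J" for J using le_S[of J J] u_bounds[of J] by linarith
  ultimately obtain L where L: "S \<longlonglongrightarrow> L" "\<And>J. L \<le> S J" using decseq_convergent by metis
  have upper: "\<exists>J. \<forall>i\<ge>J. u i \<le> L + \<delta>" if "\<delta> > 0" for \<delta>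
  proof -
    have "\<forall>\<^sub>F J in sequentially. S J < L + \<delta>" by (rule order_tendstoD(2)[OF L(1)]) (use that in simp)
    then obtain J where "S J < L + \<delta>" by (auto simp: eventually_sequentially)
    then show ?thesis using le_S[of J] by (intro exI[of _ J]) (auto intro: order_trans less_imp_le)
  qed
  have often: "\<exists>j\<ge>J. u j \<ge> L - \<delta>" if "\<delta> > 0" for \<delta> J
  proof -
    have "L - \<delta> < Sup (u ` {J..})" using L(2)[of J] that by (simp add: S_def)
    then obtain j where "j \<ge> J" "L - \<delta> < u j" by (subst (asm) less_cSup_iff) (use bdd in auto)
    then show ?thesis by (auto intro: less_imp_le)
  qed
  have single: "\<exists>\<delta>>0. \<exists>J. \<forall>j\<ge>J. u j \<ge> L - \<delta> \<longrightarrow> m k \<le> j \<and> u (j - m k) \<ge> L - \<epsilon>" if k: "k \<in> K" and e: "\<epsilon> > 0" for k \<epsilon>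
  proof -
    \<comment> \<open>p k times the shortfall at \<open>j - m k\<close> is at most
      \<open>2 * \<delta>\<close>, so this choice keeps the shortfall within \<epsilon>.\<close>
    define \<delta> where "\<delta> = p k * \<epsilon> / 2"
    have \<delta>: "\<delta> > 0" using p_pos[OF k] e by (simp add: \<delta>_def)
    obtain J where J: "\<And>i. i \<ge> J \<Longrightarrow> u i \<le> L + \<delta>" using upper[OF \<delta>] by blast
    have "m k \<le> j \<and> u (j - m k) \<ge> L - \<epsilon>" if j: "j \<ge> J + mmax" "u j \<ge> L - \<delta>" for j
    proof -
      have mk: "m k \<le> j" using m_le_mmax[OF k] j by simp
      have "u j = p k * u (j - m k) + (\<Sum>i\<in>K - {k}. p i * u (j - m i))"
        using u_recursion[of j] j by (simp add: sum.remove[OF fK k])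
      also have "(\<Sum>i\<in>K - {k}. p i * u (j - m i)) \<le> (\<Sum>i\<in>K - {k}. p i * (L + \<delta>))"
      proof (rule sum_mono)
        fix i assume "i \<in> K - {k}"
        then show "p i * u (j - m i) \<le> p i * (L + \<delta>)"
          using J[of "j - m i"] m_le_mmax[of i] p_pos[of i] j by (intro mult_left_mono) auto
      qed
      also have "\<dots> = (1 - p k) * (L + \<delta>)"
        using p_sum by (simp add: sum.remove[OF fK k] flip: sum_distrib_right)
      finally have "L - \<delta> \<le> p k * u (j - m k) + (1 - p k) * (L + \<delta>)" using j by simp
      then have "p k * (L - u (j - m k)) \<le> 2 * \<delta> - p k * \<delta>" by (simp add: algebra_simps)
      also have "\<dots> \<le> p k * \<epsilon>" using \<delta> p_pos[OF k] by (simp add: \<delta>_def)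
      finally show ?thesis using p_pos[OF k] mk by simp
    qed
    then show ?thesis using \<delta> by blast
  qed
  have good: "\<exists>\<delta>>0. \<exists>J. \<forall>j\<ge>J. u j \<ge> L - \<delta> \<longrightarrow> g \<le> j \<and> u (j - g) \<ge> L - \<epsilon>" if "g \<in> G" "\<epsilon> > 0" for g \<epsilon>
    using that
  proof (induction arbitrary: \<epsilon> rule: G.induct)
    case zero then show ?case by (intro exI[of _ \<epsilon>]) auto
  next
    case (step g k)
    obtain \<delta>1 J1 where 1: "\<delta>1 > 0" "\<And>j. j \<ge> J1 \<Longrightarrow> u j \<ge> L - \<delta>1 \<Longrightarrow> m k \<le> j \<and> u (j - m k) \<ge> L - \<epsilon>"
      using single[OF step.hyps(2) step.prems] by blast
    obtain \<delta>2 J2 where 2: "\<delta>2 > 0" "\<And>j. j \<ge> J2 \<Longrightarrow> u j \<ge> L - \<delta>2 \<Longrightarrow> g \<le> j \<and> u (j - g) \<ge> L - \<delta>1"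
      using step.IH[OF 1(1)] by blast
    have "g + m k \<le> j \<and> u (j - (g + m k)) \<ge> L - \<epsilon>" if j: "j \<ge> J1 + J2 + g" "u j \<ge> L - \<delta>2" for j
    proof -
      have "g \<le> j" "u (j - g) \<ge> L - \<delta>1" using 2(2)[of j] j by auto
      moreover have "J1 \<le> j - g" using j(1) by arith
      ultimately have "m k \<le> j - g" "u (j - g - m k) \<ge> L - \<epsilon>" using 1(2) by blast+
      then show ?thesis using \<open>g \<le> j\<close> by (simp add: diff_diff_left)
    qed
    then show ?case using 2(1) by blast
  qed
  have low: "\<exists>J. \<forall>i\<ge>J. u i \<ge> L - \<epsilon>" if e: "\<epsilon> > 0" for \<epsilon>
  proof -
    \<comment> \<open>mmax consecutive elements of G: stepping back by each of them from one j with
      u j near L produces a full window.\<close>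
    define R where "R = {s0..<s0 + mmax}"
    have "\<forall>g\<in>R. \<exists>\<delta>>0. \<exists>J. \<forall>j\<ge>J. u j \<ge> L - \<delta> \<longrightarrow> g \<le> j \<and> u (j - g) \<ge> L - \<epsilon>"
      using good[OF s0 e] by (auto simp: R_def)
    then obtain \<delta> J where dJ: "\<And>g. g \<in> R \<Longrightarrow> \<delta> g > 0"
      "\<And>g j. g \<in> R \<Longrightarrow> j \<ge> J g \<Longrightarrow> u j \<ge> L - \<delta> g \<Longrightarrow> g \<le> j \<and> u (j - g) \<ge> L - \<epsilon>" by metis
    have R: "finite R" "R \<noteq> {}" using mmax_pos by (auto simp: R_def)
    define \<delta>0 where "\<delta>0 = Min (\<delta> ` R)"
    have d0: "\<delta>0 > 0" "\<And>g. g \<in> R \<Longrightarrow> \<delta>0 \<le> \<delta> g" unfolding \<delta>0_def using R dJ(1) by (auto simp: Min_gr_iff)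
    obtain j where j: "j \<ge> Max (J ` R) + (s0 + mmax)" "u j \<ge> L - \<delta>0" using often[OF d0(1)] by blast
    have w: "u (j - g) \<ge> L - \<epsilon>" if g: "g \<in> R" for g
    proof -
      have "J g \<le> Max (J ` R)" using R g by simp
      then have "J g \<le> j" using j(1) by simp
      then show ?thesis using dJ(2)[OF g] d0(2)[OF g] j(2) by fastforce
    qed
    define j0 where "j0 = j - (s0 + mmax - 1)"
    have "u i \<ge> L - \<epsilon>" if i: "j0 \<le> i" "i < j0 + mmax" for i
    proof -
      have "j - i \<in> R" "i \<le> j" using i j(1) mmax_pos unfolding j0_def R_def by auto
      then show ?thesis using w[of "j - i"] by simp
    qed
    then show ?thesis using lower_bound_propagates[of j0 "L - \<epsilon>"] by blast
  qed
  have lim: "u \<longlonglongrightarrow> L"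
  proof (rule LIMSEQ_I)
    fix r :: real assume r: "0 < r"
    obtain J1 where J1: "\<And>i. i \<ge> J1 \<Longrightarrow> u i \<le> L + r / 2" using upper[of "r / 2"] r by auto
    obtain J2 where J2: "\<And>i. i \<ge> J2 \<Longrightarrow> u i \<ge> L - r / 2" using low[of "r / 2"] r by auto
    have "norm (u i - L) < r" if "i \<ge> max J1 J2" for i
      using J1[of i] J2[of i] that r by (auto simp: abs_less_iff)
    then show "\<exists>no. \<forall>n\<ge>no. norm (u n - L) < r" by blast
  qed
  define c0 where "c0 = Min (u ` {s0..<s0 + mmax})"
  have c0: "c0 > 0" unfolding c0_def using mmax_pos u_pos_on_G s0 by (auto simp: Min_gr_iff)
  have "c0 \<le> u i" if "s0 \<le> i" for i
    by (rule lower_bound_propagates[OF _ that]) (auto simp: c0_def)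
  then have "c0 \<le> L" by (intro LIMSEQ_le_const[OF lim]) blast
  then show ?thesis using lim c0 by (intro exI[of _ L]) auto
qed

text \<open>u is the fundamental solution of the recursion with zero past, so a general
  inhomogeneity b enters by convolution.\<close>

lemma convolution_solution:
  assumes Z: "\<And>j. Z j = (\<Sum>k\<in>K. if m k \<le> j then p k * Z (j - m k) else 0) + b j"
  shows "Z j = (\<Sum>i\<le>j. u (j - i) * b i)"
proof (induction j rule: less_induct)
  case (less j)
  have "(\<Sum>i\<le>j. u (j - i) * b i) = (\<Sum>i<j. u (j - i) * b i) + b j"
    by (simp add: lessThan_Suc_atMost[symmetric] u_0)
  also have "(\<Sum>i<j. u (j - i) * b i) = (\<Sum>i<j. \<Sum>k\<in>K. if m k \<le> j - i then p k * u (j - i - m k) * b i else 0)"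
    by (rule sum.cong[OF refl], subst u_step) (auto simp: sum_distrib_right intro!: sum.cong)
  also have "\<dots> = (\<Sum>k\<in>K. \<Sum>i<j. if m k \<le> j - i then p k * u (j - i - m k) * b i else 0)"
    by (rule sum.swap)
  also have "\<dots> = (\<Sum>k\<in>K. if m k \<le> j then p k * Z (j - m k) else 0)"
  proof (rule sum.cong[OF refl])
    fix k assume k: "k \<in> K"
    show "(\<Sum>i<j. if m k \<le> j - i then p k * u (j - i - m k) * b i else 0) = (if m k \<le> j then p k * Z (j - m k) else 0)"
    proof (cases "m k \<le> j")
      case True
      have "(\<Sum>i<j. if m k \<le> j - i then p k * u (j - i - m k) * b i else 0)
        = (\<Sum>i\<le>j - m k. p k * (u (j - m k - i) * b i))"
        by (rule sum.mono_neutral_cong_right) (use True m_pos[OF k] in \<open>auto simp: algebra_simps\<close>)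
      then show ?thesis using less[of "j - m k"] True m_pos[OF k] by (simp add: sum_distrib_left)
    next
      case False
      then show ?thesis by (auto intro!: sum.neutral)
    qed
  qed
  finally show ?case using Z[of j] by simp
qed

end

text \<open>The convolution satisfies \<open>y (Suc j) = q * y j + x (Suc j)\<close>: the past
  decays geometrically while new terms become small.\<close>

lemma geometric_convolution_null:
  fixes x :: "nat \<Rightarrow> real"
  assumes x: "x \<longlonglongrightarrow> 0" and q: "0 \<le> q" "q < 1"
  shows "(\<lambda>j. \<Sum>i\<le>j. x (j - i) * q ^ i) \<longlonglongrightarrow> 0"
proof (rule LIMSEQ_I)
  fix r :: real assume r: "0 < r"
  define y where "y j = (\<Sum>i\<le>j. x (j - i) * q ^ i)" for j
  have step: "y (Suc j) = q * y j + x (Suc j)" for j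
    unfolding y_def by (subst sum.atMost_Suc_shift) (simp add: sum_distrib_left mult_ac)
  \<comment> \<open>Inputs of size e accumulate to at most
    \<open>e / (1 - q) = r / 2\<close>.\<close>
  define e where "e = r * (1 - q) / 2"
  have e: "e > 0" using r q by (simp add: e_def)
  obtain J where J: "\<And>j. j \<ge> J \<Longrightarrow> \<bar>x j\<bar> < e" using LIMSEQ_D[OF x e] by auto
  have bound: "\<bar>y (J + i)\<bar> \<le> q ^ i * \<bar>y J\<bar> + e / (1 - q)" for i
  proof (induction i)
    case 0 then show ?case using e q by simp
  next
    case (Suc i)
    have "\<bar>y (J + Suc i)\<bar> \<le> q * \<bar>y (J + i)\<bar> + \<bar>x (Suc (J + i))\<bar>"
      using step[of "J + i"] q by (simp add: abs_mult[of q, symmetric] abs_triangle_ineq flip: abs_mult_pos) (metis abs_mult abs_of_nonneg abs_triangle_ineq)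
    also have "\<dots> \<le> q * (q ^ i * \<bar>y J\<bar> + e / (1 - q)) + e"
      using Suc J[of "Suc (J + i)"] q by (intro add_mono mult_left_mono) auto
    also have "\<dots> = q ^ Suc i * \<bar>y J\<bar> + e / (1 - q)" using q by (simp add: field_simps)
    finally show ?case .
  qed
  have "(\<lambda>i. q ^ i * \<bar>y J\<bar>) \<longlonglongrightarrow> 0 * \<bar>y J\<bar>" by (intro tendsto_intros LIMSEQ_power_zero) (use q in auto)
  then have "(\<lambda>i. q ^ i * \<bar>y J\<bar>) \<longlonglongrightarrow> 0" by simp
  from LIMSEQ_D[OF this, of "r / 2"] r obtain I where I: "\<And>i. i \<ge> I \<Longrightarrow> \<bar>q ^ i * \<bar>y J\<bar>\<bar> < r / 2" by auto
  have "norm (y j - 0) < r" if "j \<ge> J + I" for j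
  proof -
    have "\<bar>y j\<bar> \<le> q ^ (j - J) * \<bar>y J\<bar> + e / (1 - q)" using bound[of "j - J"] that by simp
    moreover have "e / (1 - q) = r / 2" using q by (simp add: e_def field_simps)
    moreover have "\<bar>q ^ (j - J) * \<bar>y J\<bar>\<bar> < r / 2" by (rule I) (use that in arith)
    ultimately show ?thesis unfolding real_norm_def by linarith
  qed
  then show "\<exists>no. \<forall>n\<ge>no. norm ((\<Sum>i\<le>n. x (n - i) * q ^ i) - 0) < r" unfolding y_def by blast
qed

section \<open>Asymptotics from the renewal equation\<close>

text \<open>Applied with \<kappa> = \<nu> D / 2, for which \<open>exp (- \<kappa> * m k)\<close> is
  \<open>(a k * \<bar>d k\<bar>) powr (D / 2)\<close>; that these weights sum to 1 is then the
  equation defining D.\<close>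

locale renewal_counting =
  fixes n :: "real \<Rightarrow> nat" and K :: "nat set" and m :: "nat \<Rightarrow> nat" and \<nu> \<kappa> r :: real and C :: nat
  assumes fK: "finite K" and m_pos: "\<And>k. k \<in> K \<Longrightarrow> m k > 0" and gcd: "Gcd (m ` K) = 1"
    and \<nu>: "\<nu> > 0" and \<kappa>: "\<kappa> > 0" and p_sum: "(\<Sum>k\<in>K. exp (- \<kappa> * m k)) = 1"
    and r: "r > 0" and small: "\<And>l. \<bar>l\<bar> \<le> r \<Longrightarrow> n l = 0"
    and lower: "\<And>l. (\<Sum>k\<in>K. n (l * ((-1) ^ m k * exp (- \<nu> * m k)))) \<le> n l"
    and upper: "\<And>l. n l \<le> (\<Sum>k\<in>K. n (l * ((-1) ^ m k * exp (- \<nu> * m k)))) + C"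
    and unbounded: "\<exists>L. (\<forall>l\<ge>L. n l \<ge> 1) \<or> (\<forall>l\<ge>L. n (- l) \<ge> 1)"
    and oscillation: "\<And>l. l > 0 \<Longrightarrow> \<exists>\<delta>>0. \<exists>m. \<forall>\<mu>. \<bar>\<mu> - l\<bar> < \<delta> \<longrightarrow> m \<le> n \<mu> \<and> n \<mu> \<le> m + 1"
begin

sublocale renewal K m "\<lambda>k. exp (- \<kappa> * m k)"
  by unfold_locales (use fK m_pos gcd p_sum in auto)

text \<open>Along \<open>t + j\<close> the sign alternates with \<open>j\<close>; since the sign of \<open>d\<^sub>k\<close> is \<open>(-1)\<close> to the power \<open>m k\<close>, this
  turns the two coupled relations for positive and negative arguments into one scalar renewal equation.\<close>

definition h :: "real \<Rightarrow> nat \<Rightarrow> real" where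
  "h t j = real (n ((-1) ^ j * exp (\<nu> * (t + j))))"

text \<open>For t \<le> t0 all arguments at negative times have modulus at most r, where n vanishes;
  hence the renewal equation starts from zero past.\<close>

definition t0 :: real where "t0 = ln r / \<nu>"

text \<open>The defect of the recursion, which the bracketing confines to [0, C]; not the
  generalized derivative of P.\<close>

definition \<rho> :: "real \<Rightarrow> nat \<Rightarrow> real" where
  "\<rho> t j = h t j - (\<Sum>k\<in>K. if m k \<le> j then h t (j - m k) else 0)"

lemma h_step:
  assumes t: "t \<le> t0" and k: "k \<in> K"
  shows "real (n (((-1) ^ j * exp (\<nu> * (t + j))) * ((-1) ^ m k * exp (- \<nu> * m k)))) = (if m k \<le> j then h t (j - m k) else 0)"
proof -
  have eq: "((-1) ^ j * exp (\<nu> * (t + j))) * ((-1) ^ m k * exp (- \<nu> * m k)) = (-1) ^ (j + m k) * exp (\<nu> * (t + real j - real (m k)))"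
    by (simp add: power_add exp_add[symmetric] algebra_simps)
  show ?thesis
  proof (cases "m k \<le> j")
    case True
    \<comment> \<open>j + m k and j - m k have the same parity, so the sign
      \<open>(-1) ^ m k\<close> fits the alternation.\<close>
    then have "j + m k = (j - m k) + 2 * m k" by simp
    then have "(-1) ^ (j + m k) = ((-1) ^ (j - m k) :: real)" by (simp only: power_add power_mult) simp
    then show ?thesis using True unfolding eq h_def by (simp add: of_nat_diff algebra_simps)
  next
    case False
    then have "\<nu> * (t + real j - real (m k)) \<le> \<nu> * t0" using t \<nu> by (intro mult_left_mono) auto
    also have "\<dots> = ln r" using \<nu> by (simp add: t0_def)
    finally have "exp (\<nu> * (t + real j - real (m k))) \<le> r" using r by (metis exp_le_cancel_iff exp_ln)
    then show ?thesis using False unfolding eq by (subst small) (auto simp: abs_mult power_abs)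
  qed
qed

lemma \<rho>_bounds:
  assumes t: "t \<le> t0" shows "0 \<le> \<rho> t j" "\<rho> t j \<le> C"
proof -
  define l where "l = (-1) ^ j * exp (\<nu> * (t + j))"
  have eq: "real (\<Sum>k\<in>K. n (l * ((-1) ^ m k * exp (- \<nu> * m k)))) = (\<Sum>k\<in>K. if m k \<le> j then h t (j - m k) else 0)"
    unfolding l_def of_nat_sum by (rule sum.cong[OF refl h_step[OF t]])
  have "real (\<Sum>k\<in>K. n (l * ((-1) ^ m k * exp (- \<nu> * m k)))) \<le> real (n l)"
    using lower[of l] by (simp only: of_nat_le_iff)
  then show "0 \<le> \<rho> t j" unfolding \<rho>_def eq by (simp add: h_def l_def)
  have "real (n l) \<le> real ((\<Sum>k\<in>K. n (l * ((-1) ^ m k * exp (- \<nu> * m k)))) + C)"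
    using upper[of l] by (simp only: of_nat_le_iff)
  then show "\<rho> t j \<le> C" unfolding \<rho>_def of_nat_add eq by (simp add: h_def l_def)
qed

text \<open>Division by the expected growth gives a recursion whose weights sum to 1 and whose
  inhomogeneity b decays geometrically.\<close>

definition Z :: "real \<Rightarrow> nat \<Rightarrow> real" where
  "Z t j = h t j * exp (- \<kappa> * (t + j))"

definition b :: "real \<Rightarrow> nat \<Rightarrow> real" where
  "b t j = \<rho> t j * exp (- \<kappa> * (t + j))"

lemma Z_equation: "Z t j = (\<Sum>k\<in>K. if m k \<le> j then exp (- \<kappa> * m k) * Z t (j - m k) else 0) + b t j"
proof -
  have "(\<Sum>k\<in>K. if m k \<le> j then exp (- \<kappa> * m k) * Z t (j - m k) else 0)
    = (\<Sum>k\<in>K. if m k \<le> j then h t (j - m k) else 0) * exp (- \<kappa> * (t + j))"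
    unfolding sum_distrib_right Z_def
    by (rule sum.cong[OF refl]) (auto simp: of_nat_diff algebra_simps exp_add[symmetric] simp flip: exp_add)
  then show ?thesis by (simp add: Z_def b_def \<rho>_def algebra_simps)
qed

lemma Z_convolution: "Z t j = (\<Sum>i\<le>j. u (j - i) * b t i)"
  by (rule convolution_solution[OF Z_equation])

definition c :: real where "c = lim u"

lemma c: "u \<longlonglongrightarrow> c" "c > 0"
proof -
  obtain c' where c': "c' > 0" "u \<longlonglongrightarrow> c'" using renewal_limit by blast
  then have "c = c'" unfolding c_def by (simp add: limI)
  then show "u \<longlonglongrightarrow> c" "c > 0" using c' by auto
qed

definition q :: real where "q = exp (- \<kappa>)"

lemma q: "0 < q" "q < 1"
  using \<kappa> by (auto simp: q_def)

text \<open>Uniform over the window [t0 - 2, t0] of one period: \<open>exp (- \<kappa> * t)\<close>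
  is largest at its left end.\<close>

definition B :: real where "B = C * exp (- \<kappa> * (t0 - 2))"

lemma b_bounds:
  assumes t: "t0 - 2 \<le> t" "t \<le> t0" shows "0 \<le> b t j" "b t j \<le> B * q ^ j"
proof -
  show "0 \<le> b t j" using \<rho>_bounds(1)[OF t(2)] by (simp add: b_def)
  have "b t j = \<rho> t j * (exp (- \<kappa> * t) * q ^ j)"
    unfolding b_def q_def by (simp add: exp_of_nat_mult[symmetric] exp_add[symmetric] algebra_simps)
  also have "\<dots> \<le> C * (exp (- \<kappa> * (t0 - 2)) * q ^ j)"
    using t \<kappa> q \<rho>_bounds[OF t(2)] by (intro mult_mono) auto
  finally show "b t j \<le> B * q ^ j" by (simp add: B_def)
qed

text \<open>The limit of the convolution of u with b, as u tends to c and b is summable.\<close>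

definition S :: "real \<Rightarrow> real" where "S t = c * (\<Sum>i. b t i)"

lemma summable_b:
  assumes t: "t0 - 2 \<le> t" "t \<le> t0" shows "summable (b t)"
proof (rule summable_comparison_test'[where g="\<lambda>j. B * q ^ j" and N=0])
  show "summable (\<lambda>j. B * q ^ j)" using q by (intro summable_mult summable_geometric) auto
  show "norm (b t j) \<le> B * q ^ j" for j using b_bounds[OF t, of j] by simp
qed

text \<open>If all b t i vanished, so would n along the whole alternating sequence. But its even
  terms are arbitrarily large positive arguments and its odd terms arbitrarily large negative ones,
  and on one side n is eventually at least 1.\<close>

lemma S_pos:
  assumes t: "t0 - 2 \<le> t" "t \<le> t0" shows "S t > 0"
proof -
  have "\<exists>i. b t i > 0"
  proof (rule ccontr)
    assume "\<not> (\<exists>i. b t i > 0)"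
    then have "b t i = 0" for i using b_bounds(1)[OF t, of i] by (metis less_eq_real_def)
    then have Z0: "Z t j = 0" for j unfolding Z_convolution by simp
    obtain L where L: "(\<forall>l\<ge>L. n l \<ge> 1) \<or> (\<forall>l\<ge>L. n (- l) \<ge> 1)" using unbounded by blast
    obtain N :: nat where N: "real N \<ge> ln (max L 1) / \<nu> - t" using real_arch_simple by blast
    have big: "exp (\<nu> * (t + real j)) \<ge> L" if "j \<ge> N" for j
    proof -
      have "ln (max L 1) / \<nu> \<le> t + real j" using N that by linarith
      then have "ln (max L 1) \<le> \<nu> * (t + real j)" using \<nu> by (simp add: divide_le_eq mult.commute)
      then have "max L 1 \<le> exp (\<nu> * (t + real j))" by (metis exp_le_cancel_iff exp_ln less_max_iff_disj zero_less_one)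
      then show ?thesis by simp
    qed
    from L show False
    proof
      assume "\<forall>l\<ge>L. n l \<ge> 1"
      then have "n (exp (\<nu> * (t + real (2 * N)))) \<ge> 1" using big[of "2 * N"] by simp
      then show False using Z0[of "2 * N"] by (simp add: Z_def h_def)
    next
      assume "\<forall>l\<ge>L. n (- l) \<ge> 1"
      then have "n (- exp (\<nu> * (t + real (2 * N + 1)))) \<ge> 1" using big[of "2 * N + 1"] by simp
      then show False using Z0[of "2 * N + 1"] by (simp add: Z_def h_def)
    qed
  qed
  then obtain i where "b t i > 0" by blast
  then have "(\<Sum>i. b t i) > 0" using suminf_pos2[OF summable_b[OF t]] b_bounds(1)[OF t] by blast
  then show ?thesis using c(2) by (simp add: S_def)
qed

text \<open>The error consists of the convolution of u - c with b and of the tail of the series of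
  b; both are controlled by the geometric bound on b, which is independent of t.\<close>

lemma Z_uniform_limit:
  assumes e: "\<epsilon> > 0"
  shows "\<exists>J. \<forall>j\<ge>J. \<forall>t. t0 - 2 \<le> t \<longrightarrow> t \<le> t0 \<longrightarrow> \<bar>Z t j - S t\<bar> \<le> \<epsilon>"
proof -
  define x where "x j = \<bar>u j - c\<bar>" for j
  have "x \<longlonglongrightarrow> 0" unfolding x_def using tendsto_rabs[OF LIM_zero[OF c(1)]] by simp
  from geometric_convolution_null[OF this] q
  have 1: "(\<lambda>j. \<Sum>i\<le>j. x (j - i) * q ^ i) \<longlonglongrightarrow> 0" by simp
  have sq: "summable (\<lambda>i. q ^ i)" using q by (intro summable_geometric) simp
  have 2: "(\<lambda>j. \<Sum>i. q ^ (i + Suc j)) \<longlonglongrightarrow> 0"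
    using suminf_exist_split2[OF sq] by (rule LIMSEQ_Suc)
  define \<eta> where "\<eta> j = B * (\<Sum>i\<le>j. x (j - i) * q ^ i) + c * (B * (\<Sum>i. q ^ (i + Suc j)))" for j
  have "\<eta> \<longlonglongrightarrow> B * 0 + c * (B * 0)" unfolding \<eta>_def by (intro tendsto_intros 1 2)
  then have "\<eta> \<longlonglongrightarrow> 0" by simp
  from LIMSEQ_D[OF this e] obtain J where J: "\<And>j. j \<ge> J \<Longrightarrow> \<bar>\<eta> j\<bar> < \<epsilon>" by auto
  have "\<bar>Z t j - S t\<bar> \<le> \<eta> j" if t: "t0 - 2 \<le> t" "t \<le> t0" for t j
  proof -
    note sb = summable_b[OF t]
    have "(\<Sum>i. b t i) = (\<Sum>i. b t (i + Suc j)) + (\<Sum>i<Suc j. b t i)" by (rule suminf_split_initial_segment[OF sb])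
    then have eq: "Z t j - S t = (\<Sum>i\<le>j. (u (j - i) - c) * b t i) - c * (\<Sum>i. b t (i + Suc j))"
      unfolding Z_convolution S_def lessThan_Suc_atMost
      by (simp add: left_diff_distrib sum_subtractf sum_distrib_left[symmetric] algebra_simps)
    have 0: "\<bar>Z t j - S t\<bar> \<le> \<bar>\<Sum>i\<le>j. (u (j - i) - c) * b t i\<bar> + \<bar>c * (\<Sum>i. b t (i + Suc j))\<bar>"
      unfolding eq by (rule abs_triangle_ineq4)
    have 3: "\<bar>\<Sum>i\<le>j. (u (j - i) - c) * b t i\<bar> \<le> (\<Sum>i\<le>j. x (j - i) * (B * q ^ i))"
    proof (rule order_trans[OF sum_abs sum_mono])
      fix i
      show "\<bar>(u (j - i) - c) * b t i\<bar> \<le> x (j - i) * (B * q ^ i)"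
        using b_bounds[OF t, of i] by (auto simp: abs_mult x_def intro!: mult_left_mono)
    qed
    have 4: "(\<Sum>i\<le>j. x (j - i) * (B * q ^ i)) = B * (\<Sum>i\<le>j. x (j - i) * q ^ i)"
      by (simp add: sum_distrib_left mult_ac)
    have 5: "\<bar>c * (\<Sum>i. b t (i + Suc j))\<bar> \<le> c * (B * (\<Sum>i. q ^ (i + Suc j)))"
    proof -
      have sb': "summable (\<lambda>i. b t (i + Suc j))" by (rule summable_ignore_initial_segment[OF sb])
      have sq': "summable (\<lambda>i. q ^ (i + Suc j))" by (rule summable_ignore_initial_segment[OF sq])
      have "0 \<le> (\<Sum>i. b t (i + Suc j))" by (rule suminf_nonneg[OF sb' b_bounds(1)[OF t]])
      moreover have "(\<Sum>i. b t (i + Suc j)) \<le> (\<Sum>i. B * q ^ (i + Suc j))"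
        by (rule suminf_le[OF b_bounds(2)[OF t] sb' summable_mult[OF sq']])
      moreover have "(\<Sum>i. B * q ^ (i + Suc j)) = B * (\<Sum>i. q ^ (i + Suc j))" by (rule suminf_mult[OF sq'])
      ultimately show ?thesis using c(2) by (simp add: abs_mult)
    qed
    show ?thesis using 0 3 5 unfolding \<eta>_def 4 by linarith
  qed
  note le = this
  show ?thesis
  proof (intro exI[of _ J] allI impI)
    fix j t assume "J \<le> j" "t0 - 2 \<le> t" "t \<le> t0"
    then show "\<bar>Z t j - S t\<bar> \<le> \<epsilon>" using le[of t j] J[of j] by linarith
  qed
qed

text \<open>Reduction modulo 2 and not modulo 1: an even number of steps leaves the sign of the
  argument unchanged.\<close>

definition shift :: "real \<Rightarrow> int" where "shift x = \<lceil>(x - t0) / 2\<rceil>"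

definition s :: "real \<Rightarrow> real" where "s x = S (x - 2 * shift x)"

lemma base_bounds: "t0 - 2 \<le> x - 2 * shift x" "x - 2 * shift x \<le> t0"
proof -
  define c where "c = real_of_int \<lceil>(x - t0) / 2\<rceil>"
  have "c < (x - t0) / 2 + 1" "(x - t0) / 2 \<le> c"
    using ceiling_correct[of "(x - t0) / 2"] unfolding c_def by linarith+
  moreover have "x - 2 * shift x = x - 2 * c" by (simp add: shift_def c_def)
  ultimately show "t0 - 2 \<le> x - 2 * shift x" "x - 2 * shift x \<le> t0" by (simp_all add: field_simps)
qed

lemma s_pos: "s x > 0"
  unfolding s_def by (rule S_pos[OF base_bounds])

lemma s_periodic: "s (x + 2) = s x"
proof -
  have eq: "(x + 2 - t0) / 2 = (x - t0) / 2 + 1" by (simp add: field_simps)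
  have "shift (x + 2) = shift x + 1"
    unfolding shift_def eq using ceiling_add_of_int[of "(x - t0) / 2" 1] by (simp only: of_int_1)
  then show ?thesis unfolding s_def by (simp add: algebra_simps)
qed

text \<open>A positive argument sits at the even time \<open>2 * shift x\<close>, a negative one at
  the odd time \<open>2 * shift (x - 1) + 1\<close>; the odd extra step is the origin of
  \<open>s (x - 1)\<close>.\<close>

lemma uniform_asymptotics:
  assumes e: "\<epsilon> > 0"
  shows "\<exists>X. \<forall>x\<ge>X. \<bar>real (n (exp (\<nu> * x))) * exp (- \<kappa> * x) - s x\<bar> \<le> \<epsilon> \<and>
    \<bar>real (n (- exp (\<nu> * x))) * exp (- \<kappa> * x) - s (x - 1)\<bar> \<le> \<epsilon>"
proof -
  obtain J where J: "\<And>j t. j \<ge> J \<Longrightarrow> t0 - 2 \<le> t \<Longrightarrow> t \<le> t0 \<Longrightarrow> \<bar>Z t j - S t\<bar> \<le> \<epsilon>"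
    using Z_uniform_limit[OF e] by blast
  have pos: "\<exists>i::nat. shift x = int i \<and> 2 * i \<ge> J" if x: "x \<ge> t0 + J" for x
  proof -
    have "real J / 2 \<le> (x - t0) / 2" using x by simp
    also have "\<dots> \<le> shift x" unfolding shift_def by (rule le_of_int_ceiling)
    finally have "real J \<le> 2 * real_of_int (shift x)" by simp
    then have "int J \<le> 2 * shift x" by linarith
    then show ?thesis by (intro exI[of _ "nat (shift x)"]) auto
  qed
  have "\<bar>real (n (exp (\<nu> * x))) * exp (- \<kappa> * x) - s x\<bar> \<le> \<epsilon> \<and>
    \<bar>real (n (- exp (\<nu> * x))) * exp (- \<kappa> * x) - s (x - 1)\<bar> \<le> \<epsilon>" if x: "x \<ge> t0 + J + 1" for x
  proof
    have "x \<ge> t0 + J" "x - 1 \<ge> t0 + J" using x by auto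
    then obtain i i' where i: "shift x = int i" "2 * i \<ge> J" and i': "shift (x - 1) = int i'" "2 * i' \<ge> J"
      using pos by meson
    have "Z (x - 2 * shift x) (2 * i) = real (n (exp (\<nu> * x))) * exp (- \<kappa> * x)"
      unfolding Z_def h_def i by (simp add: power_mult)
    then show "\<bar>real (n (exp (\<nu> * x))) * exp (- \<kappa> * x) - s x\<bar> \<le> \<epsilon>"
      using J[OF i(2) base_bounds, of x] unfolding s_def by simp
    have "Z (x - 1 - 2 * shift (x - 1)) (2 * i' + 1) = real (n (- exp (\<nu> * x))) * exp (- \<kappa> * x)"
      unfolding Z_def h_def i' by (simp add: power_mult)
    then show "\<bar>real (n (- exp (\<nu> * x))) * exp (- \<kappa> * x) - s (x - 1)\<bar> \<le> \<epsilon>"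
      using J[OF _ base_bounds, of "2 * i' + 1" "x - 1"] i'(2) unfolding s_def by simp
  qed
  then show ?thesis by blast
qed

lemma s_periodic_nat: "s (x + 2 * real i) = s x"
proof (induction i)
  case (Suc i)
  have "x + 2 * real (Suc i) = (x + 2 * real i) + 2" by simp
  show ?case unfolding \<open>x + 2 * real (Suc i) = _\<close> s_periodic by (rule Suc.IH)
qed simp

text \<open>The approximants jump, so uniform convergence alone does not suffice. Periodicity moves
  x0 far to the right, where the weight \<open>exp (- \<kappa> * x)\<close> is at most \<epsilon>
  and a local oscillation of n by 1 changes the approximant by at most \<epsilon>.\<close>

lemma s_continuous: "continuous_on UNIV s"
  unfolding continuous_on_iff
proof (intro ballI allI impI)
  fix x0 e :: real assume e: "e > 0"
  define \<epsilon> where "\<epsilon> = e / 5"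
  have \<epsilon>: "\<epsilon> > 0" using e by (simp add: \<epsilon>_def)
  obtain X where X: "\<And>x. x \<ge> X \<Longrightarrow> \<bar>real (n (exp (\<nu> * x))) * exp (- \<kappa> * x) - s x\<bar> \<le> \<epsilon>"
    using uniform_asymptotics[OF \<epsilon>] by blast
  \<comment> \<open>Beyond X the approximation is good, beyond
    \<open>- ln \<epsilon> / \<kappa>\<close> the weight is at most \<epsilon>.\<close>
  define Y where "Y = max X (- ln \<epsilon> / \<kappa>)"
  obtain i :: nat where i: "real i \<ge> Y + 1 - x0" "i \<ge> 0" using real_arch_simple by auto
  have far: "x + 2 * real i \<ge> Y" if "\<bar>x - x0\<bar> < 1" for x using that i by (auto simp: abs_less_iff)
  define f where "f x = real (n (exp (\<nu> * (x + 2 * real i))))" for x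
  define E where "E x = exp (- \<kappa> * (x + 2 * real i))" for x
  have approx: "\<bar>f x * E x - s x\<bar> \<le> \<epsilon>" if "\<bar>x - x0\<bar> < 1" for x
    using X[of "x + 2 * real i"] far[OF that] unfolding f_def E_def s_periodic_nat Y_def by simp
  have E: "0 < E x" "E x \<le> \<epsilon>" if "\<bar>x - x0\<bar> < 1" for x
  proof -
    have "- ln \<epsilon> / \<kappa> \<le> x + 2 * real i" using far[OF that] by (simp add: Y_def)
    then have "- \<kappa> * (x + 2 * real i) \<le> ln \<epsilon>" using \<kappa> by (simp add: field_simps)
    then show "E x \<le> \<epsilon>" unfolding E_def using \<epsilon> by (metis exp_le_cancel_iff exp_ln)
  qed (simp add: E_def)
  obtain \<delta> k where \<delta>: "\<delta> > 0" "\<And>\<mu>. \<bar>\<mu> - exp (\<nu> * (x0 + 2 * real i))\<bar> < \<delta> \<Longrightarrow> k \<le> n \<mu> \<and> n \<mu> \<le> k + 1"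
    using oscillation[of "exp (\<nu> * (x0 + 2 * real i))"] by auto
  have "isCont (\<lambda>x. exp (\<nu> * (x + 2 * real i))) x0" by (intro continuous_intros)
  then obtain d1 where d1: "d1 > 0" "\<And>x. \<bar>x - x0\<bar> < d1 \<Longrightarrow> \<bar>exp (\<nu> * (x + 2 * real i)) - exp (\<nu> * (x0 + 2 * real i))\<bar> < \<delta>"
    using \<delta>(1) unfolding continuous_at_eps_delta dist_real_def by blast
  have "isCont (\<lambda>x. f x0 * E x) x0" unfolding E_def by (intro continuous_intros)
  then obtain d2 where d2: "d2 > 0" "\<And>x. \<bar>x - x0\<bar> < d2 \<Longrightarrow> \<bar>f x0 * E x - f x0 * E x0\<bar> < \<epsilon>"
    using \<epsilon> unfolding continuous_at_eps_delta dist_real_def by blast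
  define d where "d = min 1 (min d1 d2)"
  have "dist (s x) (s x0) < e" if x: "dist x x0 < d" for x
  proof -
    have xd: "\<bar>x - x0\<bar> < 1" "\<bar>x - x0\<bar> < d1" "\<bar>x - x0\<bar> < d2" using x by (auto simp: d_def dist_real_def)
    have "\<bar>f x - f x0\<bar> \<le> 1"
      using \<delta>(2)[OF d1(2)[OF xd(2)]] \<delta>(2)[of "exp (\<nu> * (x0 + 2 * real i))"] \<delta>(1) unfolding f_def by auto
    then have "\<bar>f x - f x0\<bar> * E x \<le> 1 * \<epsilon>" using E[OF xd(1)] by (intro mult_mono) auto
    then have 1: "\<bar>f x * E x - f x0 * E x\<bar> \<le> \<epsilon>"
      using E(1)[OF xd(1)] by (simp add: abs_mult flip: left_diff_distrib)
    have 2: "\<bar>f x0 * E x - f x0 * E x0\<bar> < \<epsilon>" by (rule d2(2)[OF xd(3)])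
    have 3: "\<bar>f x * E x - s x\<bar> \<le> \<epsilon>" "\<bar>f x0 * E x0 - s x0\<bar> \<le> \<epsilon>" using approx xd(1) by auto
    have "\<bar>s x - s x0\<bar> < 5 * \<epsilon>" using 1 2 3 \<epsilon> by linarith
    then show ?thesis by (simp add: dist_real_def \<epsilon>_def)
  qed
  moreover have "d > 0" using d1(1) d2(1) by (simp add: d_def)
  ultimately show "\<exists>d>0. \<forall>x'\<in>UNIV. dist x' x0 < d \<longrightarrow> dist (s x') (s x0) < e" by blast
qed

end

theorem mainTheorem1:
  fixes N :: nat and a d \<beta> :: "nat \<Rightarrow> real" and P :: "real \<Rightarrow> real" and \<nu> D :: real
  assumes "self_similarity_parameters N a d"
    and "self_similar N a d \<beta> P"
    and "arithmetic_step N a d \<nu>"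
    and "is_spectral_order N a d D" and "D > 0"
    and "\<exists>y\<in>W21_0. generalized_derivative P y \<noteq> 0"
    and "\<forall>k\<in>{1..N}. d k > 0 \<longrightarrow> (\<exists>m::int. even m \<and> ln (a k * \<bar>d k\<bar>) / \<nu> = of_int m)"
    and "\<forall>k\<in>{1..N}. d k < 0 \<longrightarrow> (\<exists>m::int. odd m \<and> ln (a k * \<bar>d k\<bar>) / \<nu> = of_int m)"
  shows "\<exists>s :: real \<Rightarrow> real. continuous_on UNIV s \<and> (\<forall>t. s t > 0) \<and> (\<forall>t. s (t + 2) = s t) \<and>
    (\<exists>\<epsilon> :: real \<Rightarrow> real. (\<epsilon> \<longlongrightarrow> 0) at_top \<and>
      (\<forall>\<^sub>F l in at_top. ereal_of_enat (ind (T_pencil P l))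
         = ereal (l powr (D / 2) * (s (ln l / \<nu>) + \<epsilon> l)))) \<and>
    (\<exists>\<epsilon> :: real \<Rightarrow> real. (\<epsilon> \<longlongrightarrow> 0) at_bot \<and>
      (\<forall>\<^sub>F l in at_bot. ereal_of_enat (ind (T_pencil P l))
         = ereal (\<bar>l\<bar> powr (D / 2) * (s (ln \<bar>l\<bar> / \<nu> - 1) + \<epsilon> l))))"
proof -
  interpret similarity N a d \<beta> P by unfold_locales (rule assms(1), rule assms(2))
  have \<nu>: "\<nu> > 0" and mult: "logs_multiples_of N a d \<nu>"
    and maximal: "\<And>\<mu>. \<mu> > 0 \<Longrightarrow> logs_multiples_of N a d \<mu> \<Longrightarrow> \<mu> \<le> \<nu>"
    using assms(3) by (auto simp: arithmetic_step_def)
  define K where "K = {k \<in> {1..N}. d k \<noteq> 0}"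
  \<comment> \<open>The quotient is an integer by arithmetic self-similarity, so the floor is exact;
    it is negative because \<open>a k * \<bar>d k\<bar> < 1\<close>, which makes m k
    positive.\<close>
  define z where "z k = \<lfloor>ln (a k * \<bar>d k\<bar>) / \<nu>\<rfloor>" for k
  define m where "m k = nat (- z k)" for k
  define \<kappa> where "\<kappa> = \<nu> * D / 2"
  have K: "k \<in> {1..N}" "d k \<noteq> 0" "a k > 0" if "k \<in> K" for k
    using that a_pos by (auto simp: K_def)
  have pos: "a k * \<bar>d k\<bar> > 0" if "k \<in> K" for k using K[OF that] by simp
  have lz: "ln (a k * \<bar>d k\<bar>) = z k * \<nu>" if k: "k \<in> K" for k
  proof -
    obtain i :: int where "ln (a k * \<bar>d k\<bar>) = of_int i * \<nu>"
      using mult K(1,2)[OF k] unfolding logs_multiples_of_def by blast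
    then show ?thesis using \<nu> by (simp add: z_def)
  qed
  \<comment> \<open>\<open>(a k * \<bar>d k\<bar>)^2 = a k * (a k * (d k)^2)\<close>, where the
    first factor is at most 1 and the second is less than 1 by the condition on the
    parameters.\<close>
  have lt1: "a k * \<bar>d k\<bar> < 1" if k: "k \<in> K" for k
  proof -
    have nonneg: "0 \<le> a j" "0 \<le> a j * (d j)\<^sup>2" if "j \<in> {1..N}" for j using a_pos[OF that] by simp_all
    have "a k * (d k)\<^sup>2 \<le> (\<Sum>j=1..N. a j * (d j)\<^sup>2)"
      using K(1)[OF k] nonneg(2) by (intro member_le_sum) auto
    then have 1: "a k * (d k)\<^sup>2 < 1" using params by (simp add: self_similarity_parameters_def)
    have "a k \<le> (\<Sum>j=1..N. a j)" using K(1)[OF k] nonneg(1) by (intro member_le_sum) auto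
    then have 2: "a k \<le> 1" using a_sum by simp
    have "(a k * \<bar>d k\<bar>)\<^sup>2 = a k * (a k * (d k)\<^sup>2)" by (simp add: power2_eq_square)
    also have "\<dots> \<le> 1 * (a k * (d k)\<^sup>2)" using 2 K(3)[OF k] by (intro mult_right_mono) auto
    finally have "(a k * \<bar>d k\<bar>)\<^sup>2 < 1\<^sup>2" using 1 by simp
    then show ?thesis by (rule power2_less_imp_less) simp
  qed
  have zneg: "z k < 0" if k: "k \<in> K" for k
  proof -
    have "z k * \<nu> < 0" using lz[OF k] ln_less_zero[OF pos[OF k] lt1[OF k]] by simp
    then show ?thesis using \<nu> by (simp add: mult_less_0_iff)
  qed
  have m_pos: "m k > 0" if "k \<in> K" for k using zneg[OF that] by (simp add: m_def)
  have zm: "real_of_int (z k) = - real (m k)" if "k \<in> K" for k using zneg[OF that] by (simp add: m_def)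
  have abs: "exp (- \<nu> * m k) = a k * \<bar>d k\<bar>" if k: "k \<in> K" for k
  proof -
    have "- \<nu> * m k = ln (a k * \<bar>d k\<bar>)" unfolding lz[OF k] zm[OF k] by simp
    then show ?thesis using pos[OF k] by simp
  qed
  \<comment> \<open>Here both parity conditions enter: they say that the sign of d k is
    \<open>(-1) ^ m k\<close>.\<close>
  have signed: "(-1) ^ m k * exp (- \<nu> * m k) = a k * d k" if k: "k \<in> K" for k
  proof (cases "d k > 0")
    case True
    then obtain i :: int where "even i" "ln (a k * \<bar>d k\<bar>) / \<nu> = of_int i" using assms(7) K(1)[OF k] by blast
    then have "even (z k)" by (simp add: z_def)
    then have "even (m k)" using zneg[OF k] by (simp add: m_def even_nat_iff)
    then show ?thesis using True unfolding abs[OF k] by simp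
  next
    case False
    then have neg: "d k < 0" using K(2)[OF k] by simp
    then obtain i :: int where "odd i" "ln (a k * \<bar>d k\<bar>) / \<nu> = of_int i" using assms(8) K(1)[OF k] by blast
    then have "odd (z k)" by (simp add: z_def)
    then have "odd (m k)" using zneg[OF k] by (simp add: m_def even_nat_iff)
    then show ?thesis using neg unfolding abs[OF k] by simp
  qed
  have psum: "(\<Sum>k\<in>K. exp (- \<kappa> * m k)) = 1"
  proof -
    have "exp (- \<kappa> * m k) = (a k * \<bar>d k\<bar>) powr (D / 2)" if k: "k \<in> K" for k
      using pos[OF k] K(2,3)[OF k] unfolding powr_def lz[OF k] zm[OF k] by (simp add: \<kappa>_def)
    then show ?thesis using assms(4) unfolding is_spectral_order_def K_def[symmetric] by simp
  qed
  have Kne: "K \<noteq> {}" using psum by auto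
  \<comment> \<open>A common divisor g of all m k makes \<open>g * \<nu>\<close> an admissible step,
    so maximality of \<nu> forces g = 1.\<close>
  have gcd: "Gcd (m ` K) = 1"
  proof -
    define g where "g = Gcd (m ` K)"
    have g: "g > 0" unfolding g_def using Kne m_pos by (auto simp: Gcd_0_iff intro!: Nat.gr0I) fastforce
    have "logs_multiples_of N a d (g * \<nu>)"
      unfolding logs_multiples_of_def
    proof (intro ballI impI)
      fix k assume "k \<in> {1..N}" "d k \<noteq> 0"
      then have k: "k \<in> K" by (simp add: K_def)
      then have "g dvd m k" by (simp add: g_def)
      then obtain i where "m k = g * i" by blast
      then have "ln (a k * \<bar>d k\<bar>) = of_int (- int i) * (g * \<nu>)" unfolding lz[OF k] zm[OF k] by simp
      then show "\<exists>i::int. ln (a k * \<bar>d k\<bar>) = of_int i * (g * \<nu>)" by blast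
    qed
    then have "g * \<nu> \<le> \<nu>" using maximal[of "g * \<nu>"] g \<nu> by simp
    then show ?thesis using g \<nu> by (simp add: g_def)
  qed
  obtain r where r: "r > 0" "\<And>l. \<bar>l\<bar> \<le> r \<Longrightarrow> ind (T_pencil P l) = 0" using ind_small[OF P_L2] by blast
  have small: "nind l = 0" if "\<bar>l\<bar> \<le> r" for l using r(2)[OF that] by (simp add: ind_eq_nind zero_enat_def)
  \<comment> \<open>Indices with d k = 0 contribute the index at parameter 0, which is 0.\<close>
  have sumK: "(\<Sum>k\<in>K. nind (l * ((-1) ^ m k * exp (- \<nu> * m k)))) = (\<Sum>k=1..N. nind (l * (a k * d k)))" for l
  proof -
    have "(\<Sum>k\<in>K. nind (l * ((-1) ^ m k * exp (- \<nu> * m k)))) = (\<Sum>k\<in>K. nind (l * (a k * d k)))"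
      by (rule sum.cong[OF refl]) (simp only: signed)
    also have "\<dots> = (\<Sum>k=1..N. nind (l * (a k * d k)))"
      by (rule sum.mono_neutral_left) (use small[of 0] r(1) in \<open>auto simp: K_def\<close>)
    finally show ?thesis .
  qed
  interpret R: renewal_counting nind K m \<nu> \<kappa> r "N - 1"
  proof unfold_locales
    show "finite K" by (simp add: K_def)
    show "\<kappa> > 0" using \<nu> assms(5) by (simp add: \<kappa>_def)
    show "(\<Sum>k\<in>K. nind (l * ((-1) ^ m k * exp (- \<nu> * m k)))) \<le> nind l" for l
      unfolding sumK by (rule nind_lower)
    show "nind l \<le> (\<Sum>k\<in>K. nind (l * ((-1) ^ m k * exp (- \<nu> * m k)))) + (N - 1)" for l
      unfolding sumK by (rule nind_upper)
    show "\<exists>L. (\<forall>l\<ge>L. nind l \<ge> 1) \<or> (\<forall>l\<ge>L. nind (- l) \<ge> 1)" by (rule nind_eventually_pos[OF assms(6)])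
  qed (use m_pos gcd \<nu> psum r(1) small nind_local_oscillation in auto)
  have powr: "l powr (D / 2) = exp (\<kappa> * (ln l / \<nu>))" if "l > 0" for l
    using that \<nu> by (simp add: powr_def \<kappa>_def)
  \<comment> \<open>The errors are defined so that the asymptotic equation holds exactly; what
    remains is that they tend to 0.\<close>
  define \<epsilon>1 where "\<epsilon>1 l = real (nind l) * exp (- \<kappa> * (ln l / \<nu>)) - R.s (ln l / \<nu>)" for l
  define \<epsilon>2 where "\<epsilon>2 l = real (nind l) * exp (- \<kappa> * (ln \<bar>l\<bar> / \<nu>)) - R.s (ln \<bar>l\<bar> / \<nu> - 1)" for l
  have small_error: "\<exists>L>0. \<forall>l\<ge>L. \<bar>\<epsilon>1 l\<bar> \<le> e \<and> \<bar>\<epsilon>2 (- l)\<bar> \<le> e" if e: "e > 0" for e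
  proof -
    obtain X where X: "\<And>x. x \<ge> X \<Longrightarrow> \<bar>real (nind (exp (\<nu> * x))) * exp (- \<kappa> * x) - R.s x\<bar> \<le> e \<and>
      \<bar>real (nind (- exp (\<nu> * x))) * exp (- \<kappa> * x) - R.s (x - 1)\<bar> \<le> e"
      using R.uniform_asymptotics[OF e] by blast
    have "\<bar>\<epsilon>1 l\<bar> \<le> e \<and> \<bar>\<epsilon>2 (- l)\<bar> \<le> e" if l: "l \<ge> exp (\<nu> * X)" for l
    proof -
      have l0: "l > 0" using l by (rule less_le_trans[OF exp_gt_zero])
      have "\<nu> * X \<le> ln l" using l l0 by (simp add: ln_ge_iff)
      then have "X \<le> ln l / \<nu>" using \<nu> by (simp add: le_divide_eq mult.commute)
      moreover have "exp (\<nu> * (ln l / \<nu>)) = l" using \<nu> l0 by simp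
      ultimately show ?thesis using X[of "ln l / \<nu>"] l0 by (simp add: \<epsilon>1_def \<epsilon>2_def)
    qed
    then show ?thesis by (intro exI[of _ "exp (\<nu> * X)"]) simp
  qed
  have lim1: "(\<epsilon>1 \<longlongrightarrow> 0) at_top"
  proof (rule tendstoI)
    fix e :: real assume "e > 0"
    then obtain L where L: "\<And>l. l \<ge> L \<Longrightarrow> \<bar>\<epsilon>1 l\<bar> \<le> e / 2" using small_error[of "e / 2"] by auto
    show "\<forall>\<^sub>F l in at_top. dist (\<epsilon>1 l) 0 < e"
      using eventually_ge_at_top[of L]
    proof eventually_elim
      case (elim l)
      then show ?case using L[of l] \<open>e > 0\<close> by simp
    qed
  qed
  have lim2: "(\<epsilon>2 \<longlongrightarrow> 0) at_bot"
  proof (rule tendstoI)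
    fix e :: real assume "e > 0"
    then obtain L where L: "\<And>l. l \<ge> L \<Longrightarrow> \<bar>\<epsilon>2 (- l)\<bar> \<le> e / 2" using small_error[of "e / 2"] by auto
    show "\<forall>\<^sub>F l in at_bot. dist (\<epsilon>2 l) 0 < e"
      using eventually_le_at_bot[of "- L"]
    proof eventually_elim
      case (elim l)
      then show ?case using L[of "- l"] \<open>e > 0\<close> by simp
    qed
  qed
  have ev1: "\<forall>\<^sub>F l in at_top. ereal_of_enat (ind (T_pencil P l)) = ereal (l powr (D / 2) * (R.s (ln l / \<nu>) + \<epsilon>1 l))"
    using eventually_gt_at_top[of 0]
  proof eventually_elim
    case (elim l)
    have "l powr (D / 2) * (R.s (ln l / \<nu>) + \<epsilon>1 l) = real (nind l)"
      unfolding powr[OF elim] \<epsilon>1_def by (simp flip: exp_add)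
    then show ?case by (simp add: ind_eq_nind)
  qed
  have ev2: "\<forall>\<^sub>F l in at_bot. ereal_of_enat (ind (T_pencil P l)) = ereal (\<bar>l\<bar> powr (D / 2) * (R.s (ln \<bar>l\<bar> / \<nu> - 1) + \<epsilon>2 l))"
    using eventually_gt_at_bot[of 0]
  proof eventually_elim
    case (elim l)
    then have "\<bar>l\<bar> > 0" by simp
    have "\<bar>l\<bar> powr (D / 2) * (R.s (ln \<bar>l\<bar> / \<nu> - 1) + \<epsilon>2 l) = real (nind l)"
      unfolding powr[OF \<open>\<bar>l\<bar> > 0\<close>] \<epsilon>2_def by (simp flip: exp_add)
    then show ?case by (simp add: ind_eq_nind)
  qed
  show ?thesis
    using R.s_continuous R.s_pos R.s_periodic lim1 ev1 lim2 ev2 by blast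
qed

end
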